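(* Let $G$ be a compact graph with finitely many nodes. If the boundary-value problem $-y''+qy=\lambda By$ on $G$ with boundary conditions (I)–(II) has co-normal (elliptic) boundary conditions and $L$ is positive definite, then the eigenvalues $\lambda_1\le\lambda_2\le\dots$ in $\mathcal{L}^2(G)\cap C^+$ obey the asymptotic development $$\sqrt{\lambda_n}=\frac{n\pi}{\mathrm{length}(G^+)}+O(1),\qquad n\to\infty.$$
   Context: Graph and spaces. $G$ is an oriented graph with finitely many edges $e_1,\dots,e_K$, each of length $1$; $e_i$ is identified with $[0,1]$, with $0$ the initial and $1$ the terminal point. A complex-valued function $y$ on $G$ is a tuple $(y_1,\dots,y_K)$ with $y_i=y|_{e_i}$ a function on $[0,1]$. Put $\mathcal{L}^2(G)=\bigoplus_{i=1}^K L^2(0,1)$ and $\mathcal{H}^m(G)=\bigoplus_{i=1}^K H^m(0,1)$ (Sobolev spaces), $\int_G h\,dt=\sum_i\int_0^1 h_i\,dt$, $(f,g)=\int_G f\bar g\,dt$, $\|f\|^2=(f,f)$. Equation. $q$ is real-valued and essentially bounded on $G$; $b=1$ on the edges $e_1,\dots,e_p$ ($p\ge1$) and $b=-1$ on $e_{p+1},\dots,e_K$; $(By)(x)=b(x)y(x)$; $ly=-y''+qy$. $[f,g]=(Bf,g)$ and $C^+=\{y\in\mathcal{L}^2(G):[y,y]>0\}$. $G^+$ is the subgraph formed by the edges on which $b=1$, and $\mathrm{length}(G^+)$ is its total length (here equal to $p$). Boundary conditions. At the nodes of $G$ one imposes in total $2K$ linearly independent linear homogeneous conditions with constant coefficients,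 each involving only the values of $y$ and $y'$ at the edge ends incident to one node, which are formally self-adjoint, i.e. $(lx,y)=(x,ly)$ for all $x,y\in\mathcal{H}^2(G)$ satisfying the conditions. They are written as (I) $\sum_{j=1}^K[\alpha_{ij}y_j(0)+\gamma_{ij}y_j(1)]=0$, $i=1,\dots,J$; (II) $\sum_{j=1}^K[\alpha_{ij}y_j(0)+\beta_{ij}y_j'(0)+\gamma_{ij}y_j(1)+\delta_{ij}y_j'(1)]=0$, $i=J+1,\dots,2K$, where all Dirichlet-like conditions are in (I), that is, every linear combination of (I)–(II) containing no derivative terms is a linear combination of the conditions (I) alone. Operator. $Lf=-f''+qf$ with domain $\mathcal{D}(L)=\{f: f,f'\in AC,\ Lf\in\mathcal{L}^2(G),\ f\text{ satisfies (I) and (II)}\}$, a self-adjoint operator in $\mathcal{L}^2(G)$. $L$ positive definite means $(Ly,y)>0$ for all $y\in\mathcal{D}(L)\setminus\{0\}$. Co-normal conditions. $\mathcal{D}(F)=\{y\in\mathcal{H}^1(G): y \text{ satisfies (I)}\}$. For a function $y$ on the set $\partial G$ of the $2K$ edge ends, $\int_{\partial G}y\,d\sigma=\sum_{i=1}^K[y_i(1)-y_i(0)]$. The boundary conditions are called co-normal (or elliptic) with respect to $l$ if there is a function $f$ on $\partial G$ (one scalar for each of the $2K$ edge ends) such that, for $x\in\mathcal{D}(F)\cap\mathcal{H}^2(G)$, one has $\int_{\partial G}(fx+x')\bar y\,d\sigma=0$ for all $y\in\mathcal{D}(F)$ if and only if $x$ satisfies (II). Eigenvalues. The eigenvalues in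 $\mathcal{L}^2(G)\cap C^+$ are those eigenvalues of the boundary-value problem $-y''+qy=\lambda By$, (I)–(II), whose eigenfunctions lie in $C^+$, equivalently the positive eigenvalues; they are listed in increasing order and repeated according to multiplicity. *)

theory Defs
  imports
    "HOL-Analysis.Analysis"
    "HOL-Library.Landau_Symbols"
    "HOL-Library.Function_Algebras"
    "Graph_Theory.Digraph"
begin

section \<open>Functions on the graph\<close>

text \<open>
  The edges are numbered \<open>1, \<dots>, K\<close> and each is identified with \<open>[0, 1]\<close>. A function on the
  graph is \<open>y\<close> with \<open>y j t\<close> its value at the point \<open>t \<in> [0, 1]\<close> of edge \<open>j \<in> {1..K}\<close>; its values
  at other arguments are irrelevant. A function on the set of the \<open>2 K\<close> edge ends is given
  in the same way and is only evaluated at \<open>t = 0\<close> and \<open>t = 1\<close>.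
\<close>

type_synonym graph_fun = "nat \<Rightarrow> real \<Rightarrow> complex"

abbreviation unit_edge :: "real measure"
  where "unit_edge \<equiv> lebesgue_on {0..1}"

definition L2_edge :: "(real \<Rightarrow> complex) \<Rightarrow> bool"
  where "L2_edge f \<longleftrightarrow>
    f \<in> borel_measurable unit_edge \<and> integrable unit_edge (\<lambda>t. (cmod (f t))\<^sup>2)"

text \<open>
  \<open>f\<close> is absolutely continuous on \<open>[0, 1]\<close>, i.e. the indefinite integral of a Lebesgue integrable
  function, and \<open>f'\<close> is (a representative of) its a.e. derivative.
\<close>

definition AC_deriv :: "(real \<Rightarrow> complex) \<Rightarrow> (real \<Rightarrow> complex) \<Rightarrow> bool"
  where "AC_deriv f f' \<longleftrightarrow>
    integrable unit_edge f' \<and>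
    (\<forall>t\<in>{0..1}. f t = f 0 + (LINT s|lebesgue_on {0..t}. f' s))"

text \<open>
  Sobolev functions are represented by their absolutely continuous representatives, so that
  boundary values make sense. The derivatives are carried along as further arguments. In
  \<open>graph_H2\<close> and in \<open>dom_L\<close> below, \<open>y'\<close> is itself absolutely continuous, so it is the classical
  derivative at every point of \<open>[0, 1]\<close>, whereas \<open>y''\<close> is determined only up to null sets.
\<close>

definition graph_L2 :: "nat \<Rightarrow> graph_fun \<Rightarrow> bool"
  where "graph_L2 K y \<longleftrightarrow> (\<forall>j\<in>{1..K}. L2_edge (y j))"

definition graph_AC_deriv :: "nat \<Rightarrow> graph_fun \<Rightarrow> graph_fun \<Rightarrow> bool"
  where "graph_AC_deriv K y y' \<longleftrightarrow> (\<forall>j\<in>{1..K}. AC_deriv (y j) (y' j))"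

definition graph_H1 :: "nat \<Rightarrow> graph_fun \<Rightarrow> graph_fun \<Rightarrow> bool"
  where "graph_H1 K y y' \<longleftrightarrow> graph_AC_deriv K y y' \<and> graph_L2 K y'"

definition graph_H2 :: "nat \<Rightarrow> graph_fun \<Rightarrow> graph_fun \<Rightarrow> graph_fun \<Rightarrow> bool"
  where "graph_H2 K y y' y'' \<longleftrightarrow> graph_H1 K y y' \<and> graph_H1 K y' y''"

definition graph_inner :: "nat \<Rightarrow> graph_fun \<Rightarrow> graph_fun \<Rightarrow> complex"
  where "graph_inner K f g = (\<Sum>j=1..K. LINT t|unit_edge. f j t * cnj (g j t))"

definition pos_number :: "complex \<Rightarrow> bool"
  where "pos_number z \<longleftrightarrow> z \<in> \<real> \<and> Re z > 0"

definition nonzero_on_graph :: "nat \<Rightarrow> graph_fun \<Rightarrow> bool"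
  where "nonzero_on_graph K y \<longleftrightarrow> (\<exists>j\<in>{1..K}. \<exists>t\<in>{0..1}. y j t \<noteq> 0)"


section \<open>The differential expression and the indefinite weight\<close>

definition ess_bounded_potential :: "nat \<Rightarrow> (nat \<Rightarrow> real \<Rightarrow> real) \<Rightarrow> bool"
  where "ess_bounded_potential K q \<longleftrightarrow>
    (\<forall>j\<in>{1..K}. q j \<in> borel_measurable unit_edge \<and> (\<exists>C. AE t in unit_edge. \<bar>q j t\<bar> \<le> C))"

definition diff_expr :: "(nat \<Rightarrow> real \<Rightarrow> real) \<Rightarrow> graph_fun \<Rightarrow> graph_fun \<Rightarrow> graph_fun"
  where "diff_expr q y y'' = (\<lambda>j t. - y'' j t + of_real (q j t) * y j t)"

definition weight :: "nat \<Rightarrow> nat \<Rightarrow> real"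
  where "weight p j = (if j \<le> p then 1 else - 1)"

definition mult_weight :: "nat \<Rightarrow> graph_fun \<Rightarrow> graph_fun"
  where "mult_weight p y = (\<lambda>j t. of_real (weight p j) * y j t)"

definition indef_inner :: "nat \<Rightarrow> nat \<Rightarrow> graph_fun \<Rightarrow> graph_fun \<Rightarrow> complex"
  where "indef_inner K p f g = graph_inner K (mult_weight p f) g"

definition C_plus :: "nat \<Rightarrow> nat \<Rightarrow> graph_fun set"
  where "C_plus K p = {y. graph_L2 K y \<and> pos_number (indef_inner K p y y)}"

definition length_G_plus :: "nat \<Rightarrow> nat \<Rightarrow> real"
  where "length_G_plus K p = (\<Sum>j\<in>{j\<in>{1..K}. weight p j = 1}. measure lborel {0..1::real})"


section \<open>Boundary conditions\<close>

text \<open>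
  Row \<open>i\<close>, column \<open>j\<close> of the four coefficient arrays multiply
  \<open>y j 0\<close>, \<open>y' j 0\<close>, \<open>y j 1\<close>, \<open>y' j 1\<close> in this order. Rows \<open>1, \<dots>, num_I\<close> are the conditions (I)
  and rows \<open>num_I + 1, \<dots>, 2 K\<close> are the conditions (II).
\<close>

record bdry_cond =
  num_I :: nat
  bc_alpha :: "nat \<Rightarrow> nat \<Rightarrow> complex"
  bc_beta :: "nat \<Rightarrow> nat \<Rightarrow> complex"
  bc_gamma :: "nat \<Rightarrow> nat \<Rightarrow> complex"
  bc_delta :: "nat \<Rightarrow> nat \<Rightarrow> complex"

definition satisfies_I :: "nat \<Rightarrow> bdry_cond \<Rightarrow> graph_fun \<Rightarrow> bool"
  where "satisfies_I K A y \<longleftrightarrow>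
    (\<forall>i\<in>{1..num_I A}. (\<Sum>j=1..K. bc_alpha A i j * y j 0 + bc_gamma A i j * y j 1) = 0)"

definition satisfies_II :: "nat \<Rightarrow> bdry_cond \<Rightarrow> graph_fun \<Rightarrow> graph_fun \<Rightarrow> bool"
  where "satisfies_II K A y y' \<longleftrightarrow>
    (\<forall>i\<in>{num_I A + 1..2 * K}.
      (\<Sum>j=1..K. bc_alpha A i j * y j 0 + bc_beta A i j * y' j 0
               + bc_gamma A i j * y j 1 + bc_delta A i j * y' j 1) = 0)"

definition dirichlet_rows :: "nat \<Rightarrow> bdry_cond \<Rightarrow> bool"
  where "dirichlet_rows K A \<longleftrightarrow>
    num_I A \<le> 2 * K \<and>
    (\<forall>i\<in>{1..num_I A}. \<forall>j\<in>{1..K}. bc_beta A i j = 0 \<and> bc_delta A i j = 0)"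

definition independent_rows :: "nat \<Rightarrow> bdry_cond \<Rightarrow> bool"
  where "independent_rows K A \<longleftrightarrow>
    (\<forall>c :: nat \<Rightarrow> complex.
      (\<forall>j\<in>{1..K}. (\<Sum>i=1..2*K. c i * bc_alpha A i j) = 0 \<and> (\<Sum>i=1..2*K. c i * bc_beta A i j) = 0 \<and>
                 (\<Sum>i=1..2*K. c i * bc_gamma A i j) = 0 \<and> (\<Sum>i=1..2*K. c i * bc_delta A i j) = 0)
      \<longrightarrow> (\<forall>i\<in>{1..2*K}. c i = 0))"

text \<open>
  Every linear combination of the conditions in which no derivative occurs is a linear
  combination of the conditions (I) alone.
\<close>

definition all_dirichlet_in_I :: "nat \<Rightarrow> bdry_cond \<Rightarrow> bool"
  where "all_dirichlet_in_I K A \<longleftrightarrow>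
    (\<forall>c :: nat \<Rightarrow> complex.
      (\<forall>j\<in>{1..K}. (\<Sum>i=1..2*K. c i * bc_beta A i j) = 0 \<and> (\<Sum>i=1..2*K. c i * bc_delta A i j) = 0)
      \<longrightarrow> (\<exists>d :: nat \<Rightarrow> complex. \<forall>j\<in>{1..K}.
            (\<Sum>i=1..2*K. c i * bc_alpha A i j) = (\<Sum>i=1..num_I A. d i * bc_alpha A i j) \<and>
            (\<Sum>i=1..2*K. c i * bc_gamma A i j) = (\<Sum>i=1..num_I A. d i * bc_gamma A i j)))"

text \<open>
  Each single condition involves only edge ends incident to one node: the end \<open>t = 0\<close> of an edge
  sits at its tail and the end \<open>t = 1\<close> at its head.
\<close>

definition nodal_conditions :: "('v, nat) pre_digraph \<Rightarrow> nat \<Rightarrow> bdry_cond \<Rightarrow> bool"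
  where "nodal_conditions G K A \<longleftrightarrow>
    (\<forall>i\<in>{1..2*K}. \<exists>v\<in>verts G. \<forall>j\<in>{1..K}.
      (bc_alpha A i j \<noteq> 0 \<or> bc_beta A i j \<noteq> 0 \<longrightarrow> tail G j = v) \<and>
      (bc_gamma A i j \<noteq> 0 \<or> bc_delta A i j \<noteq> 0 \<longrightarrow> head G j = v))"

definition formally_self_adjoint :: "nat \<Rightarrow> (nat \<Rightarrow> real \<Rightarrow> real) \<Rightarrow> bdry_cond \<Rightarrow> bool"
  where "formally_self_adjoint K q A \<longleftrightarrow>
    (\<forall>x x' x'' y y' y''.
      graph_H2 K x x' x'' \<and> satisfies_I K A x \<and> satisfies_II K A x x' \<and>
      graph_H2 K y y' y'' \<and> satisfies_I K A y \<and> satisfies_II K A y y' \<longrightarrow>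
      graph_inner K (diff_expr q x x'') y = graph_inner K x (diff_expr q y y''))"

text \<open>The integral over the edge ends, with the orientation signs of the fundamental theorem.\<close>

definition bdry_integral :: "nat \<Rightarrow> graph_fun \<Rightarrow> complex"
  where "bdry_integral K h = (\<Sum>j=1..K. h j 1 - h j 0)"

definition dom_F :: "nat \<Rightarrow> bdry_cond \<Rightarrow> graph_fun set"
  where "dom_F K A = {y. (\<exists>y'. graph_H1 K y y') \<and> satisfies_I K A y}"

definition co_normal :: "nat \<Rightarrow> bdry_cond \<Rightarrow> bool"
  where "co_normal K A \<longleftrightarrow>
    (\<exists>f :: graph_fun. \<forall>x x' x''. x \<in> dom_F K A \<and> graph_H2 K x x' x'' \<longrightarrow>
      ((\<forall>y\<in>dom_F K A. bdry_integral K (\<lambda>j t. (f j t * x j t + x' j t) * cnj (y j t)) = 0)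
        \<longleftrightarrow> satisfies_II K A x x'))"


section \<open>The operator and the eigenvalue problem\<close>

definition dom_L :: "nat \<Rightarrow> (nat \<Rightarrow> real \<Rightarrow> real) \<Rightarrow> bdry_cond \<Rightarrow>
    graph_fun \<Rightarrow> graph_fun \<Rightarrow> graph_fun \<Rightarrow> bool"
  where "dom_L K q A y y' y'' \<longleftrightarrow>
    graph_AC_deriv K y y' \<and> graph_AC_deriv K y' y'' \<and> graph_L2 K (diff_expr q y y'') \<and>
    satisfies_I K A y \<and> satisfies_II K A y y'"

definition L_positive_definite :: "nat \<Rightarrow> (nat \<Rightarrow> real \<Rightarrow> real) \<Rightarrow> bdry_cond \<Rightarrow> bool"
  where "L_positive_definite K q A \<longleftrightarrow>
    (\<forall>y y' y''. dom_L K q A y y' y'' \<and> nonzero_on_graph K y \<longrightarrow>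
      pos_number (graph_inner K (diff_expr q y y'') y))"

text \<open>
  Solutions are normalised to vanish at the arguments outside the graph, so that the
  eigenspace is a linear subspace of \<^typ>\<open>graph_fun\<close> of the correct dimension.
\<close>

definition eigenspace :: "nat \<Rightarrow> nat \<Rightarrow> (nat \<Rightarrow> real \<Rightarrow> real) \<Rightarrow> bdry_cond \<Rightarrow> complex \<Rightarrow> graph_fun set"
  where "eigenspace K p q A \<mu> =
    {y. (\<forall>j t. \<not> (j \<in> {1..K} \<and> t \<in> {0..1}) \<longrightarrow> y j t = 0) \<and>
        (\<exists>y' y''. dom_L K q A y y' y'' \<and>
          (\<forall>j\<in>{1..K}. AE t in unit_edge. diff_expr q y y'' j t = \<mu> * mult_weight p y j t))}"

definition graph_scale :: "complex \<Rightarrow> graph_fun \<Rightarrow> graph_fun"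
  where "graph_scale c y = (\<lambda>j t. c * y j t)"

lemma vector_space_graph_scale: "vector_space graph_scale"
  by unfold_locales (auto simp: graph_scale_def fun_eq_iff algebra_simps)

definition multiplicity_of ::
    "nat \<Rightarrow> nat \<Rightarrow> (nat \<Rightarrow> real \<Rightarrow> real) \<Rightarrow> bdry_cond \<Rightarrow> complex \<Rightarrow> nat"
  where "multiplicity_of K p q A \<mu> = vector_space.dim graph_scale (eigenspace K p q A \<mu>)"

definition eigenvalues_C_plus ::
    "nat \<Rightarrow> nat \<Rightarrow> (nat \<Rightarrow> real \<Rightarrow> real) \<Rightarrow> bdry_cond \<Rightarrow> complex set"
  where "eigenvalues_C_plus K p q A =
    {\<mu>. (\<exists>y\<in>eigenspace K p q A \<mu>. nonzero_on_graph K y) \<and>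
        (\<forall>y\<in>eigenspace K p q A \<mu>. nonzero_on_graph K y \<longrightarrow> y \<in> C_plus K p)}"

text \<open>
  \<open>lam 1 \<le> lam 2 \<le> \<dots>\<close> runs exactly through the eigenvalues with eigenfunctions in \<open>C\<^sup>+\<close>, each
  as often as its multiplicity; \<open>lam 0\<close> plays no role.
\<close>

definition lists_eigenvalues_C_plus ::
    "nat \<Rightarrow> nat \<Rightarrow> (nat \<Rightarrow> real \<Rightarrow> real) \<Rightarrow> bdry_cond \<Rightarrow> (nat \<Rightarrow> real) \<Rightarrow> bool"
  where "lists_eigenvalues_C_plus K p q A lam \<longleftrightarrow>
    mono_on {1..} lam \<and>
    (\<forall>\<mu> :: complex.
      finite {n\<in>{1..}. of_real (lam n) = \<mu>} \<and>
      card {n\<in>{1..}. of_real (lam n) = \<mu>} =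
        (if \<mu> \<in> eigenvalues_C_plus K p q A then multiplicity_of K p q A \<mu> else 0))"

end

theory Submission
  imports Defs "HOL-Complex_Analysis.Great_Picard"
begin

text \<open>
  Let \<open>V\<close> be the space of functions that are \<open>C\<^sup>1\<close> on each edge and satisfy (I), let \<open>F\<close> be the
  quadratic form of \<open>L\<close>, with the boundary term supplied by the co-normal conditions, and let
  \<open>Q\<close> be the indefinite form \<open>[y, y]\<close>. Eigenfunctions satisfy \<open>F(y, z) = \<lambda> Q(y, z)\<close> for
  \<open>z \<in> V\<close>, and the number \<open>N(r)\<close> of eigenvalues in \<open>(0, r]\<close> is the size of a maximal
  \<open>Q\<close>-orthonormal set of such eigenfunctions.

  Upper bound: if such a set had more than \<open>2 K + p m\<close> elements, a combination of them would
  vanish at all edge ends and at the points \<open>i / (m + 1)\<close> of the positive edges. The Wirtinger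
  inequality on the resulting intervals contradicts \<open>F \<le> r Q\<close> once
  \<open>((m + 1) \<pi>)\<^sup>2 > r + 2 \<parallel>q\<parallel>\<close>.

  Lower bound: if \<open>(m \<pi>)\<^sup>2 + \<parallel>q\<parallel> < r\<close> and \<open>N(r) < p m\<close>, a combination of the functions
  \<open>sin (k \<pi> t)\<close>, \<open>k \<le> m\<close>, on the positive edges is \<open>Q\<close>-orthogonal to all eigenfunctions counted by
  \<open>N(r)\<close> and satisfies \<open>F < r Q\<close>. Minimising \<open>F / Q\<close> on the orthogonal complement then yields a
  further eigenfunction with eigenvalue below \<open>r\<close>. A minimising sequence converges uniformly by
  Arzela-Ascoli. By the Cauchy-Schwarz inequality for \<open>F - \<lambda> Q\<close> its limit is a very weak solution,
  hence a solution, so no completeness of Sobolev spaces is needed. The same minimisation with \<open>Q\<close>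
  replaced by the \<open>L\<^sup>2\<close> norm turns positivity of \<open>L\<close> into coercivity of \<open>F\<close>.
\<close>

section \<open>Continuously differentiable functions on an edge\<close>

text \<open>Three obstacles shape the argument. Positivity of \<open>L\<close> is known only on its
  domain, whereas the variational method needs it on all of \<open>V\<close>, where (II) is not
  imposed; a minimiser over \<open>V\<close> acquires (II) as a natural boundary condition, and this
  carries positivity over. The co-normal function \<open>f\<close> is an arbitrary complex scalar at
  each edge end, so the symmetry of the boundary term in \<open>F\<close> has to be extracted from
  formal self-adjointness. The form \<open>Q\<close> is indefinite, so
  \<open>F - \<lambda> Q\<close> is nonnegative only on the orthogonal complement over which
  \<open>\<lambda>\<close> is the infimum of the quotient; statements proved there are extended to
  \<open>V\<close> through the eigenfunctions already found. In the upper bound, one copy of the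
  bound of \<open>q\<close> is spent on the positive edges. The other keeps the comparison constant
  above the bound of \<open>q\<close>, which settles the negative edges, where \<open>Q\<close> is
  negative and no zeros are imposed.\<close>

lemmas LINT_cong = Bochner_Integration.integral_cong
  and LINT_add = Bochner_Integration.integral_add
  and LINT_diff = Bochner_Integration.integral_diff

lemma integrable_continuous_edge:
  fixes f :: "real \<Rightarrow> 'a::euclidean_space"
  shows "continuous_on {0..1} f \<Longrightarrow> integrable unit_edge f"
  by (rule continuous_imp_integrable_real)

lemma LINT_unit_edge_eq_integral:
  fixes f :: "real \<Rightarrow> 'a::euclidean_space"
  shows "continuous_on {0..1} f \<Longrightarrow> (LINT t|unit_edge. f t) = integral {0..1} f"
  by (rule lebesgue_integral_eq_integral[OF integrable_continuous_edge]) auto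

text \<open>The derivative is one-sided at the ends. Products of such functions and their
  derivatives are continuous, so the Lebesgue integral over the edge agrees with the gauge integral
  and the fundamental theorem of calculus applies at every point.\<close>

definition C1_edge :: "(real \<Rightarrow> 'a::euclidean_space) \<Rightarrow> (real \<Rightarrow> 'a) \<Rightarrow> bool"
  where "C1_edge f f' \<longleftrightarrow> continuous_on {0..1} f' \<and>
    (\<forall>t\<in>{0..1}. (f has_vector_derivative f' t) (at t within {0..1}))"

lemma C1_edge_deriv:
  "C1_edge f f' \<Longrightarrow> t \<in> {0..1} \<Longrightarrow> (f has_vector_derivative f' t) (at t within {0..1})"
  by (simp add: C1_edge_def)

lemma C1_edge_continuous_deriv: "C1_edge f f' \<Longrightarrow> continuous_on {0..1} f'"
  by (simp add: C1_edge_def)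

lemma C1_edge_continuous: "C1_edge f f' \<Longrightarrow> continuous_on {0..1} f"
  by (simp add: C1_edge_def continuous_on_eq_continuous_within)
    (blast intro: has_vector_derivative_continuous)

lemma C1_edge_add: "C1_edge f f' \<Longrightarrow> C1_edge g g' \<Longrightarrow> C1_edge (\<lambda>t. f t + g t) (\<lambda>t. f' t + g' t)"
  by (auto simp: C1_edge_def intro!: continuous_intros derivative_eq_intros)

lemma C1_edge_cmult:
  fixes f :: "real \<Rightarrow> complex"
  shows "C1_edge f f' \<Longrightarrow> C1_edge (\<lambda>t. c * f t) (\<lambda>t. c * f' t)"
  by (auto simp: C1_edge_def intro!: continuous_intros has_vector_derivative_mult_right)

lemma C1_edge_cnj: "C1_edge f f' \<Longrightarrow> C1_edge (\<lambda>t. cnj (f t)) (\<lambda>t. cnj (f' t))"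
  by (auto simp: C1_edge_def intro!: continuous_intros has_vector_derivative_cnj)

lemma C1_edge_mult:
  fixes f g :: "real \<Rightarrow> complex"
  assumes "C1_edge f f'" "C1_edge g g'"
  shows "C1_edge (\<lambda>t. f t * g t) (\<lambda>t. f' t * g t + f t * g' t)"
  unfolding C1_edge_def
proof (intro conjI ballI)
  show "continuous_on {0..1} (\<lambda>t. f' t * g t + f t * g' t)"
    by (intro continuous_intros C1_edge_continuous[OF assms(1)] C1_edge_continuous[OF assms(2)]
        assms[THEN C1_edge_continuous_deriv])
  fix t :: real assume "t \<in> {0..1}"
  then show "((\<lambda>t. f t * g t) has_vector_derivative f' t * g t + f t * g' t) (at t within {0..1})"
    using has_vector_derivative_mult[OF assms[THEN C1_edge_deriv]]
    by (simp add: algebra_simps)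
qed

lemma C1_edge_const: "C1_edge (\<lambda>t. c) (\<lambda>t. 0)"
  by (auto simp: C1_edge_def intro!: continuous_intros derivative_eq_intros)

lemma C1_edge_of_real: "C1_edge (\<lambda>t. complex_of_real t) (\<lambda>t. 1)"
  unfolding C1_edge_def
  by (auto intro!: continuous_intros derivative_eq_intros has_vector_derivative_of_real)

lemma C1_edge_cong:
  assumes "C1_edge f f'" "\<And>t. t \<in> {0..1} \<Longrightarrow> f t = g t" "\<And>t. t \<in> {0..1} \<Longrightarrow> f' t = g' t"
  shows "C1_edge g g'"
  unfolding C1_edge_def
proof (intro conjI ballI)
  show "continuous_on {0..1} g'"
    using C1_edge_continuous_deriv[OF assms(1)] assms(3)
    by (rule continuous_on_eq)
  fix t :: real assume t: "t \<in> {0..1}"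
  show "(g has_vector_derivative g' t) (at t within {0..1})"
    by (rule has_vector_derivative_transform[OF t _ C1_edge_deriv[OF assms(1) t, unfolded assms(3)[OF t]]])
      (use assms(2) in auto)
qed

lemma LINT_C1_edge: "C1_edge f f' \<Longrightarrow> (LINT t|unit_edge. f' t) = f 1 - f 0"
  unfolding C1_edge_def
  by (subst LINT_unit_edge_eq_integral) (auto intro!: integral_unique fundamental_theorem_of_calculus)

lemma LINT_by_parts:
  fixes f g :: "real \<Rightarrow> complex"
  assumes "C1_edge f f'" "C1_edge g g'"
  shows "(LINT t|unit_edge. f' t * g t) = f 1 * g 1 - f 0 * g 0 - (LINT t|unit_edge. f t * g' t)"
proof -
  have "(LINT t|unit_edge. f' t * g t + f t * g' t) = f 1 * g 1 - f 0 * g 0"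
    using LINT_C1_edge[OF C1_edge_mult[OF assms]] by simp
  moreover have "(LINT t|unit_edge. f' t * g t + f t * g' t)
      = (LINT t|unit_edge. f' t * g t) + (LINT t|unit_edge. f t * g' t)"
    by (intro LINT_add integrable_continuous_edge continuous_intros
        C1_edge_continuous[OF assms(1)] C1_edge_continuous[OF assms(2)] assms[THEN C1_edge_continuous_deriv])
  ultimately show ?thesis by (simp add: algebra_simps)
qed

section \<open>Primitives of integrable functions and absolute continuity\<close>

lemma integrable_lebesgue_on_subinterval:
  fixes f :: "real \<Rightarrow> 'a::euclidean_space"
  assumes "integrable unit_edge f" "{a..b} \<subseteq> {0..1}"
  shows "integrable (lebesgue_on {a..b}) f"
proof -
  have "set_integrable lebesgue {0..1} f"
    using assms(1) by (simp add: integrable_restrict_space set_integrable_def)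
  then have "set_integrable lebesgue {a..b} f"
    by (rule set_integrable_subset) (use assms in auto)
  then show ?thesis by (simp add: integrable_restrict_space set_integrable_def)
qed

text \<open>The integral occurring in \<open>AC_deriv\<close>, isolated so that absolute continuity
  reads \<open>f t = f 0 + primitive f' t\<close> on the edge.\<close>

definition primitive :: "(real \<Rightarrow> complex) \<Rightarrow> real \<Rightarrow> complex"
  where "primitive g t = (LINT s|lebesgue_on {0..t}. g s)"

lemma primitive_0 [simp]: "primitive g 0 = 0"
proof -
  have "AE x in lebesgue_on {0::real}. g x = 0"
    by (subst AE_restrict_space_iff, simp, rule AE_I'[of "{0}"]) auto
  then show ?thesis
    by (simp add: primitive_def integral_eq_zero_AE)
qed

lemma primitive_eq_integral:
  assumes "integrable unit_edge g" "t \<in> {0..1}"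
  shows "primitive g t = integral {0..t} g"
  unfolding primitive_def
  by (rule lebesgue_integral_eq_integral[OF integrable_lebesgue_on_subinterval[OF assms(1)]])
    (use assms in auto)

lemma continuous_on_primitive:
  assumes "integrable unit_edge g"
  shows "continuous_on {0..1} (primitive g)"
proof -
  have "g integrable_on {0..1}"
    using assms by (simp add: integrable_on_lebesgue_on)
  then have "continuous_on {0..1} (\<lambda>t. integral {0..t} g)"
    by (rule indefinite_integral_continuous_1)
  then show ?thesis
    by (rule continuous_on_eq) (simp add: primitive_eq_integral[OF assms])
qed

lemma C1_edge_primitive:
  assumes "continuous_on {0..1} g"
  shows "C1_edge (primitive g) g"
proof (rule C1_edge_cong)
  show "C1_edge (\<lambda>t. integral {0..t} g) g"
    using assms integral_has_vector_derivative[OF assms] by (simp add: C1_edge_def)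
qed (use primitive_eq_integral[OF integrable_continuous_edge[OF assms]] in auto)

lemma AC_deriv_iff_primitive:
  "AC_deriv f f' \<longleftrightarrow> integrable unit_edge f' \<and> (\<forall>t\<in>{0..1}. f t = f 0 + primitive f' t)"
  by (simp add: AC_deriv_def primitive_def)

lemma AC_deriv_eq: "AC_deriv f f' \<Longrightarrow> t \<in> {0..1} \<Longrightarrow> f 0 + primitive f' t = f t"
  unfolding AC_deriv_iff_primitive by metis

lemma AC_deriv_continuous: "AC_deriv f f' \<Longrightarrow> continuous_on {0..1} f"
  by (rule continuous_on_eq[of _ "\<lambda>t. f 0 + primitive f' t"])
    (auto simp: AC_deriv_eq intro!: continuous_intros continuous_on_primitive, simp add: AC_deriv_def)

lemma AC_deriv_imp_C1_edge:
  assumes "AC_deriv f f'" "continuous_on {0..1} f'"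
  shows "C1_edge f f'"
proof (rule C1_edge_cong)
  show "C1_edge (\<lambda>t. f 0 + primitive f' t) (\<lambda>t. 0 + f' t)"
    by (intro C1_edge_add C1_edge_const C1_edge_primitive assms)
qed (use assms AC_deriv_eq in auto)

lemma C1_edge_imp_AC_deriv:
  assumes "C1_edge f f'"
  shows "AC_deriv f f'"
  unfolding AC_deriv_iff_primitive
proof (intro conjI ballI)
  show int: "integrable unit_edge f'"
    by (intro integrable_continuous_edge C1_edge_continuous_deriv[OF assms])
  fix t :: real assume t: "t \<in> {0..1}"
  have "(f' has_integral f t - f 0) {0..t}"
    by (rule fundamental_theorem_of_calculus)
      (use t in \<open>auto intro!: has_vector_derivative_within_subset[OF C1_edge_deriv[OF assms]]\<close>)
  then show "f t = f 0 + primitive f' t"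
    using int t by (simp add: primitive_eq_integral integral_unique)
qed

lemma integrable_mult_continuous:
  fixes g z :: "real \<Rightarrow> complex"
  assumes "integrable unit_edge g" "continuous_on {0..1} z"
  shows "integrable unit_edge (\<lambda>t. g t * z t)"
proof -
  obtain B where B: "\<And>t. t \<in> {0..1} \<Longrightarrow> cmod (z t) \<le> B"
    using compact_imp_bounded[OF compact_continuous_image[OF assms(2) compact_Icc]]
    by (fastforce simp: bounded_iff)
  show ?thesis
  proof (rule Bochner_Integration.integrable_bound[where f="\<lambda>t. B * cmod (g t)"])
    show "integrable unit_edge (\<lambda>t. B * cmod (g t))"
      using assms by simp
    show "(\<lambda>t. g t * z t) \<in> borel_measurable unit_edge"
      by (intro borel_measurable_times borel_measurable_integrable integrable_continuous_edge assms)
    show "AE t in unit_edge. cmod (g t * z t) \<le> norm (B * cmod (g t))"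
    proof (rule AE_I2)
      fix t assume "t \<in> space unit_edge"
      then have "cmod (z t) \<le> B" using B by simp
      then have "cmod (g t) * cmod (z t) \<le> cmod (g t) * B"
        by (intro mult_left_mono) auto
      also have "\<dots> \<le> \<bar>B * cmod (g t)\<bar>" by (simp add: mult.commute)
      finally show "cmod (g t * z t) \<le> norm (B * cmod (g t))" by (simp add: norm_mult)
    qed
  qed
qed

section \<open>Integration by parts, Wirtinger and trace inequalities\<close>

text \<open>Fubini for \<open>g s * z' t\<close> on the triangle \<open>s \<le> t\<close>: one order
  of integration produces the primitive, the other \<open>g s * (z 1 - z s)\<close>. Second
  derivatives of solutions are only integrable, so the pointwise product rule behind
  \<open>LINT_by_parts\<close> does not apply to them.\<close>

lemma LINT_primitive_mult:
  assumes g: "integrable unit_edge g" and z: "C1_edge z z'"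
  shows "(LINT t|unit_edge. primitive g t * z' t) = primitive g 1 * z 1 - (LINT t|unit_edge. g t * z t)"
proof -
  let ?M = "unit_edge"
  define h where "h = (\<lambda>s t. (if s \<le> t then g s * z' t else 0))"
  have sf: "sigma_finite_measure ?M" by (rule finite_measure.axioms(1)[OF finite_measure_lebesgue_on]) simp
  then interpret pair_sigma_finite ?M ?M by (simp add: pair_sigma_finite_def)
  note z'c = C1_edge_continuous_deriv[OF z]
  have z'i: "integrable ?M z'" by (rule integrable_continuous_edge[OF z'c])
  have [measurable]: "g \<in> borel_measurable ?M" "z' \<in> borel_measurable ?M"
    using g z'i by auto
  have id: "(\<lambda>x::real. x) \<in> borel_measurable ?M"
    using integrable_continuous_edge[of "\<lambda>x::real. x"] by auto
  have [measurable]: "(\<lambda>p. fst p) \<in> borel_measurable (?M \<Otimes>\<^sub>M ?M)" "(\<lambda>p. snd p) \<in> borel_measurable (?M \<Otimes>\<^sub>M ?M)"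
    by (rule measurable_compose[OF measurable_fst id], rule measurable_compose[OF measurable_snd id])
  have prod: "integrable (?M \<Otimes>\<^sub>M ?M) (\<lambda>p. g (fst p) * z' (snd p))"
  proof (rule Fubini_integrable)
    show "(\<lambda>p. g (fst p) * z' (snd p)) \<in> borel_measurable (?M \<Otimes>\<^sub>M ?M)" by measurable
    have "integrable ?M (\<lambda>x. norm (g x) * (LINT y|?M. norm (z' y)))"
      using g by (intro integrable_mult_left integrable_norm) auto
    then show "integrable ?M (\<lambda>x. LINT y|?M. norm (g (fst (x, y)) * z' (snd (x, y))))"
      by (simp add: norm_mult)
    show "AE x in ?M. integrable ?M (\<lambda>y. g (fst (x, y)) * z' (snd (x, y)))"
      using z'i by (intro AE_I2) auto
  qed
  have hi: "integrable (?M \<Otimes>\<^sub>M ?M) (case_prod h)"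
  proof (rule Bochner_Integration.integrable_bound[OF prod])
    have "(\<lambda>p. if fst p \<le> snd p then g (fst p) * z' (snd p) else 0) \<in> borel_measurable (?M \<Otimes>\<^sub>M ?M)"
      by measurable
    then show "case_prod h \<in> borel_measurable (?M \<Otimes>\<^sub>M ?M)"
      by (simp add: h_def case_prod_beta')
    show "AE p in ?M \<Otimes>\<^sub>M ?M. norm (case_prod h p) \<le> norm (g (fst p) * z' (snd p))"
      by (intro AE_I2) (auto simp: h_def)
  qed
  have fub: "(LINT t|?M. (LINT s|?M. h s t)) = (LINT s|?M. (LINT t|?M. h s t))"
    by (rule Fubini_integral[OF hi])
  \<comment> \<open>Both inner integrals run over part of the edge: \<open>{0..t}\<close> in one
    order and \<open>{s..1}\<close> in the other.\<close>
  have cut: "(LINT s|?M. (if P s then f s else 0)) = (LINT s|lebesgue_on S. f s)"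
    if "S \<subseteq> {0..1}" "S \<in> sets lebesgue" "\<And>s. s \<in> {0..1} \<Longrightarrow> P s \<longleftrightarrow> s \<in> S"
    for P and f :: "real \<Rightarrow> complex" and S
  proof -
    have "(LINT s|?M. (if P s then f s else 0)) = (LINT s|lebesgue. indicator {0..1} s *\<^sub>R (if P s then f s else 0))"
      by (rule integral_restrict_space) simp
    also have "\<dots> = (LINT s|lebesgue. indicator S s *\<^sub>R f s)"
      by (rule LINT_cong) (use that in \<open>auto simp: indicator_def\<close>)
    also have "\<dots> = (LINT s|lebesgue_on S. f s)"
      using that(2) by (intro integral_restrict_space[symmetric]) simp
    finally show ?thesis .
  qed
  have "(LINT t|?M. (LINT s|?M. h s t)) = (LINT t|?M. primitive g t * z' t)"
  proof (rule LINT_cong[OF refl])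
    fix t assume "t \<in> space ?M"
    then have t: "t \<in> {0..1}" by simp
    have "(LINT s|?M. h s t) = (LINT s|?M. (if s \<le> t then g s else 0) * z' t)"
      by (rule LINT_cong) (auto simp: h_def)
    also have "\<dots> = (LINT s|?M. (if s \<le> t then g s else 0)) * z' t"
      by simp
    also have "(LINT s|?M. (if s \<le> t then g s else 0)) = primitive g t"
      unfolding primitive_def by (rule cut) (use t in auto)
    finally show "(LINT s|?M. h s t) = primitive g t * z' t" .
  qed
  moreover have "(LINT s|?M. (LINT t|?M. h s t)) = (LINT s|?M. g s * z 1 - g s * z s)"
  proof (rule LINT_cong[OF refl])
    fix s assume "s \<in> space ?M"
    then have s: "s \<in> {0..1}" by simp
    have "(LINT t|?M. h s t) = (LINT t|?M. g s * (if s \<le> t then z' t else 0))"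
      by (rule LINT_cong) (auto simp: h_def)
    also have "\<dots> = g s * (LINT t|?M. (if s \<le> t then z' t else 0))"
      by simp
    also have "(LINT t|?M. (if s \<le> t then z' t else 0)) = (LINT t|lebesgue_on {s..1}. z' t)"
      by (rule cut) (use s in auto)
    also have "\<dots> = integral {s..1} z'"
      by (rule lebesgue_integral_eq_integral[OF integrable_lebesgue_on_subinterval[OF z'i]]) (use s in auto)
    also have "\<dots> = z 1 - z s"
      by (intro integral_unique fundamental_theorem_of_calculus)
        (use s in \<open>auto intro!: has_vector_derivative_within_subset[OF C1_edge_deriv[OF z]]\<close>)
    finally show "(LINT t|?M. h s t) = g s * z 1 - g s * z s"
      by (simp add: algebra_simps)
  qed
  moreover have "(LINT s|?M. g s * z 1 - g s * z s) = (LINT s|?M. g s * z 1) - (LINT s|?M. g s * z s)"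
    by (intro LINT_diff integrable_mult_continuous[OF g] C1_edge_continuous[OF z])
      (use g in auto)
  moreover have "(LINT s|?M. g s * z 1) = primitive g 1 * z 1"
    by (simp add: primitive_def)
  ultimately show ?thesis using fub by metis
qed

text \<open>Splitting off the constant \<open>g 0\<close> reduces the claim to
  \<open>LINT_primitive_mult\<close>, since \<open>g - g 0\<close> is the primitive of
  \<open>g'\<close>.\<close>

lemma LINT_AC_by_parts:
  assumes g: "AC_deriv g g'" and z: "C1_edge z z'"
  shows "(LINT t|unit_edge. g' t * z t) = g 1 * z 1 - g 0 * z 0 - (LINT t|unit_edge. g t * z' t)"
proof -
  have g': "integrable unit_edge g'" using g by (simp add: AC_deriv_def)
  have zi: "integrable unit_edge z'"
    by (rule integrable_continuous_edge[OF C1_edge_continuous_deriv[OF z]])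
  have "(LINT t|unit_edge. g t * z' t) = (LINT t|unit_edge. g 0 * z' t + primitive g' t * z' t)"
    by (rule LINT_cong) (simp_all add: AC_deriv_eq[OF g] flip: distrib_right)
  also have "\<dots> = g 0 * (LINT t|unit_edge. z' t) + (LINT t|unit_edge. primitive g' t * z' t)"
    using zi
    by (subst LINT_add)
      (auto intro!: integrable_continuous_edge continuous_intros continuous_on_primitive[OF g']
        C1_edge_continuous_deriv[OF z])
  also have "\<dots> = g 0 * (z 1 - z 0) + (primitive g' 1 * z 1 - (LINT t|unit_edge. g' t * z t))"
    by (simp add: LINT_C1_edge[OF z] LINT_primitive_mult[OF g' z])
  finally have "(LINT t|unit_edge. g t * z' t)
      = (g 0 + primitive g' 1) * z 1 - g 0 * z 0 - (LINT t|unit_edge. g' t * z t)"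
    by (simp add: algebra_simps)
  then show ?thesis using AC_deriv_eq[OF g, of 1] by simp
qed

lemma continuous_nonneg_LINT_eq_0:
  fixes f :: "real \<Rightarrow> real"
  assumes "continuous_on {0..1} f" "\<And>t. t \<in> {0..1} \<Longrightarrow> 0 \<le> f t" "(LINT t|unit_edge. f t) = 0" "t \<in> {0..1}"
  shows "f t = 0"
proof -
  have "(f has_integral 0) (cbox 0 1)"
    using assms integrable_continuous_interval[OF assms(1)]
    by (simp add: LINT_unit_edge_eq_integral has_integral_iff)
  then show ?thesis
    using has_integral_0_cbox_imp_0[of 0 1 f t] assms by auto
qed

section \<open>Inequalities between a function and its derivative on one edge\<close>

lemma has_vector_derivative_inner_self:
  fixes y :: "real \<Rightarrow> complex"
  assumes "(y has_vector_derivative y') (at t within S)"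
  shows "((\<lambda>t. (cmod (y t))\<^sup>2) has_vector_derivative 2 * (y t \<bullet> y')) (at t within S)"
  using bounded_bilinear.has_vector_derivative[OF bounded_bilinear_inner assms assms]
  by (simp add: power2_norm_eq_inner inner_commute)

text \<open>Picone's identity: with \<open>r = c cot (\<delta> + c (t - a))\<close>, which satisfies \<open>r' = - c\<^sup>2 - r\<^sup>2\<close>, one has
  \<open>\<bar>y'\<bar>\<^sup>2 - c\<^sup>2 \<bar>y\<bar>\<^sup>2 = \<bar>y' - r y\<bar>\<^sup>2 + (r \<bar>y\<bar>\<^sup>2)'\<close>.\<close>

lemma wirtinger_interval:
  fixes y y' :: "real \<Rightarrow> complex"
  assumes ab: "a \<le> b" and c: "0 < c" "c * (b - a) < pi"
    and y: "\<And>t. t \<in> {a..b} \<Longrightarrow> (y has_vector_derivative y' t) (at t within {a..b})"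
    and y'c: "continuous_on {a..b} y'" and y0: "y a = 0" "y b = 0"
  shows "c\<^sup>2 * integral {a..b} (\<lambda>t. (cmod (y t))\<^sup>2) \<le> integral {a..b} (\<lambda>t. (cmod (y' t))\<^sup>2)"
proof -
  \<comment> \<open>Half of the slack \<open>pi - c (b - a)\<close>: the phase \<open>ph\<close>
    then runs from \<open>d\<close> to \<open>pi - d\<close>, so the cotangent stays finite on the
    closed interval.\<close>
  define d where "d = (pi - c * (b - a)) / 2"
  define ph where "ph = (\<lambda>t. d + c * (t - a))"
  define r where "r = (\<lambda>t. c * cos (ph t) / sin (ph t))"
  have ph_bd: "0 < ph t \<and> ph t < pi" if "t \<in> {a..b}" for t
  proof -
    have "0 \<le> c * (t - a)" "c * (t - a) \<le> c * (b - a)"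
      using that c by auto
    moreover have "2 * d = pi - c * (b - a)" by (simp add: d_def)
    ultimately show ?thesis using c unfolding ph_def by linarith
  qed
  have s0: "sin (ph t) \<noteq> 0" if "t \<in> {a..b}" for t
    using sin_gt_zero[of "ph t"] ph_bd[OF that] by auto
  have yc: "continuous_on {a..b} y"
    unfolding continuous_on_eq_continuous_within
    using has_vector_derivative_continuous[OF y] by blast
  have phc: "continuous_on {a..b} ph" unfolding ph_def by (intro continuous_intros)
  have rc: "continuous_on {a..b} r"
    unfolding r_def using s0 by (intro continuous_intros phc) auto
  have r': "(r has_vector_derivative (- c\<^sup>2 - (r t)\<^sup>2)) (at t within {a..b})" if t: "t \<in> {a..b}" for t
  proof -
    have "(r has_real_derivative ((c * (- sin (ph t) * c)) * sin (ph t) - (c * cos (ph t)) * (cos (ph t) * c))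
        / (sin (ph t) * sin (ph t))) (at t within {a..b})"
      unfolding r_def using s0[OF t] unfolding ph_def
      by (auto intro!: derivative_eq_intros)
    moreover have "((c * (- sin (ph t) * c)) * sin (ph t) - (c * cos (ph t)) * (cos (ph t) * c))
        / (sin (ph t) * sin (ph t)) = - c\<^sup>2 - (r t)\<^sup>2"
      using s0[OF t] unfolding r_def by (simp add: field_simps power2_eq_square)
    ultimately show ?thesis
      by (simp add: has_real_derivative_iff_has_vector_derivative)
  qed
  define D where "D = (\<lambda>t. (- c\<^sup>2 - (r t)\<^sup>2) * (cmod (y t))\<^sup>2 + r t * (2 * (y t \<bullet> y' t)))"
  have "(D has_integral (r b * (cmod (y b))\<^sup>2 - r a * (cmod (y a))\<^sup>2)) {a..b}"
  proof (rule fundamental_theorem_of_calculus[OF ab])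
    fix t assume t: "t \<in> {a..b}"
    show "((\<lambda>t. r t * (cmod (y t))\<^sup>2) has_vector_derivative D t) (at t within {a..b})"
      using has_vector_derivative_mult[OF r'[OF t] has_vector_derivative_inner_self[OF y[OF t]]]
      by (simp add: D_def algebra_simps)
  qed
  \<comment> \<open>The boundary terms \<open>r |y|^2\<close> drop out because \<open>y\<close>
    vanishes at both ends, where \<open>r\<close> is finite.\<close>
  then have D0: "integral {a..b} D = 0" using y0 by (simp add: integral_unique)
  have "0 \<le> integral {a..b} (\<lambda>t. (cmod (y' t - r t *\<^sub>R y t))\<^sup>2)"
    by (rule integral_nonneg)
      (auto intro!: integrable_continuous_interval continuous_intros yc y'c rc)
  also have "\<dots> = integral {a..b} (\<lambda>t. ((cmod (y' t))\<^sup>2 - c\<^sup>2 * (cmod (y t))\<^sup>2) - D t)"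
  proof (rule integral_cong)
    fix t
    have e: "(cmod (y' t - r t *\<^sub>R y t))\<^sup>2 = (cmod (y' t))\<^sup>2 - 2 * r t * (y t \<bullet> y' t) + (r t)\<^sup>2 * (cmod (y t))\<^sup>2"
      unfolding cmod_power2 inner_complex_def by (simp add: power2_eq_square algebra_simps)
    show "(cmod (y' t - r t *\<^sub>R y t))\<^sup>2 = ((cmod (y' t))\<^sup>2 - c\<^sup>2 * (cmod (y t))\<^sup>2) - D t"
      by (rule trans[OF e]) (simp add: D_def algebra_simps)
  qed
  also have "\<dots> = integral {a..b} (\<lambda>t. (cmod (y' t))\<^sup>2 - c\<^sup>2 * (cmod (y t))\<^sup>2) - integral {a..b} D"
    unfolding D_def
    by (rule Henstock_Kurzweil_Integration.integral_diff)
      (auto intro!: integrable_continuous_interval continuous_intros yc y'c rc)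
  also have "integral {a..b} (\<lambda>t. (cmod (y' t))\<^sup>2 - c\<^sup>2 * (cmod (y t))\<^sup>2)
      = integral {a..b} (\<lambda>t. (cmod (y' t))\<^sup>2) - integral {a..b} (\<lambda>t. c\<^sup>2 * (cmod (y t))\<^sup>2)"
    by (rule Henstock_Kurzweil_Integration.integral_diff)
      (auto intro!: integrable_continuous_interval continuous_intros yc y'c)
  finally show ?thesis using D0 by simp
qed

text \<open>Each of the \<open>m + 1\<close> cells has length \<open>1 / (m + 1)\<close>, so the
  condition on \<open>c\<close> is the one that \<open>wirtinger_interval\<close> demands on a
  single cell; the inequalities are added up from left to right.\<close>

lemma wirtinger_grid:
  assumes y: "C1_edge y y'" and c: "0 < c" "c < real (Suc m) * pi"
    and y0: "\<And>i. i \<le> Suc m \<Longrightarrow> y (real i / real (Suc m)) = 0"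
  shows "c\<^sup>2 * (LINT t|unit_edge. (cmod (y t))\<^sup>2) \<le> (LINT t|unit_edge. (cmod (y' t))\<^sup>2)"
proof -
  let ?g = "\<lambda>i. real i / real (Suc m)"
  note yc = C1_edge_continuous[OF y] and y'c = C1_edge_continuous_deriv[OF y]
  have "c\<^sup>2 * integral {0..?g i} (\<lambda>t. (cmod (y t))\<^sup>2) \<le> integral {0..?g i} (\<lambda>t. (cmod (y' t))\<^sup>2)"
    if "i \<le> Suc m" for i
    using that
  proof (induction i)
    case 0
    then show ?case by simp
  next
    case (Suc i)
    have le: "0 \<le> ?g i" "?g i \<le> ?g (Suc i)" "?g (Suc i) \<le> 1"
      using Suc.prems by (auto simp: divide_simps)
    have split: "integral {0..?g (Suc i)} f = integral {0..?g i} f + integral {?g i..?g (Suc i)} f"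
      if "continuous_on {0..1} f" for f :: "real \<Rightarrow> real"
    proof -
      have "f integrable_on {0..?g (Suc i)}"
        by (rule integrable_continuous_interval[OF continuous_on_subset[OF that]]) (use le in auto)
      then show ?thesis
        using Henstock_Kurzweil_Integration.integral_combine[OF le(1,2)] by metis
    qed
    have "c\<^sup>2 * integral {?g i..?g (Suc i)} (\<lambda>t. (cmod (y t))\<^sup>2)
        \<le> integral {?g i..?g (Suc i)} (\<lambda>t. (cmod (y' t))\<^sup>2)"
    proof (rule wirtinger_interval[OF le(2) c(1)])
      have "?g (Suc i) - ?g i = 1 / real (Suc m)" by (simp add: divide_simps)
      then show "c * (?g (Suc i) - ?g i) < pi" using c(2) by (simp add: divide_simps mult.commute)
      show "(y has_vector_derivative y' t) (at t within {?g i..?g (Suc i)})" if "t \<in> {?g i..?g (Suc i)}" for t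
        by (rule has_vector_derivative_within_subset[OF C1_edge_deriv[OF y]])
          (use that le in \<open>unfold atLeastAtMost_iff subset_iff, linarith+\<close>)
      show "continuous_on {?g i..?g (Suc i)} y'"
        by (rule continuous_on_subset[OF y'c]) (use le in auto)
      show "y (?g i) = 0" "y (?g (Suc i)) = 0" using y0[of i] y0[of "Suc i"] Suc.prems by auto
    qed
    moreover have "c\<^sup>2 * integral {0..?g i} (\<lambda>t. (cmod (y t))\<^sup>2) \<le> integral {0..?g i} (\<lambda>t. (cmod (y' t))\<^sup>2)"
      using Suc by simp
    ultimately show ?case
      using split[of "\<lambda>t. (cmod (y t))\<^sup>2"] split[of "\<lambda>t. (cmod (y' t))\<^sup>2"] yc y'c
      by (simp add: continuous_intros distrib_left)
  qed
  from this[of "Suc m"] show ?thesis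
    using yc y'c by (simp add: LINT_unit_edge_eq_integral continuous_intros)
qed

text \<open>Integrate the derivative of \<open>h |y|^2\<close> with a linear \<open>h\<close> of
  modulus at most 1 and split the cross term by Young's inequality. The free \<open>e\<close> lets a
  boundary form be absorbed by a small part of the energy of the derivative.\<close>

lemma trace_bound:
  assumes y: "C1_edge y y'" and e: "0 < e" and s: "s = 0 \<or> s = 1"
  shows "(cmod (y s))\<^sup>2 \<le> e * (LINT t|unit_edge. (cmod (y' t))\<^sup>2) + (1 + 1 / e) * (LINT t|unit_edge. (cmod (y t))\<^sup>2)"
proof -
  note yc = C1_edge_continuous[OF y] and y'c = C1_edge_continuous_deriv[OF y]
  \<comment> \<open>A function of slope 1 that vanishes at the end opposite to \<open>s\<close>, so
    that only \<open>|y s|^2\<close> survives as boundary term.\<close>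
  define h where "h = (\<lambda>t::real. if s = 0 then t - 1 else t)"
  have h': "(h has_vector_derivative 1) (at t within {0..1})" for t
    using s unfolding h_def by (auto intro!: derivative_eq_intros)
  have hc: "continuous_on {0..1} h"
    using s unfolding h_def by (auto intro!: continuous_intros)
  have hb: "\<bar>h t\<bar> \<le> 1" if "t \<in> {0..1}" for t
    using that s by (auto simp: h_def)
  have "((\<lambda>t. h t * (2 * (y t \<bullet> y' t)) + (cmod (y t))\<^sup>2) has_integral
      (h 1 * (cmod (y 1))\<^sup>2 - h 0 * (cmod (y 0))\<^sup>2)) {0..1}"
  proof (rule fundamental_theorem_of_calculus)
    fix t :: real assume t: "t \<in> {0..1}"
    show "((\<lambda>t. h t * (cmod (y t))\<^sup>2) has_vector_derivative h t * (2 * (y t \<bullet> y' t)) + (cmod (y t))\<^sup>2) (at t within {0..1})"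
      using has_vector_derivative_mult[OF h' has_vector_derivative_inner_self[OF C1_edge_deriv[OF y t]]] by simp
  qed simp
  moreover have "h 1 * (cmod (y 1))\<^sup>2 - h 0 * (cmod (y 0))\<^sup>2 = (cmod (y s))\<^sup>2"
    using s by (auto simp: h_def)
  ultimately have "(cmod (y s))\<^sup>2 = integral {0..1} (\<lambda>t. h t * (2 * (y t \<bullet> y' t)) + (cmod (y t))\<^sup>2)"
    by (simp add: integral_unique)
  also have "\<dots> \<le> integral {0..1} (\<lambda>t. e * (cmod (y' t))\<^sup>2 + (1 + 1 / e) * (cmod (y t))\<^sup>2)"
  proof (rule integral_le)
    fix t :: real assume t: "t \<in> {0..1}"
    have "h t * (2 * (y t \<bullet> y' t)) \<le> \<bar>h t\<bar> * \<bar>2 * (y t \<bullet> y' t)\<bar>"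
      by (metis abs_ge_self abs_mult)
    also have "\<dots> \<le> 1 * (2 * (cmod (y t) * cmod (y' t)))"
      using hb[OF t] Cauchy_Schwarz_ineq2[of "y t" "y' t"] by (intro mult_mono) (auto simp: abs_mult)
    also have "\<dots> \<le> e * (cmod (y' t))\<^sup>2 + (1 / e) * (cmod (y t))\<^sup>2"
    proof -
      have "0 \<le> (e * cmod (y' t) - cmod (y t))\<^sup>2 / e" using e by simp
      also have "\<dots> = e * (cmod (y' t))\<^sup>2 + (1 / e) * (cmod (y t))\<^sup>2 - 2 * (cmod (y t) * cmod (y' t))"
        using e by (simp add: field_simps power2_eq_square)
      finally show ?thesis by simp
    qed
    finally show "h t * (2 * (y t \<bullet> y' t)) + (cmod (y t))\<^sup>2 \<le> e * (cmod (y' t))\<^sup>2 + (1 + 1 / e) * (cmod (y t))\<^sup>2"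
      by (simp add: algebra_simps)
  qed (intro integrable_continuous_interval continuous_intros yc y'c hc)+
  also have "\<dots> = e * integral {0..1} (\<lambda>t. (cmod (y' t))\<^sup>2) + (1 + 1 / e) * integral {0..1} (\<lambda>t. (cmod (y t))\<^sup>2)"
    by (subst Henstock_Kurzweil_Integration.integral_add)
      (auto intro!: integrable_continuous_interval continuous_intros yc y'c)
  finally show ?thesis
    by (simp add: LINT_unit_edge_eq_integral continuous_intros yc y'c)
qed

text \<open>Young's inequality \<open>2 |y'| \<le> e |y'|^2 + 1 / e\<close> under the integral.
  Choosing first \<open>e\<close> and then \<open>t - s\<close> small gives equicontinuity of any
  family with bounded energy.\<close>

lemma oscillation_bound:
  assumes y: "C1_edge y y'" and e: "0 < e" and s: "0 \<le> s" "s \<le> t" "t \<le> 1"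
  shows "cmod (y t - y s) \<le> e * (LINT t|unit_edge. (cmod (y' t))\<^sup>2) + (t - s) / e"
proof -
  note yc = C1_edge_continuous[OF y] and y'c = C1_edge_continuous_deriv[OF y]
  have sub: "{s..t} \<subseteq> {0..1}" using s by auto
  note cs = continuous_on_subset[OF y'c sub]
  have "(y' has_integral y t - y s) {s..t}"
    by (rule fundamental_theorem_of_calculus[OF s(2)])
      (use sub in \<open>auto intro!: has_vector_derivative_within_subset[OF C1_edge_deriv[OF y]]\<close>)
  then have "cmod (y t - y s) = cmod (integral {s..t} y')" by (simp add: integral_unique)
  also have "\<dots> \<le> integral {s..t} (\<lambda>u. e * (cmod (y' u))\<^sup>2 + 1 / e)"
  proof (rule integral_norm_bound_integral)
    fix u
    have "0 \<le> (e * cmod (y' u) - 1)\<^sup>2 / e" using e by simp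
    also have "\<dots> = e * (cmod (y' u))\<^sup>2 + 1 / e - 2 * cmod (y' u)"
      using e by (simp add: field_simps power2_eq_square)
    finally have "2 * cmod (y' u) \<le> e * (cmod (y' u))\<^sup>2 + 1 / e" by simp
    then show "cmod (y' u) \<le> e * (cmod (y' u))\<^sup>2 + 1 / e" using norm_ge_zero[of "y' u"] by linarith
  qed (intro integrable_continuous_interval continuous_intros cs)+
  also have "\<dots> = e * integral {s..t} (\<lambda>u. (cmod (y' u))\<^sup>2) + (t - s) / e"
    using s
    by (subst Henstock_Kurzweil_Integration.integral_add)
      (auto intro!: integrable_continuous_interval continuous_intros cs)
  also have "integral {s..t} (\<lambda>u. (cmod (y' u))\<^sup>2) \<le> integral {0..1} (\<lambda>u. (cmod (y' u))\<^sup>2)"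
    by (rule integral_subset_le[OF sub])
      (auto intro!: integrable_continuous_interval continuous_intros cs y'c)
  finally show ?thesis
    using e by (simp add: LINT_unit_edge_eq_integral continuous_intros y'c)
qed

text \<open>Subtract from \<open>u\<close> its projection \<open>a + b t\<close> onto the affine
  functions. The moments of order 0 and 1 of the residual \<open>v\<close> vanish, which is exactly
  what makes the double primitive of its conjugate flat at both ends; with this test function the
  hypothesis says that the integral of \<open>|v|^2\<close> is 0.\<close>

lemma du_Bois_Reymond_second:
  fixes u :: "real \<Rightarrow> complex"
  assumes uc: "continuous_on {0..1} u"
    and weak: "\<And>z z' z''. C1_edge z z' \<Longrightarrow> C1_edge z' z'' \<Longrightarrow> z 0 = 0 \<Longrightarrow> z' 0 = 0 \<Longrightarrow> z 1 = 0 \<Longrightarrow> z' 1 = 0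
      \<Longrightarrow> (LINT t|unit_edge. u t * z'' t) = 0"
  shows "\<exists>a b. \<forall>t\<in>{0..1}. u t = a + b * of_real t"
proof -
  let ?I = "\<lambda>f. (LINT t|unit_edge. f t)"
  note ii = integrable_continuous_edge
  define m0 m1 where "m0 = ?I u" and "m1 = ?I (\<lambda>t. u t * of_real t)"
  \<comment> \<open>The solution of the moment equations \<open>a + b / 2 = m0\<close> and
    \<open>a / 2 + b / 3 = m1\<close>.\<close>
  define a b where "a = 4 * m0 - 6 * m1" and "b = 12 * m1 - 6 * m0"
  define v where "v = (\<lambda>t. u t - (a + b * of_real t))"
  have vc: "continuous_on {0..1} v" unfolding v_def by (intro continuous_intros uc)
  have C2: "C1_edge (\<lambda>t. of_real t * of_real t / 2) (\<lambda>t. complex_of_real t)"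
    using C1_edge_cmult[OF C1_edge_mult[OF C1_edge_of_real C1_edge_of_real], of "1/2"] by simp
  have i1: "?I (\<lambda>t. complex_of_real t) = 1/2"
    using LINT_C1_edge[OF C2] by simp
  have "?I (\<lambda>t. complex_of_real t * of_real t) = 1/3"
    using LINT_by_parts[OF C2 C1_edge_of_real] by (simp add: field_simps)
  note i2 = this
  have v0: "?I v = 0"
  proof -
    have ia: "?I (\<lambda>t. a) = a"
      using LINT_C1_edge[OF C1_edge_cmult[OF C1_edge_of_real, of a]] by simp
    have "?I v = ?I u - (?I (\<lambda>t. a) + b * ?I of_real)"
      unfolding v_def by (simp add: ii continuous_intros uc del: lebesgue_integral_const)
    also have "\<dots> = 0"
      unfolding ia i1 m0_def[symmetric] by (simp add: a_def b_def field_simps)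
    finally show ?thesis .
  qed
  have v1: "?I (\<lambda>t. v t * of_real t) = 0"
  proof -
    have "?I (\<lambda>t. v t * of_real t) = ?I (\<lambda>t. u t * of_real t - (a * of_real t + b * (of_real t * of_real t)))"
      by (simp add: v_def algebra_simps)
    also have "\<dots> = ?I (\<lambda>t. u t * of_real t) - (a * ?I of_real + b * ?I (\<lambda>t. of_real t * of_real t))"
      by (simp add: ii continuous_intros uc)
    finally show ?thesis
      unfolding i1 i2 m1_def[symmetric] by (simp add: a_def b_def field_simps)
  qed
  define z'' z' z where "z'' = (\<lambda>t. cnj (v t))" and "z' = primitive z''" and "z = primitive z'"
  have z''c: "continuous_on {0..1} z''" unfolding z''_def by (intro continuous_intros vc)
  have z': "C1_edge z' z''" unfolding z'_def by (rule C1_edge_primitive[OF z''c])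
  have z: "C1_edge z z'" unfolding z_def by (rule C1_edge_primitive[OF C1_edge_continuous[OF z']])
  have zz: "z 0 = 0" "z' 0 = 0" by (simp_all add: z_def z'_def)
  have z'1: "z' 1 = 0"
    using LINT_C1_edge[OF z'] zz v0 Bochner_Integration.integral_cnj[of unit_edge v] by (simp add: z''_def)
  have tz: "?I (\<lambda>t. of_real t * z'' t) = 0"
    using v1 Bochner_Integration.integral_cnj[of unit_edge "\<lambda>t. v t * of_real t"] by (simp add: z''_def mult.commute)
  \<comment> \<open>Integrating \<open>z'\<close> by parts against the factor 1 expresses
    \<open>z 1\<close> through \<open>z' 1\<close> and the first moment of \<open>z''\<close>, both
    of which vanish.\<close>
  have z1: "z 1 = 0"
    using LINT_C1_edge[OF z] LINT_by_parts[OF C1_edge_of_real z'] zz z'1 tz by simp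
  have "?I (\<lambda>t. v t * z'' t) = ?I (\<lambda>t. u t * z'' t - (a * z'' t + b * (of_real t * z'' t)))"
    by (simp add: v_def algebra_simps)
  also have "\<dots> = ?I (\<lambda>t. u t * z'' t) - (a * ?I z'' + b * ?I (\<lambda>t. of_real t * z'' t))"
    by (simp add: ii continuous_intros uc z''c)
  also have "\<dots> = 0"
    using weak[OF z z' zz z1 z'1] tz LINT_C1_edge[OF z'] z'1 zz by simp
  finally have "?I (\<lambda>t. complex_of_real ((cmod (v t))\<^sup>2)) = 0"
    unfolding complex_norm_square by (simp add: z''_def)
  then have "?I (\<lambda>t. (cmod (v t))\<^sup>2) = 0"
    by (simp only: integral_complex_of_real of_real_eq_0_iff)
  then have "v t = 0" if "t \<in> {0..1}" for t
    using continuous_nonneg_LINT_eq_0[of "\<lambda>t. (cmod (v t))\<^sup>2" t] that by (simp add: continuous_intros vc)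
  then show ?thesis unfolding v_def by (intro exI[of _ a] exI[of _ b]) auto
qed

section \<open>Orthogonality of the trigonometric functions on an edge\<close>

lemma C1_edge_real_ident: "C1_edge (\<lambda>t::real. t) (\<lambda>t. 1)"
  by (auto simp: C1_edge_def intro!: continuous_intros derivative_eq_intros)

lemma LINT_cos_pi:
  assumes "n \<noteq> 0"
  shows "(LINT t|unit_edge. cos (real_of_int n * pi * t)) = 0"
proof -
  let ?c = "real_of_int n * pi"
  have "((\<lambda>t. cos (?c * t)) has_integral (sin (?c * 1) / ?c - sin (?c * 0) / ?c)) {0..1}"
    using assms
    by (intro fundamental_theorem_of_calculus)
      (auto intro!: derivative_eq_intros simp flip: has_real_derivative_iff_has_vector_derivative)
  moreover have "sin (?c * 1) = 0" using sin_int_times_real[of n] by (simp add: sin_zero_iff_int2)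
  ultimately have "((\<lambda>t. cos (?c * t)) has_integral 0) {0..1}" by simp
  then show ?thesis
    by (subst LINT_unit_edge_eq_integral) (auto intro!: continuous_intros integral_unique)
qed

text \<open>Product-to-sum formulas leave cosines of frequency \<open>k - l\<close> and
  \<open>k + l\<close>; only frequency 0 contributes, and \<open>k + l\<close> is never 0. The sines
  give the mass of the later test functions, the cosines that of their derivatives.\<close>

lemma LINT_sin_sin:
  assumes "k \<noteq> 0" "l \<noteq> 0"
  shows "(LINT t|unit_edge. sin (real k * pi * t) * sin (real l * pi * t)) = (if k = l then 1 / 2 else 0)"
    and "(LINT t|unit_edge. cos (real k * pi * t) * cos (real l * pi * t)) = (if k = l then 1 / 2 else 0)"
proof -
  let ?C = "\<lambda>n::int. (LINT t|unit_edge. cos (real_of_int n * pi * t))"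
  have C: "?C n = (if n = 0 then 1 else 0)" for n
    using LINT_cos_pi[of n] LINT_C1_edge[OF C1_edge_real_ident] by auto
  have ci: "integrable unit_edge (\<lambda>t. cos (real_of_int n * pi * t))" for n
    by (intro integrable_continuous_edge continuous_intros)
  have 1: "sin (real k * pi * t) * sin (real l * pi * t)
      = (cos (real_of_int (int k - int l) * pi * t) - cos (real_of_int (int k + int l) * pi * t)) / 2" for t
    by (simp add: sin_times_sin algebra_simps)
  have 2: "cos (real k * pi * t) * cos (real l * pi * t)
      = (cos (real_of_int (int k - int l) * pi * t) + cos (real_of_int (int k + int l) * pi * t)) / 2" for t
    by (simp add: cos_times_cos algebra_simps)
  have kl: "int k + int l \<noteq> 0" "int k - int l = 0 \<longleftrightarrow> k = l" using assms by auto
  show "(LINT t|unit_edge. sin (real k * pi * t) * sin (real l * pi * t)) = (if k = l then 1 / 2 else 0)"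
    unfolding 1 by (subst integral_divide_zero, subst LINT_diff[OF ci ci], unfold C kl) (simp add: assms)
  show "(LINT t|unit_edge. cos (real k * pi * t) * cos (real l * pi * t)) = (if k = l then 1 / 2 else 0)"
    unfolding 2 by (subst integral_divide_zero, subst LINT_add[OF ci ci], unfold C kl) (simp add: assms)
qed

section \<open>Hermitian forms and counting\<close>

text \<open>Elimination of one unknown per equation. This is the dimension count behind both
  eigenvalue bounds: more free coefficients than linear constraints.\<close>

lemma underdetermined_system:
  fixes a :: "'j \<Rightarrow> 'i \<Rightarrow> complex"
  assumes "finite J" "finite I" "card J < card I"
  shows "\<exists>c. (\<exists>i\<in>I. c i \<noteq> 0) \<and> (\<forall>j\<in>J. (\<Sum>i\<in>I. c i * a j i) = 0)"
  using assms
proof (induction J arbitrary: I a rule: finite_induct)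
  case empty
  then obtain i where "i \<in> I" by (metis card.empty card_gt_0_iff ex_in_conv)
  then show ?case by (intro exI[of _ "\<lambda>_. 1"]) auto
next
  case (insert j0 J)
  show ?case
  proof (cases "\<forall>i\<in>I. a j0 i = 0")
    case True
    have "card J < card I" using insert by simp
    from insert.IH[OF insert.prems(1) this, of a] obtain c
      where c: "\<exists>i\<in>I. c i \<noteq> 0" "\<forall>j\<in>J. (\<Sum>i\<in>I. c i * a j i) = 0" by blast
    moreover have "(\<Sum>i\<in>I. c i * a j0 i) = 0" using True by simp
    ultimately show ?thesis by blast
  next
    case False
    then obtain i0 where i0: "i0 \<in> I" "a j0 i0 \<noteq> 0" by blast
    \<comment> \<open>Row \<open>j\<close> minus the multiple of row \<open>j0\<close> that cancels
      the unknown \<open>i0\<close>.\<close>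
    define b where "b = (\<lambda>j i. a j i - a j i0 * a j0 i / a j0 i0)"
    have "finite (I - {i0})" "card J < card (I - {i0})"
      using insert i0 by (auto simp: card_Diff_singleton)
    from insert.IH[OF this, of b] obtain c
      where c: "\<exists>i\<in>I - {i0}. c i \<noteq> 0" "\<And>j. j \<in> J \<Longrightarrow> (\<Sum>i\<in>I - {i0}. c i * b j i) = 0" by blast
    define s where "s = (\<Sum>i\<in>I - {i0}. c i * a j0 i)"
    \<comment> \<open>Back substitution: the eliminated unknown receives the value that solves
      equation \<open>j0\<close>.\<close>
    define d where "d = c(i0 := - s / a j0 i0)"
    have split: "(\<Sum>i\<in>I. d i * a j i) = - s / a j0 i0 * a j i0 + (\<Sum>i\<in>I - {i0}. c i * a j i)" for j
      using insert.prems(1) i0 by (subst sum.remove[of _ i0]) (auto simp: d_def intro!: sum.cong)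
    have "(\<Sum>i\<in>I. d i * a j i) = 0" if "j \<in> J" for j
    proof -
      have "(\<Sum>i\<in>I - {i0}. c i * b j i) = (\<Sum>i\<in>I - {i0}. c i * a j i) - s * (a j i0 / a j0 i0)"
        unfolding b_def s_def sum_distrib_right sum_subtractf[symmetric]
        by (rule sum.cong) (auto simp: algebra_simps)
      then show ?thesis using c(2)[OF that] split[of j] by simp
    qed
    moreover have "(\<Sum>i\<in>I. d i * a j0 i) = 0"
      using split[of j0] i0 by (simp add: s_def)
    moreover have "\<exists>i\<in>I. d i \<noteq> 0" using c(1) by (auto simp: d_def)
    ultimately show ?thesis by blast
  qed
qed

text \<open>The laws are required on \<open>V\<close> only, because additivity of \<open>F\<close>
  rests on that of \<open>grad\<close>, which needs differentiability. No sign is assumed: the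
  locale serves \<open>F\<close>, the indefinite \<open>Q\<close>, and \<open>F\<close> minus a
  multiple of \<open>Q\<close>.\<close>

locale hermitian_form = vector_space scale
  for scale :: "complex \<Rightarrow> 'a \<Rightarrow> 'a::ab_group_add" +
  fixes V :: "'a set" and h :: "'a \<Rightarrow> 'a \<Rightarrow> complex"
  assumes subspace_V: "subspace V"
    and add_left: "x \<in> V \<Longrightarrow> y \<in> V \<Longrightarrow> z \<in> V \<Longrightarrow> h (x + y) z = h x z + h y z"
    and scale_left: "x \<in> V \<Longrightarrow> z \<in> V \<Longrightarrow> h (scale c x) z = c * h x z"
    and herm: "x \<in> V \<Longrightarrow> y \<in> V \<Longrightarrow> h y x = cnj (h x y)"
begin

lemma add_right: "x \<in> V \<Longrightarrow> y \<in> V \<Longrightarrow> z \<in> V \<Longrightarrow> h z (x + y) = h z x + h z y"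
  using add_left[of x y z] herm[of "x + y" z] herm[of x z] herm[of y z] subspace_add[OF subspace_V, of x y]
  by simp

lemma scale_right: "x \<in> V \<Longrightarrow> z \<in> V \<Longrightarrow> h z (scale c x) = cnj c * h z x"
  using scale_left[of x z c] herm[of "scale c x" z] herm[of x z] subspace_scale[OF subspace_V, of x c]
  by simp

lemma zero_left: "z \<in> V \<Longrightarrow> h 0 z = 0"
  using scale_left[of 0 z 0] subspace_0[OF subspace_V] by simp

lemma diag_real: "x \<in> V \<Longrightarrow> h x x = of_real (Re (h x x))"
  using herm[of x x] by (simp add: complex_eq_iff)

lemma comb_in: "finite T \<Longrightarrow> T \<subseteq> V \<Longrightarrow> (\<Sum>e\<in>T. scale (c e) e) \<in> V"
  by (rule subspace_sum[OF subspace_V]) (auto intro: subspace_scale[OF subspace_V])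

lemma comb_left:
  assumes "finite T" "T \<subseteq> V" "z \<in> V"
  shows "h (\<Sum>e\<in>T. scale (c e) e) z = (\<Sum>e\<in>T. c e * h e z)"
  using assms
proof (induction T rule: finite_induct)
  case empty
  then show ?case by (simp add: zero_left)
next
  case (insert x T)
  then show ?case
    by (simp add: add_left scale_left comb_in subspace_scale[OF subspace_V])
qed

lemma diff_left: "x \<in> V \<Longrightarrow> y \<in> V \<Longrightarrow> z \<in> V \<Longrightarrow> h (x - y) z = h x z - h y z"
  using add_left[of "x - y" y z] subspace_diff[OF subspace_V, of x y] by simp

text \<open>Nonnegativity of \<open>h\<close> at \<open>x - r w z\<close>, with
  \<open>w = h x z\<close>, for every real \<open>r\<close> bounds the discriminant. It is asked on
  a subspace \<open>Y\<close> only and may be degenerate, since \<open>F - l Q\<close> will be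
  nonnegative merely on an orthogonal complement and nearly vanishes along a minimising
  sequence.\<close>

lemma Cauchy_Schwarz:
  assumes Y: "subspace Y" "Y \<subseteq> V" and pos: "\<And>y. y \<in> Y \<Longrightarrow> 0 \<le> Re (h y y)" and xz: "x \<in> Y" "z \<in> Y"
  shows "(cmod (h x z))\<^sup>2 \<le> Re (h x x) * Re (h z z)"
proof (rule ccontr)
  define w a c where "w = h x z" and "a = Re (h x x)" and "c = Re (h z z)"
  assume "\<not> ?thesis"
  then have neg: "a * c < (cmod w)\<^sup>2" by (simp add: w_def a_def c_def)
  have xzV: "x \<in> V" "z \<in> V" using xz Y by auto
  have ac: "0 \<le> a" "0 \<le> c" using pos xz by (auto simp: a_def c_def)
  have w0: "0 < (cmod w)\<^sup>2" using neg ac by (meson le_less_trans mult_nonneg_nonneg)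
  have q: "0 \<le> a - 2 * r * (cmod w)\<^sup>2 + r\<^sup>2 * (cmod w)\<^sup>2 * c" for r
  proof -
    define s where "s = - complex_of_real r * w"
    have sz: "scale s z \<in> V" "scale s z \<in> Y" using xzV xz subspace_scale subspace_V Y by auto
    have "0 \<le> Re (h (x + scale s z) (x + scale s z))"
      by (intro pos subspace_add[OF Y(1)] xz sz)
    also have "h (x + scale s z) (x + scale s z) = h x x + cnj s * w + s * cnj w + s * cnj s * h z z"
      using xzV sz herm[of x z] subspace_add[OF subspace_V]
      by (simp add: add_left add_right scale_left scale_right w_def algebra_simps)
    also have "Re \<dots> = a - 2 * r * (cmod w)\<^sup>2 + r\<^sup>2 * (cmod w)\<^sup>2 * c"
    proof -
      have "s * cnj s = of_real (r\<^sup>2 * (cmod w)\<^sup>2)"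
        using complex_norm_square[of w] by (simp add: s_def power2_eq_square mult_ac)
      moreover have "cnj s * w = of_real (- r * (cmod w)\<^sup>2)" "s * cnj w = of_real (- r * (cmod w)\<^sup>2)"
        using complex_norm_square[of w] by (simp_all add: s_def mult_ac)
      ultimately show ?thesis by (simp add: a_def c_def)
    qed
    finally show ?thesis .
  qed
  show False
  proof (cases "c = 0")
    case True
    \<comment> \<open>For \<open>c = 0\<close> the expression in \<open>q\<close> is affine in
      \<open>r\<close>, and at this value of \<open>r\<close> it equals -1.\<close>
    have "2 * ((a + 1) / (2 * (cmod w)\<^sup>2)) * (cmod w)\<^sup>2 = a + 1" using w0 by simp
    then show False using q[of "(a + 1) / (2 * (cmod w)\<^sup>2)"] True by simp
  next
    case False
    then have "0 \<le> a - (cmod w)\<^sup>2 / c" using q[of "1 / c"] by (simp add: power2_eq_square)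
    then show False using neg False ac by (simp add: field_simps)
  qed
qed

text \<open>All squares are +1, so for an indefinite form such a set spans a positive definite
  subspace. Finiteness is built in to make sums over \<open>T\<close> and \<open>card T\<close>
  meaningful.\<close>

definition orthonormal :: "'a set \<Rightarrow> bool"
  where "orthonormal T \<longleftrightarrow> finite T \<and> T \<subseteq> V \<and> (\<forall>x\<in>T. \<forall>y\<in>T. h x y = (if x = y then 1 else 0))"

lemma orthonormal_coeff:
  assumes "orthonormal T" "f \<in> T"
  shows "h (\<Sum>e\<in>T. scale (c e) e) f = c f"
proof -
  have T: "finite T" "T \<subseteq> V" "f \<in> V" using assms by (auto simp: orthonormal_def)
  have "h (\<Sum>e\<in>T. scale (c e) e) f = (\<Sum>e\<in>T. c e * h e f)" by (rule comb_left[OF T])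
  also have "\<dots> = (\<Sum>e\<in>T. if e = f then c e else 0)"
    using assms by (intro sum.cong) (auto simp: orthonormal_def)
  also have "\<dots> = c f" using T assms by (simp add: sum.delta)
  finally show ?thesis .
qed

lemma orthonormal_norm:
  assumes "orthonormal T"
  shows "h (\<Sum>e\<in>T. scale (c e) e) (\<Sum>e\<in>T. scale (c e) e) = of_real (\<Sum>e\<in>T. (cmod (c e))\<^sup>2)"
proof -
  have T: "finite T" "T \<subseteq> V" using assms by (auto simp: orthonormal_def)
  let ?x = "\<Sum>e\<in>T. scale (c e) e"
  have x: "?x \<in> V" by (rule comb_in[OF T])
  have "h ?x ?x = (\<Sum>e\<in>T. c e * h e ?x)" by (rule comb_left[OF T x])
  also have "\<dots> = (\<Sum>e\<in>T. of_real ((cmod (c e))\<^sup>2))"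
  proof (rule sum.cong[OF refl])
    fix e assume e: "e \<in> T"
    then have "h e ?x = cnj (c e)"
      using herm[OF x, of e] orthonormal_coeff[OF assms e, of c] T by auto
    then show "c e * h e ?x = of_real ((cmod (c e))\<^sup>2)" by (simp only: complex_norm_square)
  qed
  finally show ?thesis by simp
qed

lemma orthonormal_independent:
  assumes "orthonormal T"
  shows "independent T"
proof (rule independent_if_scalars_zero)
  show "finite T" using assms by (simp add: orthonormal_def)
  fix c x assume "(\<Sum>e\<in>T. scale (c e) e) = 0" "x \<in> T"
  then show "c x = 0"
    using orthonormal_coeff[OF assms, of x c] zero_left[of x] assms by (auto simp: orthonormal_def)
qed

text \<open>Orthogonal projection onto \<open>T\<close> works for an indefinite form as well, since
  only the values of \<open>h\<close> within \<open>T\<close> enter.\<close>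

lemma orthonormal_residual:
  assumes "orthonormal T" "x \<in> V" "f \<in> T"
  shows "h (x - (\<Sum>e\<in>T. scale (h x e) e)) f = 0"
proof -
  have T: "finite T" "T \<subseteq> V" using assms by (auto simp: orthonormal_def)
  show ?thesis
    using assms T orthonormal_coeff[OF assms(1,3), of "h x"] comb_in[OF T, of "h x"]
    by (subst diff_left) auto
qed

lemma orthonormal_insert:
  assumes "orthonormal T" "x \<in> V" "h x x = 1" "\<And>e. e \<in> T \<Longrightarrow> h x e = 0"
  shows "orthonormal (insert x T)" "x \<notin> T"
proof -
  have "h e x = 0" if "e \<in> T" for e
    using that assms herm[of x e] by (auto simp: orthonormal_def)
  then show "orthonormal (insert x T)" "x \<notin> T"
    using assms by (auto simp: orthonormal_def)
qed

text \<open>The size bound takes the place of finite dimension: an orthonormal set of greatest size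
  exists, a nonzero vector orthogonal to it could be normalised and added, hence every residual
  vanishes and \<open>T\<close> spans \<open>S\<close>. This turns the dimension in
  \<open>multiplicity_of\<close> into a number of orthonormal vectors.\<close>

lemma maximal_orthonormal:
  assumes S: "subspace S" "S \<subseteq> V" and pos: "\<And>x. x \<in> S \<Longrightarrow> x \<noteq> 0 \<Longrightarrow> 0 < Re (h x x)"
    and bound: "\<And>T. orthonormal T \<Longrightarrow> T \<subseteq> S \<Longrightarrow> card T \<le> M"
  obtains T where "orthonormal T" "T \<subseteq> S" "card T = dim S"
    "\<And>x. x \<in> S \<Longrightarrow> (\<And>e. e \<in> T \<Longrightarrow> h x e = 0) \<Longrightarrow> x = 0"
proof -
  let ?P = "\<lambda>n. \<exists>T. orthonormal T \<and> T \<subseteq> S \<and> card T = n"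
  have "?P 0" by (intro exI[of _ "{}"]) (auto simp: orthonormal_def)
  moreover have "\<forall>n. ?P n \<longrightarrow> n \<le> M" using bound by auto
  ultimately have "?P (GREATEST n. ?P n)" and max: "\<And>n. ?P n \<Longrightarrow> n \<le> (GREATEST n. ?P n)"
    using GreatestI_nat[of ?P 0 M] Greatest_le_nat[of ?P _ M] by blast+
  then obtain T where T: "orthonormal T" "T \<subseteq> S" "card T = (GREATEST n. ?P n)" by blast
  have fin: "finite T" using T by (simp add: orthonormal_def)
  have zero: "x = 0" if x: "x \<in> S" and orth: "\<And>e. e \<in> T \<Longrightarrow> h x e = 0" for x
  proof (rule ccontr)
    assume "x \<noteq> 0"
    define r where "r = Re (h x x)"
    have r: "0 < r" using pos x \<open>x \<noteq> 0\<close> by (simp add: r_def)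
    have xV: "x \<in> V" using x S by auto
    define k where "k = complex_of_real (1 / sqrt r)"
    have kxS: "scale k x \<in> S" using x by (rule subspace_scale[OF S(1)])
    then have kx: "scale k x \<in> V" using S by auto
    have "h (scale k x) (scale k x) = k * cnj k * of_real r"
      using xV kx diag_real[OF xV] by (simp add: scale_left scale_right r_def)
    also have "\<dots> = 1" using r by (simp add: k_def flip: of_real_mult)
    finally have "h (scale k x) (scale k x) = 1" .
    moreover have "h (scale k x) e = 0" if "e \<in> T" for e
      using orth[OF that] that T S xV by (subst scale_left) auto
    ultimately have ins: "orthonormal (insert (scale k x) T)" "scale k x \<notin> T"
      using orthonormal_insert[OF T(1) kx] by auto
    then have "?P (Suc (card T))" using T kxS fin by (intro exI[of _ "insert (scale k x) T"]) auto
    then show False using max[of "Suc (card T)"] T by simp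
  qed
  have "S \<subseteq> span T"
  proof
    fix x assume x: "x \<in> S"
    let ?p = "\<Sum>e\<in>T. scale (h x e) e"
    have "?p \<in> S" by (rule subspace_sum[OF S(1)]) (use T subspace_scale[OF S(1)] in auto)
    then have "x - ?p \<in> S" using subspace_diff[OF S(1) x] by simp
    then have "x - ?p = 0"
      by (rule zero) (use orthonormal_residual[OF T(1)] x S in auto)
    then have "x = ?p" by simp
    moreover have "?p \<in> span T" by (intro span_sum span_scale span_base)
    ultimately show "x \<in> span T" by simp
  qed
  then have card: "card T = dim S"
    by (rule basis_card_eq_dim[OF T(2) _ orthonormal_independent[OF T(1)]])
  show ?thesis by (rule that[OF T(1,2) card]) (rule zero, assumption, blast)
qed

end

text \<open>A multiset of reals with support \<open>E\<close> and multiplicities \<open>m\<close>,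
  discrete and bounded below by \<open>finite_below\<close>. It separates the bookkeeping between
  the counting function \<open>N\<close> and an ordered listing from the analysis.\<close>

locale discrete_multiset =
  fixes E :: "real set" and m :: "real \<Rightarrow> nat"
  assumes finite_below: "finite {x \<in> E. x \<le> r}"
    and m_pos: "x \<in> E \<Longrightarrow> 0 < m x"
begin

definition N :: "real \<Rightarrow> nat" where "N r = (\<Sum>x\<in>{x \<in> E. x \<le> r}. m x)"

lemma N_attained: "0 < N r \<Longrightarrow> \<exists>x\<in>E. x \<le> r \<and> N x = N r"
proof -
  assume "0 < N r"
  let ?S = "{x \<in> E. x \<le> r}"
  have ne: "?S \<noteq> {}" using \<open>0 < N r\<close> unfolding N_def by (metis not_gr0 sum.empty)
  note fin = finite_below[of r]
  define z where "z = Max ?S"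
  have z: "z \<in> E" "z \<le> r" using Max_in[OF fin ne] by (auto simp: z_def)
  have "{x \<in> E. x \<le> z} = ?S" using z Max_ge[OF fin] by (auto simp: z_def)
  then have "N z = N r" unfolding N_def by simp
  with z show ?thesis by blast
qed

text \<open>The number \<open>k\<close> counts what lies strictly below \<open>x\<close>, so
  \<open>x\<close> occupies the positions \<open>k + 1, ..., N x\<close> of an ordered listing. A
  nonzero \<open>k\<close> is itself a value of \<open>N\<close>, attained at the predecessor of
  \<open>x\<close> in \<open>E\<close>.\<close>

lemma N_below:
  assumes "x \<in> E"
  shows "\<exists>k. k + m x = N x \<and> (\<forall>y. y < x \<longrightarrow> N y \<le> k) \<and> (k = 0 \<or> (\<exists>y\<in>E. y < x \<and> N y = k))"
proof -
  let ?S = "{y \<in> E. y < x}"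
  have fin: "finite ?S" by (rule finite_subset[OF _ finite_below[of x]]) auto
  define k where "k = (\<Sum>y\<in>?S. m y)"
  have "{y \<in> E. y \<le> x} = insert x ?S" using assms by auto
  then have "k + m x = N x" unfolding N_def k_def using fin by simp
  moreover have "N y \<le> k" if "y < x" for y
    unfolding N_def k_def by (rule sum_mono2[OF fin]) (use that in auto)
  moreover have "\<exists>y\<in>E. y < x \<and> N y = k" if "k \<noteq> 0"
  proof -
    have ne: "?S \<noteq> {}" using that unfolding k_def by (metis sum.empty)
    define z where "z = Max ?S"
    have z: "z \<in> E" "z < x" using Max_in[OF fin ne] by (auto simp: z_def)
    have "{y \<in> E. y \<le> z} = ?S" using z Max_ge[OF fin] by (auto simp: z_def)
    then have "N z = k" unfolding N_def k_def by simp
    with z show ?thesis by blast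
  qed
  ultimately show ?thesis by (intro exI[of _ k]) blast
qed

text \<open>The counterpart of \<open>lists_eigenvalues_C_plus\<close> over the reals, with
  positions again starting at 1.\<close>

definition enumerates :: "(nat \<Rightarrow> real) \<Rightarrow> bool"
  where "enumerates lam \<longleftrightarrow> mono_on {1..} lam \<and>
    (\<forall>x. finite {n\<in>{1..}. lam n = x} \<and> card {n\<in>{1..}. lam n = x} = (if x \<in> E then m x else 0))"

text \<open>The entry at position \<open>n\<close> is the least \<open>x\<close> in \<open>E\<close>
  with \<open>n \<le> N x\<close>; it exists because some \<open>N r\<close> reaches
  \<open>n\<close> and \<open>E\<close> is finite below any bound.\<close>

lemma enumerates_exists:
  assumes unb: "\<And>n. \<exists>r. n \<le> N r"
  shows "\<exists>lam. enumerates lam"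
proof -
  let ?S = "\<lambda>n. {x \<in> E. n \<le> N x}"
  have ex: "\<exists>x. x \<in> ?S n \<and> (\<forall>y\<in>?S n. x \<le> y)" if n: "1 \<le> n" for n
  proof -
    obtain r where r: "n \<le> N r" using unb by blast
    then obtain x0 where x0: "x0 \<in> E" "n \<le> N x0" using N_attained[of r] n by force
    let ?F = "{x \<in> ?S n. x \<le> x0}"
    have fin: "finite ?F" by (rule finite_subset[OF _ finite_below[of x0]]) auto
    have ne: "?F \<noteq> {}" using x0 by auto
    have min: "Min ?F \<in> ?F" by (rule Min_in[OF fin ne])
    have le: "Min ?F \<le> y" if "y \<in> ?S n" for y
    proof (cases "y \<le> x0")
      case True
      then show ?thesis using that by (intro Min_le[OF fin]) auto
    next
      case False
      moreover have "Min ?F \<le> x0" using min by blast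
      ultimately show ?thesis by linarith
    qed
    show ?thesis by (rule exI[of _ "Min ?F"]) (use min le in blast)
  qed
  then obtain lam where lam: "\<And>n. 1 \<le> n \<Longrightarrow> lam n \<in> ?S n \<and> (\<forall>y\<in>?S n. lam n \<le> y)" by metis
  have "mono_on {1..} lam"
  proof (rule mono_onI)
    fix a b :: nat assume "a \<in> {1..}" "b \<in> {1..}" "a \<le> b"
    then show "lam a \<le> lam b" using lam[of a] lam[of b] by auto
  qed
  moreover have "finite {n\<in>{1..}. lam n = x} \<and> card {n\<in>{1..}. lam n = x} = (if x \<in> E then m x else 0)" for x
  proof (cases "x \<in> E")
    case True
    obtain k where k: "k + m x = N x" "\<And>y. y < x \<Longrightarrow> N y \<le> k" "k = 0 \<or> (\<exists>y\<in>E. y < x \<and> N y = k)"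
      using N_below[OF True] by blast
    \<comment> \<open>The interval is open at \<open>k\<close>: position \<open>k\<close> still
      belongs to the predecessor of \<open>x\<close>, and \<open>m x\<close> positions
      remain.\<close>
    have "{n\<in>{1..}. lam n = x} = {k<..N x}"
    proof (intro set_eqI iffI)
      fix n assume "n \<in> {n\<in>{1..}. lam n = x}"
      then have n: "1 \<le> n" "lam n = x" by auto
      have "\<not> n \<le> k"
      proof
        assume "n \<le> k"
        then obtain y where "y \<in> E" "y < x" "N y = k" using k(3) n by auto
        then show False using lam[OF n(1)] n \<open>n \<le> k\<close> by auto
      qed
      then show "n \<in> {k<..N x}" using lam[OF n(1)] n by auto
    next
      fix n assume n: "n \<in> {k<..N x}"
      then have n1: "1 \<le> n" by auto
      have "lam n \<le> x" using lam[OF n1] n True by auto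
      moreover have "\<not> lam n < x" using k(2)[of "lam n"] lam[OF n1] n by auto
      ultimately show "n \<in> {n\<in>{1..}. lam n = x}" using n1 by auto
    qed
    then show ?thesis using True k(1) by simp
  next
    case False
    then have e: "{n\<in>{1..}. lam n = x} = {}" using lam by auto
    show ?thesis unfolding e using False by simp
  qed
  ultimately show ?thesis unfolding enumerates_def by blast
qed

lemma enumerates_in:
  assumes lam: "enumerates lam" and n: "1 \<le> n"
  shows "lam n \<in> E"
proof (rule ccontr)
  assume "lam n \<notin> E"
  then have "finite {k\<in>{1..}. lam k = lam n}" "card {k\<in>{1..}. lam k = lam n} = 0"
    using lam unfolding enumerates_def by metis+
  then have "{k\<in>{1..}. lam k = lam n} = {}" using card_0_eq by blast
  then show False using n by auto
qed

lemma enumerates_card: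
  assumes lam: "enumerates lam"
  shows "finite {n\<in>{1..}. lam n \<le> r}" "card {n\<in>{1..}. lam n \<le> r} = N r"
proof -
  have eq: "{n\<in>{1..}. lam n \<le> r} = (\<Union>x\<in>{x \<in> E. x \<le> r}. {n\<in>{1..}. lam n = x})"
    using enumerates_in[OF lam] by auto
  have fib: "finite {n\<in>{1..}. lam n = x}" "x \<in> E \<Longrightarrow> card {n\<in>{1..}. lam n = x} = m x" for x
    using lam unfolding enumerates_def by metis+
  show "finite {n\<in>{1..}. lam n \<le> r}"
    unfolding eq using finite_below fib by (intro finite_UN_I)
  have "card {n\<in>{1..}. lam n \<le> r} = (\<Sum>x\<in>{x \<in> E. x \<le> r}. card {n\<in>{1..}. lam n = x})"
    unfolding eq using fib finite_below by (intro card_UN_disjoint) auto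
  also have "\<dots> = N r" unfolding N_def by (rule sum.cong[OF refl], rule fib(2)) auto
  finally show "card {n\<in>{1..}. lam n \<le> r} = N r" .
qed

text \<open>Both parts come from counting the positions with value at most a given level. Together
  they make \<open>lam\<close> and \<open>N\<close> inverse to each other in the order sense, so
  that bounds for one become bounds for the other.\<close>

lemma enumerates_bounds:
  assumes lam: "enumerates lam" and n: "1 \<le> n"
  shows "n \<le> N (lam n)" and "r < lam n \<Longrightarrow> N r < n"
proof -
  have mono: "lam a \<le> lam b" if "1 \<le> a" "a \<le> b" for a b
    using lam that unfolding enumerates_def mono_on_def by auto
  have "{1..n} \<subseteq> {k\<in>{1..}. lam k \<le> lam n}" using mono by auto
  then have "card {1..n} \<le> card {k\<in>{1..}. lam k \<le> lam n}"
    by (rule card_mono[OF enumerates_card(1)[OF lam]])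
  then show "n \<le> N (lam n)" using enumerates_card(2)[OF lam] by simp
  assume r: "r < lam n"
  have "{k\<in>{1..}. lam k \<le> r} \<subseteq> {1..<n}"
  proof
    fix k assume "k \<in> {k\<in>{1..}. lam k \<le> r}"
    then show "k \<in> {1..<n}" using mono[of n k] r n by (cases "n \<le> k") auto
  qed
  then have "card {k\<in>{1..}. lam k \<le> r} \<le> card {1..<n}" by (intro card_mono) auto
  then show "N r < n" using enumerates_card(2)[OF lam] n by simp
qed

text \<open>The counting bounds are inverted at \<open>x = lam n\<close>. The upper one, with the
  least \<open>k\<close> it admits, bounds \<open>n pi / p\<close> by \<open>sqrt x\<close>; the
  lower one, with the least \<open>l\<close> such that \<open>n < p l\<close>, bounds
  \<open>sqrt x\<close> by \<open>n pi / p\<close>, each up to a constant. Subadditivity of the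
  square root moves \<open>C\<close> into the error.\<close>

lemma sqrt_asymptotics:
  assumes lam: "enumerates lam" and pos: "\<And>x. x \<in> E \<Longrightarrow> 0 < x" and p: "1 \<le> p" and C: "0 \<le> C"
    and upper: "\<And>r k. 0 < r \<Longrightarrow> r + 2 * C < (real (Suc k) * pi)\<^sup>2 \<Longrightarrow> N r \<le> M + p * k"
    and lower: "\<And>r k. (real k * pi)\<^sup>2 + C < r \<Longrightarrow> p * k \<le> N r"
  shows "(\<lambda>n. sqrt (lam n) - real n * pi / real p) \<in> O(\<lambda>_. 1)"
proof (rule bigoI[where c = "real M * pi + sqrt (2 * C) + pi + sqrt C"], rule eventually_sequentiallyI[of 1])
  fix n :: nat assume n: "1 \<le> n"
  define x where "x = lam n"
  have x: "0 < x" using enumerates_in[OF lam n] pos by (simp add: x_def)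
  have p0: "0 < real p" using p by simp
  define k where "k = nat \<lfloor>sqrt (x + 2 * C) / pi\<rfloor>"
  have k: "real k \<le> sqrt (x + 2 * C) / pi" "sqrt (x + 2 * C) / pi < real (Suc k)"
    using x C unfolding k_def by (simp_all add: of_nat_nat) linarith
  have "sqrt (x + 2 * C) < real (Suc k) * pi" using k(2) by (simp add: divide_less_eq)
  then have "(sqrt (x + 2 * C))\<^sup>2 < (real (Suc k) * pi)\<^sup>2"
    using x C by (intro power_strict_mono) auto
  then have "x + 2 * C < (real (Suc k) * pi)\<^sup>2" using x C by simp
  then have "n \<le> M + p * k"
    using upper[OF x] enumerates_bounds(1)[OF lam n] unfolding x_def by (meson le_trans)
  then have "real n \<le> real M + real p * real k" by (metis of_nat_add of_nat_le_iff of_nat_mult)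
  also have "\<dots> \<le> real M + real p * (sqrt (x + 2 * C) / pi)"
    using k(1) p0 by (intro add_left_mono mult_left_mono) auto
  finally have "real n * pi / real p \<le> real M * pi / real p + sqrt (x + 2 * C)"
    using p0 by (simp add: field_simps)
  also have "\<dots> \<le> real M * pi + (sqrt x + sqrt (2 * C))"
  proof (rule add_mono)
    show "real M * pi / real p \<le> real M * pi"
      using divide_left_mono[of 1 "real p" "real M * pi"] p by simp
    show "sqrt (x + 2 * C) \<le> sqrt x + sqrt (2 * C)" using x C by (intro sqrt_add_le_add_sqrt) auto
  qed
  finally have low: "real n * pi / real p - sqrt x \<le> real M * pi + sqrt (2 * C)" by simp
  define l where "l = Suc (n div p)"
  have "n < p * l" using p unfolding l_def by (simp add: dividend_less_times_div)
  have "x \<le> (real l * pi)\<^sup>2 + C"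
  proof (rule ccontr)
    assume "\<not> ?thesis"
    \<comment> \<open>A level strictly below \<open>x\<close> is needed: there the counting function
      misses position \<open>n\<close>, whereas \<open>lower\<close> gives it at least
      \<open>p l > n\<close>.\<close>
    then obtain r where r: "(real l * pi)\<^sup>2 + C < r" "r < x" using dense[of "(real l * pi)\<^sup>2 + C" x] by auto
    then have "p * l < n" using lower[OF r(1)] enumerates_bounds(2)[OF lam n, of r] by (simp add: x_def)
    then show False using \<open>n < p * l\<close> by simp
  qed
  then have "sqrt x \<le> sqrt ((real l * pi)\<^sup>2 + C)" by simp
  also have "\<dots> \<le> sqrt ((real l * pi)\<^sup>2) + sqrt C" using C by (intro sqrt_add_le_add_sqrt) auto
  also have "sqrt ((real l * pi)\<^sup>2) = real l * pi" by simp
  also have "real l \<le> real n / real p + 1"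
  proof -
    have "real p * real (n div p) \<le> real n"
      by (metis of_nat_le_iff of_nat_mult times_div_less_eq_dividend)
    then show ?thesis using p0 by (simp add: l_def field_simps)
  qed
  finally have up: "sqrt x \<le> (real n / real p + 1) * pi + sqrt C" by simp
  show "norm (sqrt (lam n) - real n * pi / real p) \<le> (real M * pi + sqrt (2 * C) + pi + sqrt C) * norm (1::real)"
  proof -
    have "0 \<le> real M * pi" "0 \<le> sqrt (2 * C)" "0 \<le> sqrt C" using C by auto
    moreover have "sqrt x - real n * pi / real p \<le> pi + sqrt C" using up by (simp add: algebra_simps)
    ultimately show ?thesis using low pi_gt_zero unfolding x_def by (simp only: real_norm_def abs_le_iff abs_one mult_1_right) linarith
  qed
qed

end

section \<open>The quadratic form of the problem\<close>

text \<open>The derivative as an operation on the function, one-sided at the ends. With it the form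
  domain consists of single functions rather than of functions paired with their derivatives, and so
  becomes a subspace in the ordinary sense.\<close>

definition grad :: "graph_fun \<Rightarrow> graph_fun"
  where "grad y = (\<lambda>j t. vector_derivative (y j) (at t within {0..1}))"

definition C1_graph :: "nat \<Rightarrow> graph_fun \<Rightarrow> bool"
  where "C1_graph K y \<longleftrightarrow> (\<forall>j\<in>{1..K}. C1_edge (y j) (grad y j))"

lemma grad_eq: "C1_edge (y j) y' \<Longrightarrow> t \<in> {0..1} \<Longrightarrow> grad y j t = y' t"
  unfolding grad_def by (rule vector_derivative_within_closed_interval) (auto dest: C1_edge_deriv)

lemma C1_graphI:
  assumes "\<And>j. j \<in> {1..K} \<Longrightarrow> C1_edge (y j) (y' j)"
  shows "C1_graph K y"
  unfolding C1_graph_def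
  by (intro ballI, rule C1_edge_cong[OF assms]) (auto simp: grad_eq[OF assms])

lemma C1_graph_edge: "C1_graph K y \<Longrightarrow> j \<in> {1..K} \<Longrightarrow> C1_edge (y j) (grad y j)"
  by (simp add: C1_graph_def)

lemmas C1_graph_cont = C1_graph_edge[THEN C1_edge_continuous]
  and C1_graph_cont_grad = C1_graph_edge[THEN C1_edge_continuous_deriv]

lemma satisfies_I_cong:
  assumes "\<And>j. j \<in> {1..K} \<Longrightarrow> x j 0 = y j 0 \<and> x j 1 = y j 1"
  shows "satisfies_I K A x \<longleftrightarrow> satisfies_I K A y"
proof -
  have "(\<Sum>j=1..K. bc_alpha A i j * x j 0 + bc_gamma A i j * x j 1)
      = (\<Sum>j=1..K. bc_alpha A i j * y j 0 + bc_gamma A i j * y j 1)" for i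
    by (rule sum.cong) (use assms in auto)
  then show ?thesis by (simp add: satisfies_I_def)
qed

lemma satisfies_I_zero: "(\<And>j. j \<in> {1..K} \<Longrightarrow> x j 0 = 0 \<and> x j 1 = 0) \<Longrightarrow> satisfies_I K A x"
  by (simp add: satisfies_I_def)

lemma satisfies_I_add: "satisfies_I K A x \<Longrightarrow> satisfies_I K A y \<Longrightarrow> satisfies_I K A (x + y)"
  by (auto simp: satisfies_I_def distrib_left sum.distrib algebra_simps)

lemma satisfies_I_scale:
  assumes "satisfies_I K A x"
  shows "satisfies_I K A (graph_scale c x)"
  unfolding satisfies_I_def
proof
  fix i assume "i \<in> {1..num_I A}"
  have "(\<Sum>j=1..K. bc_alpha A i j * graph_scale c x j 0 + bc_gamma A i j * graph_scale c x j 1)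
      = c * (\<Sum>j=1..K. bc_alpha A i j * x j 0 + bc_gamma A i j * x j 1)"
    by (simp add: graph_scale_def sum_distrib_left algebra_simps)
  then show "(\<Sum>j=1..K. bc_alpha A i j * graph_scale c x j 0 + bc_gamma A i j * graph_scale c x j 1) = 0"
    using assms \<open>i \<in> _\<close> by (simp add: satisfies_I_def)
qed

definition energy0 :: "nat \<Rightarrow> graph_fun \<Rightarrow> real"
  where "energy0 K y = (\<Sum>j=1..K. LINT t|unit_edge. (cmod (y j t))\<^sup>2)"

definition energy1 :: "nat \<Rightarrow> graph_fun \<Rightarrow> real"
  where "energy1 K y = (\<Sum>j=1..K. LINT t|unit_edge. (cmod (grad y j t))\<^sup>2)"

text \<open>One constant weight per edge. With \<open>weight p\<close> this is the indefinite form,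
  with the constant 1 the inner product of the graph; the direct method is applied to both.\<close>

definition weighted_inner :: "nat \<Rightarrow> (nat \<Rightarrow> real) \<Rightarrow> graph_fun \<Rightarrow> graph_fun \<Rightarrow> complex"
  where "weighted_inner K \<omega> x y = (\<Sum>j=1..K. of_real (\<omega> j) * (LINT t|unit_edge. x j t * cnj (y j t)))"

lemma energy0_nonneg: "0 \<le> energy0 K y"
  and energy1_nonneg: "0 \<le> energy1 K y"
  unfolding energy0_def energy1_def by (auto intro!: sum_nonneg)

lemma LINT_of_real_norm_square: "(LINT t|M. y t * cnj (y t)) = of_real (LINT t|M. (cmod (y t))\<^sup>2)"
  unfolding complex_norm_square[symmetric] by (rule integral_complex_of_real)

lemma weighted_inner_diag:
  "weighted_inner K \<omega> y y = of_real (\<Sum>j=1..K. \<omega> j * (LINT t|unit_edge. (cmod (y j t))\<^sup>2))"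
  unfolding weighted_inner_def LINT_of_real_norm_square by simp

lemma L2_edge_continuous: "continuous_on {0..1} y \<Longrightarrow> L2_edge y"
  unfolding L2_edge_def using integrable_continuous_edge[of y]
  by (auto intro!: integrable_continuous_edge continuous_intros borel_measurable_integrable)

section \<open>Estimates for the essentially bounded potential\<close>

locale graph_potential =
  fixes K :: nat and q :: "nat \<Rightarrow> real \<Rightarrow> real"
  assumes potential: "ess_bounded_potential K q"
begin

lemma q_bound: "\<exists>C\<ge>0. \<forall>j\<in>{1..K}. AE t in unit_edge. \<bar>q j t\<bar> \<le> C"
proof -
  have "\<forall>j\<in>{1..K}. \<exists>C. AE t in unit_edge. \<bar>q j t\<bar> \<le> C"
    using potential by (auto simp: ess_bounded_potential_def)
  then obtain c where c: "\<And>j. j \<in> {1..K} \<Longrightarrow> AE t in unit_edge. \<bar>q j t\<bar> \<le> c j" by metis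
  have "AE t in unit_edge. \<bar>q j t\<bar> \<le> (\<Sum>j=1..K. \<bar>c j\<bar>)" if j: "j \<in> {1..K}" for j
  proof -
    have "c j \<le> \<bar>c j\<bar>" by simp
    also have "\<bar>c j\<bar> \<le> (\<Sum>j=1..K. \<bar>c j\<bar>)" by (rule member_le_sum[OF j]) auto
    finally show ?thesis using c[OF j] by (auto elim: eventually_mono)
  qed
  then show ?thesis by (intro exI[of _ "\<Sum>j=1..K. \<bar>c j\<bar>"]) (auto intro: sum_nonneg)
qed

lemma q_measurable: "j \<in> {1..K} \<Longrightarrow> q j \<in> borel_measurable unit_edge"
  using potential by (auto simp: ess_bounded_potential_def)

lemma q_integrable: "j \<in> {1..K} \<Longrightarrow> integrable unit_edge (\<lambda>t. complex_of_real (q j t))"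
proof -
  assume j: "j \<in> {1..K}"
  obtain C where C: "AE t in unit_edge. \<bar>q j t\<bar> \<le> C" using q_bound j by blast
  interpret finite_measure unit_edge by (rule finite_measure_lebesgue_on) simp
  have "integrable unit_edge (q j)"
    by (rule integrable_const_bound[where B = C]) (use C q_measurable[OF j] in auto)
  then show ?thesis by (rule integrable_of_real)
qed

lemma q_mult_integrable:
  fixes z :: "real \<Rightarrow> complex"
  shows "j \<in> {1..K} \<Longrightarrow> continuous_on {0..1} z \<Longrightarrow> integrable unit_edge (\<lambda>t. of_real (q j t) * z t)"
  by (rule integrable_mult_continuous[where g = "\<lambda>t. of_real (q j t)", OF q_integrable])

lemma q_term_bound:
  assumes C: "AE t in unit_edge. \<bar>q j t\<bar> \<le> C" and j: "j \<in> {1..K}" and y: "continuous_on {0..1} y"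
  shows "\<bar>LINT t|unit_edge. q j t * (cmod (y t))\<^sup>2\<bar> \<le> C * (LINT t|unit_edge. (cmod (y t))\<^sup>2)"
proof -
  have int: "integrable unit_edge (\<lambda>t. q j t * (cmod (y t))\<^sup>2)"
  proof -
    have "integrable unit_edge (\<lambda>t. Re (of_real (q j t) * of_real ((cmod (y t))\<^sup>2)))"
      by (intro integrable_Re q_mult_integrable j continuous_intros y)
    then show ?thesis by simp
  qed
  have "\<bar>LINT t|unit_edge. q j t * (cmod (y t))\<^sup>2\<bar> \<le> (LINT t|unit_edge. \<bar>q j t * (cmod (y t))\<^sup>2\<bar>)"
    by (rule integral_abs_bound)
  also have "\<dots> \<le> (LINT t|unit_edge. C * (cmod (y t))\<^sup>2)"
  proof (rule integral_mono_AE)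
    show "integrable unit_edge (\<lambda>t. \<bar>q j t * (cmod (y t))\<^sup>2\<bar>)" using int by simp
    show "integrable unit_edge (\<lambda>t. C * (cmod (y t))\<^sup>2)"
      by (intro integrable_continuous_edge continuous_intros y)
    show "AE t in unit_edge. \<bar>q j t * (cmod (y t))\<^sup>2\<bar> \<le> C * (cmod (y t))\<^sup>2"
      using C by eventually_elim (auto simp: abs_mult intro!: mult_right_mono)
  qed
  finally show ?thesis by simp
qed

text \<open>Almost everywhere \<open>g\<close> is dominated by \<open>(C + |c|) |y|\<close> with
  \<open>y\<close> continuous, which upgrades integrability to square integrability.\<close>

lemma L2_edge_potential:
  assumes "integrable unit_edge g" "AE t in unit_edge. g t = of_real (q j t - c) * y t"
    "continuous_on {0..1} y" "j \<in> {1..K}"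
  shows "L2_edge g"
proof -
  obtain C where C: "AE t in unit_edge. \<bar>q j t\<bar> \<le> C" "0 \<le> C" using q_bound assms(4) by blast
  have m: "g \<in> borel_measurable unit_edge" using assms(1) by simp
  have "integrable unit_edge (\<lambda>t. (cmod (g t))\<^sup>2)"
  proof (rule Bochner_Integration.integrable_bound)
    show "integrable unit_edge (\<lambda>t. ((C + \<bar>c\<bar>) * cmod (y t))\<^sup>2)"
      by (intro integrable_continuous_edge continuous_intros assms)
    show "(\<lambda>t. (cmod (g t))\<^sup>2) \<in> borel_measurable unit_edge" using m by measurable
    show "AE t in unit_edge. norm ((cmod (g t))\<^sup>2) \<le> norm (((C + \<bar>c\<bar>) * cmod (y t))\<^sup>2)"
      using C(1) assms(2)
    proof eventually_elim
      case (elim t)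
      have "cmod (g t) = \<bar>q j t - c\<bar> * cmod (y t)" using elim(2) by (simp only: norm_mult norm_of_real)
      also have "\<dots> \<le> (C + \<bar>c\<bar>) * cmod (y t)" using elim(1) by (intro mult_right_mono) auto
      finally have "(cmod (g t))\<^sup>2 \<le> ((C + \<bar>c\<bar>) * cmod (y t))\<^sup>2" by (intro power_mono) auto
      then show ?case by simp
    qed
  qed
  then show ?thesis using m by (simp add: L2_edge_def)
qed

lemma potential_integrable:
  fixes y :: "real \<Rightarrow> complex"
  assumes j: "j \<in> {1..K}" and y: "continuous_on {0..1} y"
  shows "integrable unit_edge (\<lambda>t. of_real (q j t - c) * y t)"
proof -
  have "integrable unit_edge (\<lambda>t. of_real (q j t) * y t - of_real c * y t)"
    by (intro Bochner_Integration.integrable_diff q_mult_integrable j y integrable_continuous_edge continuous_intros)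
  then show ?thesis by (simp add: algebra_simps)
qed

end

text \<open>\<open>f\<close> is the boundary function of the co-normal conditions. Both assumptions
  speak of boundary data and not of \<open>q\<close>, so the locale can be entered again with the
  potential shifted by a constant.\<close>

locale graph_form = graph_potential K q
  for K :: nat and q :: "nat \<Rightarrow> real \<Rightarrow> real" +
  fixes A :: bdry_cond and f :: graph_fun
  assumes bdry_herm: "satisfies_I K A x \<Longrightarrow> satisfies_I K A y \<Longrightarrow>
      bdry_integral K (\<lambda>j t. f j t * y j t * cnj (x j t)) = cnj (bdry_integral K (\<lambda>j t. f j t * x j t * cnj (y j t)))"
    and conormal: "x \<in> dom_F K A \<Longrightarrow> graph_H2 K x x' x'' \<Longrightarrow>
      (\<forall>y\<in>dom_F K A. bdry_integral K (\<lambda>j t. (f j t * x j t + x' j t) * cnj (y j t)) = 0) \<longleftrightarrow> satisfies_II K A x x'"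
begin

definition V :: "graph_fun set" where "V = {y. C1_graph K y \<and> satisfies_I K A y}"

definition bform :: "graph_fun \<Rightarrow> graph_fun \<Rightarrow> complex"
  where "bform x y = bdry_integral K (\<lambda>j t. f j t * x j t * cnj (y j t))"

text \<open>Integrating the pairing of \<open>l y\<close> with \<open>z\<close> by parts leaves
  minus the boundary integral of \<open>y'\<close> times the conjugate of \<open>z\<close>. The
  co-normal identity replaces it by plus that of \<open>f y\<close> times the conjugate of
  \<open>z\<close>, hence the sign of \<open>bform\<close>.\<close>

definition F :: "graph_fun \<Rightarrow> graph_fun \<Rightarrow> complex"
  where "F x y = (\<Sum>j=1..K. (LINT t|unit_edge. grad x j t * cnj (grad y j t))
    + (LINT t|unit_edge. of_real (q j t) * (x j t * cnj (y j t)))) + bform x y"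

lemma V_C1: "y \<in> V \<Longrightarrow> C1_graph K y" and V_I: "y \<in> V \<Longrightarrow> satisfies_I K A y"
  by (auto simp: V_def)

lemma subspace_V: "module.subspace graph_scale V"
proof -
  interpret vector_space graph_scale by (rule vector_space_graph_scale)
  show ?thesis
  proof (rule subspaceI)
    show "0 \<in> V"
      unfolding V_def using C1_edge_const[of 0]
      by (auto intro!: C1_graphI[where y' = "\<lambda>_ _. 0"] satisfies_I_zero simp: zero_fun_def)
    fix x y assume xy: "x \<in> V" "y \<in> V"
    have "C1_graph K (x + y)"
      by (rule C1_graphI[where y' = "\<lambda>j t. grad x j t + grad y j t"])
        (use C1_edge_add[OF V_C1[OF xy(1), THEN C1_graph_edge] V_C1[OF xy(2), THEN C1_graph_edge]] in
          \<open>simp add: plus_fun_def\<close>)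
    then show "x + y \<in> V" using xy by (simp add: V_def satisfies_I_add)
  next
    fix c x assume x: "x \<in> V"
    have "C1_graph K (graph_scale c x)"
      by (rule C1_graphI[where y' = "\<lambda>j t. c * grad x j t"])
        (use C1_edge_cmult[OF V_C1[OF x, THEN C1_graph_edge]] in \<open>simp add: graph_scale_def\<close>)
    then show "graph_scale c x \<in> V" using x by (simp add: V_def satisfies_I_scale)
  qed
qed

lemma grad_add:
  assumes "C1_graph K x" "C1_graph K y" "j \<in> {1..K}" "t \<in> {0..1}"
  shows "grad (x + y) j t = grad x j t + grad y j t"
  using C1_edge_add[OF C1_graph_edge[OF assms(1,3)] C1_graph_edge[OF assms(2,3)]] assms(4)
  by (subst grad_eq[where y' = "\<lambda>t. grad x j t + grad y j t"]) (auto simp: plus_fun_def)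

lemma grad_scale:
  assumes "C1_graph K x" "j \<in> {1..K}" "t \<in> {0..1}"
  shows "grad (graph_scale c x) j t = c * grad x j t"
  using C1_edge_cmult[OF C1_graph_edge[OF assms(1,2)]] assms(3)
  by (subst grad_eq[where y' = "\<lambda>t. c * grad x j t"]) (auto simp: graph_scale_def)

lemma bform_add: "bform (x + y) z = bform x z + bform y z"
  by (simp add: bform_def bdry_integral_def algebra_simps sum.distrib sum_subtractf)

lemma bform_scale: "bform (graph_scale c x) z = c * bform x z"
  by (simp add: bform_def bdry_integral_def graph_scale_def algebra_simps sum_distrib_left)

lemma F_hermitian: "hermitian_form graph_scale V F"
proof -
  interpret vector_space graph_scale by (rule vector_space_graph_scale)
  show ?thesis
  proof unfold_locales
    show "subspace V" by (rule subspace_V)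
  next
    fix x y z assume V: "x \<in> V" "y \<in> V" "z \<in> V"
    note C = V[THEN V_C1]
    have "(LINT t|unit_edge. grad (x + y) j t * cnj (grad z j t))
      = (LINT t|unit_edge. grad x j t * cnj (grad z j t)) + (LINT t|unit_edge. grad y j t * cnj (grad z j t))"
      if j: "j \<in> {1..K}" for j
    proof -
      have "(LINT t|unit_edge. grad (x + y) j t * cnj (grad z j t))
        = (LINT t|unit_edge. grad x j t * cnj (grad z j t) + grad y j t * cnj (grad z j t))"
        by (rule LINT_cong) (auto simp: grad_add[OF C(1,2) j] distrib_right)
      also have "\<dots> = (LINT t|unit_edge. grad x j t * cnj (grad z j t)) + (LINT t|unit_edge. grad y j t * cnj (grad z j t))"
        by (intro LINT_add integrable_continuous_edge continuous_intros
            C1_graph_cont_grad[OF _ j] C)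
      finally show ?thesis .
    qed
    moreover have "(LINT t|unit_edge. of_real (q j t) * ((x + y) j t * cnj (z j t)))
      = (LINT t|unit_edge. of_real (q j t) * (x j t * cnj (z j t))) + (LINT t|unit_edge. of_real (q j t) * (y j t * cnj (z j t)))"
      if j: "j \<in> {1..K}" for j
    proof -
      have "(LINT t|unit_edge. of_real (q j t) * ((x + y) j t * cnj (z j t)))
        = (LINT t|unit_edge. of_real (q j t) * (x j t * cnj (z j t)) + of_real (q j t) * (y j t * cnj (z j t)))"
        by (rule LINT_cong) (auto simp: algebra_simps)
      also have "\<dots> = (LINT t|unit_edge. of_real (q j t) * (x j t * cnj (z j t))) + (LINT t|unit_edge. of_real (q j t) * (y j t * cnj (z j t)))"
        by (intro LINT_add q_mult_integrable j continuous_intros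
            C1_graph_cont[OF _ j] C)
      finally show ?thesis .
    qed
    ultimately show "F (x + y) z = F x z + F y z"
      by (simp add: F_def bform_add sum.distrib)
  next
    fix x z c assume V: "x \<in> V" "z \<in> V"
    note C = V[THEN V_C1]
    have "(LINT t|unit_edge. grad (graph_scale c x) j t * cnj (grad z j t))
      = c * (LINT t|unit_edge. grad x j t * cnj (grad z j t))" if j: "j \<in> {1..K}" for j
      unfolding integral_mult_right_zero[symmetric]
      by (rule LINT_cong) (auto simp: grad_scale[OF C(1) j])
    moreover have "(LINT t|unit_edge. of_real (q j t) * ((graph_scale c x) j t * cnj (z j t)))
      = c * (LINT t|unit_edge. of_real (q j t) * (x j t * cnj (z j t)))" for j
      unfolding integral_mult_right_zero[symmetric]
      by (rule LINT_cong) (auto simp: graph_scale_def)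
    ultimately show "F (graph_scale c x) z = c * F x z"
      by (simp add: F_def bform_scale sum_distrib_left distrib_left)
  next
    fix x y assume V: "x \<in> V" "y \<in> V"
    have "(LINT t|unit_edge. grad y j t * cnj (grad x j t)) = cnj (LINT t|unit_edge. grad x j t * cnj (grad y j t))" for j
      unfolding Bochner_Integration.integral_cnj[symmetric] by (simp add: mult.commute)
    moreover have "(LINT t|unit_edge. of_real (q j t) * (y j t * cnj (x j t)))
        = cnj (LINT t|unit_edge. of_real (q j t) * (x j t * cnj (y j t)))" for j
      unfolding Bochner_Integration.integral_cnj[symmetric] by (simp add: mult.commute)
    moreover have "bform y x = cnj (bform x y)"
      unfolding bform_def by (rule bdry_herm) (use V V_I in auto)
    ultimately show "F y x = cnj (F x y)" by (simp add: F_def)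
  qed
qed

lemma weighted_inner_hermitian: "hermitian_form graph_scale V (weighted_inner K \<omega>)"
proof -
  interpret vector_space graph_scale by (rule vector_space_graph_scale)
  show ?thesis
  proof unfold_locales
    show "subspace V" by (rule subspace_V)
  next
    fix x y z assume V: "x \<in> V" "y \<in> V" "z \<in> V"
    note C = V[THEN V_C1]
    have "(LINT t|unit_edge. (x + y) j t * cnj (z j t))
      = (LINT t|unit_edge. x j t * cnj (z j t)) + (LINT t|unit_edge. y j t * cnj (z j t))"
      if j: "j \<in> {1..K}" for j
    proof -
      have "(LINT t|unit_edge. (x + y) j t * cnj (z j t))
        = (LINT t|unit_edge. x j t * cnj (z j t) + y j t * cnj (z j t))"
        by (rule LINT_cong) (auto simp: algebra_simps)
      also have "\<dots> = (LINT t|unit_edge. x j t * cnj (z j t)) + (LINT t|unit_edge. y j t * cnj (z j t))"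
        by (intro LINT_add integrable_continuous_edge continuous_intros
            C1_graph_cont[OF _ j] C)
      finally show ?thesis .
    qed
    then show "weighted_inner K \<omega> (x + y) z = weighted_inner K \<omega> x z + weighted_inner K \<omega> y z"
      by (simp add: weighted_inner_def sum.distrib distrib_left)
  next
    fix x z c
    have "(LINT t|unit_edge. (graph_scale c x) j t * cnj (z j t))
      = c * (LINT t|unit_edge. x j t * cnj (z j t))" for j
      unfolding integral_mult_right_zero[symmetric]
      by (rule LINT_cong) (auto simp: graph_scale_def)
    then show "weighted_inner K \<omega> (graph_scale c x) z = c * weighted_inner K \<omega> x z"
      by (simp add: weighted_inner_def sum_distrib_left mult_ac)
  next
    fix x y :: graph_fun
    have "(LINT t|unit_edge. y j t * cnj (x j t)) = cnj (LINT t|unit_edge. x j t * cnj (y j t))" for j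
      unfolding Bochner_Integration.integral_cnj[symmetric] by (simp add: mult.commute)
    then show "weighted_inner K \<omega> y x = cnj (weighted_inner K \<omega> x y)"
      by (simp add: weighted_inner_def)
  qed
qed

lemma Re_F_diag:
  assumes "y \<in> V"
  shows "Re (F y y) = energy1 K y + (\<Sum>j=1..K. LINT t|unit_edge. q j t * (cmod (y j t))\<^sup>2) + Re (bform y y)"
proof -
  have "(LINT t|unit_edge. of_real (q j t) * (y j t * cnj (y j t))) = of_real (LINT t|unit_edge. q j t * (cmod (y j t))\<^sup>2)" for j
    unfolding complex_norm_square[symmetric] of_real_mult[symmetric] by (rule integral_complex_of_real)
  then show ?thesis unfolding F_def LINT_of_real_norm_square energy1_def
    by (simp add: sum.distrib)
qed

lemma bform_bound:
  "\<exists>M\<ge>0. \<forall>y. cmod (bform y y) \<le> M * (\<Sum>j=1..K. (cmod (y j 1))\<^sup>2 + (cmod (y j 0))\<^sup>2)"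
proof -
  define M where "M = (\<Sum>j=1..K. cmod (f j 1) + cmod (f j 0))"
  have M0: "0 \<le> M" unfolding M_def by (intro sum_nonneg) auto
  have M: "cmod (f j 1) \<le> M" "cmod (f j 0) \<le> M" if "j \<in> {1..K}" for j
  proof -
    have "cmod (f j 1) + cmod (f j 0) \<le> M" unfolding M_def by (rule member_le_sum[OF that]) auto
    then show "cmod (f j 1) \<le> M" "cmod (f j 0) \<le> M"
      using norm_ge_zero[of "f j 0"] norm_ge_zero[of "f j 1"] by linarith+
  qed
  have "cmod (bform y y) \<le> M * (\<Sum>j=1..K. (cmod (y j 1))\<^sup>2 + (cmod (y j 0))\<^sup>2)" for y
    unfolding bform_def bdry_integral_def sum_distrib_left
  proof (rule order_trans[OF norm_sum], rule sum_mono)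
    fix j assume j: "j \<in> {1..K}"
    have "cmod (f j 1 * y j 1 * cnj (y j 1) - f j 0 * y j 0 * cnj (y j 0))
        \<le> cmod (f j 1) * (cmod (y j 1))\<^sup>2 + cmod (f j 0) * (cmod (y j 0))\<^sup>2"
      by (rule order_trans[OF norm_triangle_ineq4]) (simp add: norm_mult power2_eq_square)
    also have "\<dots> \<le> M * (cmod (y j 1))\<^sup>2 + M * (cmod (y j 0))\<^sup>2"
      using M[OF j] by (intro add_mono mult_right_mono) auto
    finally show "cmod (f j 1 * y j 1 * cnj (y j 1) - f j 0 * y j 0 * cnj (y j 0))
        \<le> M * ((cmod (y j 1))\<^sup>2 + (cmod (y j 0))\<^sup>2)" by (simp add: distrib_left)
  qed
  then show ?thesis using M0 by blast
qed

text \<open>The potential costs at most a multiple of \<open>energy0\<close>, and the boundary form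
  is split by \<open>trace_bound\<close> so that it uses up at most half of
  \<open>energy1\<close>.\<close>

lemma Garding: "\<exists>d\<ge>0. \<forall>y\<in>V. energy1 K y \<le> 2 * Re (F y y) + d * energy0 K y"
proof -
  obtain C where C: "0 \<le> C" "\<And>j. j \<in> {1..K} \<Longrightarrow> AE t in unit_edge. \<bar>q j t\<bar> \<le> C"
    using q_bound by blast
  obtain M where M: "0 \<le> M" "\<And>y. cmod (bform y y) \<le> M * (\<Sum>j=1..K. (cmod (y j 1))\<^sup>2 + (cmod (y j 0))\<^sup>2)"
    using bform_bound by blast
  \<comment> \<open>With this choice \<open>2 M e\<close> is at most 1/2; the summand 1 covers
    \<open>M = 0\<close>.\<close>
  define e where "e = 1 / (4 * (M + 1))"
  have e: "0 < e" "2 * M * e \<le> 1 / 2" using M(1) by (auto simp: e_def field_simps)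
  define B where "B = 2 * M * (1 + 1 / e)"
  have "energy1 K y \<le> 2 * Re (F y y) + (2 * C + 2 * B) * energy0 K y" if y: "y \<in> V" for y
  proof -
    have "- (\<Sum>j=1..K. LINT t|unit_edge. q j t * (cmod (y j t))\<^sup>2) \<le> C * energy0 K y"
      unfolding energy0_def sum_distrib_left sum_negf[symmetric]
    proof (rule sum_mono)
      fix j assume j: "j \<in> {1..K}"
      show "- (LINT t|unit_edge. q j t * (cmod (y j t))\<^sup>2) \<le> C * (LINT t|unit_edge. (cmod (y j t))\<^sup>2)"
        using q_term_bound[OF C(2)[OF j] j C1_graph_cont[OF V_C1[OF y] j]] by linarith
    qed
    moreover have "- Re (bform y y) \<le> (1 / 2) * energy1 K y + B * energy0 K y"
    proof -
      have "- Re (bform y y) \<le> cmod (bform y y)" using abs_Re_le_cmod[of "bform y y"] by linarith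
      also have "\<dots> \<le> M * (\<Sum>j=1..K. (cmod (y j 1))\<^sup>2 + (cmod (y j 0))\<^sup>2)" by (rule M(2))
      also have "\<dots> \<le> M * (\<Sum>j=1..K. 2 * (e * (LINT t|unit_edge. (cmod (grad y j t))\<^sup>2)
          + (1 + 1 / e) * (LINT t|unit_edge. (cmod (y j t))\<^sup>2)))"
      proof (intro mult_left_mono[OF _ M(1)] sum_mono)
        fix j assume j: "j \<in> {1..K}"
        show "(cmod (y j 1))\<^sup>2 + (cmod (y j 0))\<^sup>2 \<le> 2 * (e * (LINT t|unit_edge. (cmod (grad y j t))\<^sup>2)
          + (1 + 1 / e) * (LINT t|unit_edge. (cmod (y j t))\<^sup>2))"
          using trace_bound[OF C1_graph_edge[OF V_C1[OF y] j] e(1), of 0]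
            trace_bound[OF C1_graph_edge[OF V_C1[OF y] j] e(1), of 1] by simp
      qed
      also have "\<dots> = (2 * M * e) * energy1 K y + B * energy0 K y"
        unfolding energy0_def energy1_def B_def
        by (simp add: sum.distrib sum_distrib_left algebra_simps)
      also have "\<dots> \<le> (1 / 2) * energy1 K y + B * energy0 K y"
        by (intro add_right_mono mult_right_mono e energy1_nonneg)
      finally show ?thesis .
    qed
    ultimately show ?thesis using Re_F_diag[OF y] by (simp add: distrib_right)
  qed
  moreover have "0 \<le> 2 * C + 2 * B" using C(1) M(1) e(1) by (simp add: B_def)
  ultimately show ?thesis by blast
qed

text \<open>The equation \<open>- y'' + q y = l \<omega> y\<close> solved for \<open>y''\<close>. A
  general weight lets one notion cover both the indefinite problem and the eigenvalue problem of
  \<open>L\<close> itself.\<close>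

definition solution :: "(nat \<Rightarrow> real) \<Rightarrow> real \<Rightarrow> graph_fun \<Rightarrow> graph_fun \<Rightarrow> graph_fun \<Rightarrow> bool"
  where "solution \<omega> l y y' y'' \<longleftrightarrow> graph_AC_deriv K y y' \<and> graph_AC_deriv K y' y'' \<and>
    (\<forall>j\<in>{1..K}. AE t in unit_edge. y'' j t = of_real (q j t - l * \<omega> j) * y j t) \<and>
    satisfies_I K A y \<and> satisfies_II K A y y'"

lemma dom_F_of_C1: "C1_graph K y \<Longrightarrow> satisfies_I K A y \<Longrightarrow> y \<in> dom_F K A"
  unfolding dom_F_def graph_H1_def graph_AC_deriv_def graph_L2_def
  using C1_edge_imp_AC_deriv[OF C1_graph_edge] L2_edge_continuous[OF C1_graph_cont_grad] by blast

lemma AC_C1_edge: "AC_deriv y y' \<Longrightarrow> AC_deriv y' y'' \<Longrightarrow> C1_edge y y'"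
  by (rule AC_deriv_imp_C1_edge[OF _ AC_deriv_continuous])

text \<open>By the equation \<open>y''\<close> is a bounded function times a continuous one, hence
  square integrable. This makes the co-normal equivalence applicable, which is stated on
  \<open>graph_H2\<close>.\<close>

lemma solution_H2:
  assumes "solution \<omega> l y y' y''"
  shows "graph_H2 K y y' y''" "y \<in> V" "y \<in> dom_F K A"
proof -
  have AC: "AC_deriv (y j) (y' j)" "AC_deriv (y' j) (y'' j)" if "j \<in> {1..K}" for j
    using assms that by (auto simp: solution_def graph_AC_deriv_def)
  note C1 = AC_C1_edge[OF AC]
  have "C1_graph K y" by (rule C1_graphI[OF C1])
  then show "y \<in> V" "y \<in> dom_F K A" using assms dom_F_of_C1 by (auto simp: V_def solution_def)
  show "graph_H2 K y y' y''"
    unfolding graph_H2_def graph_H1_def graph_L2_def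
  proof (intro conjI ballI)
    fix j assume j: "j \<in> {1..K}"
    show "L2_edge (y' j)" by (rule L2_edge_continuous[OF AC_deriv_continuous[OF AC(2)[OF j]]])
    show "L2_edge (y'' j)"
      by (rule L2_edge_potential[where c = "l * \<omega> j", OF _ _ AC_deriv_continuous[OF AC(1)[OF j]] j])
        (use assms j AC(2)[OF j] in \<open>auto simp: solution_def AC_deriv_def\<close>)
  qed (use assms in \<open>auto simp: solution_def\<close>)
qed

text \<open>Integration by parts leaves the boundary integral of \<open>y'\<close> times the
  conjugate of \<open>z\<close>; condition (II), read through the co-normal equivalence, cancels it
  against \<open>bform\<close>.\<close>

lemma solution_weak:
  assumes sol: "solution \<omega> l y y' y''" and z: "z \<in> V"
  shows "F y z = of_real l * weighted_inner K \<omega> y z"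
proof -
  have AC: "AC_deriv (y j) (y' j)" "AC_deriv (y' j) (y'' j)" if "j \<in> {1..K}" for j
    using sol that by (auto simp: solution_def graph_AC_deriv_def)
  have "\<forall>z\<in>dom_F K A. bdry_integral K (\<lambda>j t. (f j t * y j t + y' j t) * cnj (z j t)) = 0"
    using conormal[OF solution_H2(3,1)[OF sol]] sol by (simp add: solution_def)
  then have "bdry_integral K (\<lambda>j t. (f j t * y j t + y' j t) * cnj (z j t)) = 0"
    using dom_F_of_C1[OF V_C1[OF z] V_I[OF z]] by blast
  moreover have "bdry_integral K (\<lambda>j t. (f j t * y j t + y' j t) * cnj (z j t))
      = bform y z + (\<Sum>j=1..K. y' j 1 * cnj (z j 1) - y' j 0 * cnj (z j 0))"
    by (simp add: bdry_integral_def bform_def algebra_simps sum.distrib sum_subtractf)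
  ultimately have b: "bform y z = - (\<Sum>j=1..K. y' j 1 * cnj (z j 1) - y' j 0 * cnj (z j 0))"
    by (simp add: add_eq_0_iff)
  have "(LINT t|unit_edge. grad y j t * cnj (grad z j t)) + (LINT t|unit_edge. of_real (q j t) * (y j t * cnj (z j t)))
      = (y' j 1 * cnj (z j 1) - y' j 0 * cnj (z j 0)) + of_real (l * \<omega> j) * (LINT t|unit_edge. y j t * cnj (z j t))"
    if j: "j \<in> {1..K}" for j
  proof -
    note C1 = AC_C1_edge[OF AC[OF j]]
    note zc = C1_graph_edge[OF V_C1[OF z] j]
    note yc = C1_edge_continuous[OF C1]
    have "(LINT t|unit_edge. grad y j t * cnj (grad z j t)) = (LINT t|unit_edge. y' j t * cnj (grad z j t))"
      by (rule LINT_cong) (auto simp: grad_eq[of y j "y' j", OF C1])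
    also have "\<dots> = y' j 1 * cnj (z j 1) - y' j 0 * cnj (z j 0) - (LINT t|unit_edge. y'' j t * cnj (z j t))"
      using LINT_AC_by_parts[OF AC(2)[OF j] C1_edge_cnj[OF zc]] by simp
    also have "(LINT t|unit_edge. y'' j t * cnj (z j t))
        = (LINT t|unit_edge. of_real (q j t) * (y j t * cnj (z j t)) - of_real (l * \<omega> j) * (y j t * cnj (z j t)))"
    proof (rule integral_cong_AE)
      have "integrable unit_edge (\<lambda>t. y'' j t * cnj (z j t))"
        by (rule integrable_mult_continuous)
          (use AC(2)[OF j] in \<open>auto simp: AC_deriv_def intro!: continuous_intros C1_edge_continuous[OF zc]\<close>)
      then show "(\<lambda>t. y'' j t * cnj (z j t)) \<in> borel_measurable unit_edge" by simp
      have "integrable unit_edge (\<lambda>t. of_real (q j t) * (y j t * cnj (z j t)) - of_real (l * \<omega> j) * (y j t * cnj (z j t)))"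
        by (intro Bochner_Integration.integrable_diff q_mult_integrable j integrable_continuous_edge
            continuous_intros yc C1_edge_continuous[OF zc])
      then show "(\<lambda>t. of_real (q j t) * (y j t * cnj (z j t)) - of_real (l * \<omega> j) * (y j t * cnj (z j t))) \<in> borel_measurable unit_edge"
        by simp
      have "AE t in unit_edge. y'' j t = of_real (q j t - l * \<omega> j) * y j t"
        using sol j by (auto simp: solution_def)
      then show "AE t in unit_edge. y'' j t * cnj (z j t) = of_real (q j t) * (y j t * cnj (z j t)) - of_real (l * \<omega> j) * (y j t * cnj (z j t))"
      proof eventually_elim
        case (elim t)
        show ?case unfolding elim by (simp add: algebra_simps)
      qed
    qed
    also have "\<dots> = (LINT t|unit_edge. of_real (q j t) * (y j t * cnj (z j t))) - (LINT t|unit_edge. of_real (l * \<omega> j) * (y j t * cnj (z j t)))"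
      by (intro LINT_diff q_mult_integrable j integrable_continuous_edge
            continuous_intros yc C1_edge_continuous[OF zc])
    also have "(LINT t|unit_edge. of_real (l * \<omega> j) * (y j t * cnj (z j t))) = of_real (l * \<omega> j) * (LINT t|unit_edge. y j t * cnj (z j t))"
      by simp
    finally show ?thesis by simp
  qed
  then have "F y z = (\<Sum>j=1..K. (y' j 1 * cnj (z j 1) - y' j 0 * cnj (z j 0)) + of_real (l * \<omega> j) * (LINT t|unit_edge. y j t * cnj (z j t))) + bform y z"
    unfolding F_def by simp
  also have "\<dots> = (\<Sum>j=1..K. of_real (l * \<omega> j) * (LINT t|unit_edge. y j t * cnj (z j t)))"
    unfolding b by (simp add: sum.distrib)
  also have "\<dots> = of_real l * weighted_inner K \<omega> y z"
    unfolding weighted_inner_def sum_distrib_left by (simp add: mult.assoc)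
  finally show ?thesis .
qed

end

section \<open>The direct method\<close>

lemma hermitian_form_diff:
  assumes "hermitian_form sc V h" "hermitian_form sc V k"
  shows "hermitian_form sc V (\<lambda>x y. h x y - complex_of_real r * k x y)"
proof -
  interpret h: hermitian_form sc V h by fact
  interpret k: hermitian_form sc V k by fact
  show ?thesis
  proof unfold_locales
    fix x y assume "x \<in> V" "y \<in> V"
    then show "h y x - complex_of_real r * k y x = cnj (h x y - complex_of_real r * k x y)"
      using h.herm[of x y] k.herm[of x y] by simp
  qed (use h.subspace_V in \<open>auto simp: h.add_left k.add_left h.scale_left k.scale_left algebra_simps\<close>)
qed

lemma LINT_tendsto:
  fixes s :: "nat \<Rightarrow> real \<Rightarrow> complex" and u h :: "real \<Rightarrow> complex"
  assumes h: "integrable unit_edge h" and s: "\<And>n. continuous_on {0..1} (s n)" and u: "continuous_on {0..1} u"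
    and lim: "\<And>t. t \<in> {0..1} \<Longrightarrow> (\<lambda>n. s n t) \<longlonglongrightarrow> u t"
    and B: "\<And>n t. t \<in> {0..1} \<Longrightarrow> cmod (s n t) \<le> B"
  shows "(\<lambda>n. LINT t|unit_edge. h t * s n t) \<longlonglongrightarrow> (LINT t|unit_edge. h t * u t)"
proof (rule integral_dominated_convergence)
  show "(\<lambda>t. h t * u t) \<in> borel_measurable unit_edge"
    using integrable_mult_continuous[OF h u] by simp
  show "(\<lambda>t. h t * s n t) \<in> borel_measurable unit_edge" for n
    using integrable_mult_continuous[OF h s] by simp
  show "integrable unit_edge (\<lambda>t. cmod (h t) * B)" using h by simp
  show "AE t in unit_edge. (\<lambda>n. h t * s n t) \<longlonglongrightarrow> h t * u t"
    by (rule AE_I2) (auto intro!: tendsto_mult lim)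
  show "AE t in unit_edge. norm (h t * s n t) \<le> cmod (h t) * B" for n
    by (rule AE_I2) (auto simp: norm_mult intro!: mult_left_mono B)
qed

text \<open>The trace bound controls the value at one end and the oscillation bound the rest, which
  yields uniform boundedness and equicontinuity. All edges are placed side by side in one compact
  subset of the plane, so that a single application of Arzela-Ascoli gives one subsequence for all
  of them.\<close>

lemma graph_compactness:
  assumes C1: "\<And>n. C1_graph K (y n)" and R: "\<And>n. energy0 K (y n) \<le> R" "\<And>n. energy1 K (y n) \<le> R"
  obtains k u B where "strict_mono (k :: nat \<Rightarrow> nat)" "\<And>j. j \<in> {1..K} \<Longrightarrow> continuous_on {0..1} (u j)"
    "\<And>j t. j \<in> {1..K} \<Longrightarrow> t \<in> {0..1} \<Longrightarrow> (\<lambda>n. y (k n) j t) \<longlonglongrightarrow> u j t"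
    "\<And>n j t. j \<in> {1..K} \<Longrightarrow> t \<in> {0..1} \<Longrightarrow> cmod (y n j t) \<le> B"
    "\<And>j t. \<not> (j \<in> {1..K} \<and> t \<in> {0..1}) \<Longrightarrow> u j t = 0"
proof -
  have R0: "0 \<le> R" using energy0_nonneg[of K "y 0"] R(1)[of 0] by linarith
  have e0: "(LINT t|unit_edge. (cmod (y n j t))\<^sup>2) \<le> R" if j: "j \<in> {1..K}" for n j
    using member_le_sum[OF j, of "\<lambda>j. LINT t|unit_edge. (cmod (y n j t))\<^sup>2"] R(1)[of n]
    unfolding energy0_def by (auto intro: order_trans)
  have e1: "(LINT t|unit_edge. (cmod (grad (y n) j t))\<^sup>2) \<le> R" if j: "j \<in> {1..K}" for n j
    using member_le_sum[OF j, of "\<lambda>j. LINT t|unit_edge. (cmod (grad (y n) j t))\<^sup>2"] R(2)[of n]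
    unfolding energy1_def by (auto intro: order_trans)
  have osc: "cmod (y n j t - y n j s) \<le> e * R + \<bar>t - s\<bar> / e"
    if "j \<in> {1..K}" "s \<in> {0..1}" "t \<in> {0..1}" "0 < e" for n j s t e
  proof -
    have "cmod (y n j b - y n j a) \<le> e * R + \<bar>b - a\<bar> / e" if "0 \<le> a" "a \<le> b" "b \<le> 1" for a b
    proof -
      have "cmod (y n j b - y n j a) \<le> e * (LINT t|unit_edge. (cmod (grad (y n) j t))\<^sup>2) + (b - a) / e"
        by (rule oscillation_bound[OF C1_graph_edge[OF C1 \<open>j \<in> _\<close>] \<open>0 < e\<close> that])
      also have "\<dots> \<le> e * R + \<bar>b - a\<bar> / e"
        using e1[OF \<open>j \<in> _\<close>] that \<open>0 < e\<close> by (intro add_mono mult_left_mono) auto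
      finally show ?thesis .
    qed
    from this[of s t] this[of t s] show ?thesis
      using that by (cases "s \<le> t") (auto simp: norm_minus_commute abs_minus_commute)
  qed
  \<comment> \<open>At the initial point \<open>|y| \<le> |y|^2 + 1 \<le> 3 R + 1\<close>, and the
    oscillation bound with \<open>e = 1\<close> adds at most \<open>R + 1\<close>.\<close>
  define B where "B = 3 * R + 2 + R"
  have B: "cmod (y n j t) \<le> B" if j: "j \<in> {1..K}" and t: "t \<in> {0..1}" for n j t
  proof -
    have "(cmod (y n j 0))\<^sup>2 \<le> 1 * (LINT t|unit_edge. (cmod (grad (y n) j t))\<^sup>2) + (1 + 1 / 1) * (LINT t|unit_edge. (cmod (y n j t))\<^sup>2)"
      by (rule trace_bound[OF C1_graph_edge[OF C1 j]]) auto
    also have "\<dots> \<le> 3 * R" using e0[OF j, of n] e1[OF j, of n] by simp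
    finally have "(cmod (y n j 0))\<^sup>2 \<le> 3 * R" .
    moreover have "cmod (y n j 0) \<le> (cmod (y n j 0))\<^sup>2 + 1"
      using zero_le_power2[of "cmod (y n j 0) - 1 / 2"] by (simp add: power2_eq_square algebra_simps)
    moreover have "cmod (y n j t - y n j 0) \<le> R + 1"
      using osc[OF j _ t, of 0 1 n] t by simp
    moreover have "cmod (y n j t) \<le> cmod (y n j t - y n j 0) + cmod (y n j 0)"
      using norm_triangle_ineq[of "y n j t - y n j 0" "y n j 0"] by simp
    ultimately show ?thesis by (simp add: B_def)
  qed
  define S where "S = real ` {1..K} \<times> {0..1::real}"
  define G where "G = (\<lambda>n (p::real \<times> real). y n (nat \<lfloor>fst p\<rfloor>) (snd p))"
  have "compact S" unfolding S_def by (intro compact_Times compact_Icc finite_imp_compact[of "real ` {1..K}"]) auto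
  moreover have "norm (G n p) \<le> B" if "p \<in> S" for n p
    using that by (auto simp: S_def G_def intro!: B)
  moreover have "\<exists>d. 0 < d \<and> (\<forall>n p'. p' \<in> S \<and> norm (p - p') < d \<longrightarrow> norm (G n p - G n p') < e)"
    if p: "p \<in> S" and e: "0 < e" for p e
  proof -
    obtain j t where jt: "p = (real j, t)" "j \<in> {1..K}" "t \<in> {0..1}" using p by (auto simp: S_def)
    \<comment> \<open>\<open>h\<close> makes the energy part of the oscillation smaller than
      \<open>e / 2\<close>. Below, \<open>d\<close> does the same for the part
      \<open>|t - t'| / h\<close> and, being at most 1/2, keeps both points on the same
      edge.\<close>
    define h where "h = e / (4 * (R + 1))"
    have h: "0 < h" "h * R < e / 2" using e R0 by (auto simp: h_def field_simps intro!: add_pos_nonneg)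
    define d where "d = min (1/2) (h * e / 2)"
    have d: "0 < d" "d \<le> 1/2" "d \<le> h * e / 2" using h e by (auto simp: d_def)
    have "norm (G n p - G n p') < e" if p': "p' \<in> S" "norm (p - p') < d" for n p'
    proof -
      obtain j' t' where jt': "p' = (real j', t')" "j' \<in> {1..K}" "t' \<in> {0..1}" using p' by (auto simp: S_def)
      have "norm (real j - real j') \<le> norm (p - p')" "norm (t - t') \<le> norm (p - p')"
        using norm_fst_le[of "real j - real j'" "t - t'"] norm_snd_le[of "t - t'" "real j - real j'"]
        by (auto simp: jt jt')
      then have "\<bar>real j - real j'\<bar> < 1" "\<bar>t - t'\<bar> < d" using p'(2) d by auto
      then have "j = j'" by linarith
      have "norm (G n p - G n p') \<le> h * R + \<bar>t - t'\<bar> / h"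
        using osc[OF jt(2) jt'(3) jt(3) h(1), of n] \<open>j = j'\<close> by (simp add: G_def jt jt')
      moreover have "\<bar>t - t'\<bar> / h < e / 2"
      proof -
        have "\<bar>t - t'\<bar> < h * e / 2" using \<open>\<bar>t - t'\<bar> < d\<close> d by linarith
        then show ?thesis using h(1) by (simp add: field_simps)
      qed
      ultimately show ?thesis using h(2) by linarith
    qed
    then show ?thesis using d(1) by blast
  qed
  ultimately obtain g and k :: "nat \<Rightarrow> nat" where g: "continuous_on S g" "strict_mono k"
      "\<And>e. 0 < e \<Longrightarrow> \<exists>N. \<forall>n x. n \<ge> N \<and> x \<in> S \<longrightarrow> norm (G (k n) x - g x) < e"
    using Arzela_Ascoli[of S G B] by metis
  \<comment> \<open>The value 0 off the graph is the normalisation demanded by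
    \<open>eigenspace\<close>.\<close>
  define u where "u = (\<lambda>j t. if j \<in> {1..K} \<and> t \<in> {0..1} then g (real j, t) else 0)"
  have uc: "continuous_on {0..1} (u j)" if j: "j \<in> {1..K}" for j
  proof -
    have "continuous_on {0..1} (\<lambda>t. g (real j, t))"
      by (rule continuous_on_compose2[OF g(1)]) (use j in \<open>auto intro!: continuous_intros simp: S_def\<close>)
    then show ?thesis by (rule continuous_on_eq) (use j in \<open>auto simp: u_def\<close>)
  qed
  have lim: "(\<lambda>n. y (k n) j t) \<longlonglongrightarrow> u j t" if j: "j \<in> {1..K}" "t \<in> {0..1}" for j t
  proof (rule LIMSEQ_I)
    fix r :: real assume "0 < r"
    then obtain N where N: "\<And>n x. n \<ge> N \<Longrightarrow> x \<in> S \<Longrightarrow> norm (G (k n) x - g x) < r" using g(3) by blast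
    have "(real j, t) \<in> S" using j by (auto simp: S_def)
    then show "\<exists>N. \<forall>n\<ge>N. norm (y (k n) j t - u j t) < r"
      using N[of _ "(real j, t)"] j by (intro exI[of _ N]) (auto simp: G_def u_def)
  qed
  show ?thesis
  proof (rule that[OF g(2), of u B])
    show "u j t = 0" if "\<not> (j \<in> {1..K} \<and> t \<in> {0..1})" for j t
      using that unfolding u_def by (rule if_not_P)
  qed (rule uc lim B, assumption+)+
qed

context graph_form
begin

text \<open>Regularity of a continuous function that satisfies the equation with both derivatives on
  the test function. Tests living on one edge and flat at its ends show that \<open>y\<close>
  differs from a double primitive of \<open>(q - l \<omega>) y\<close> by an affine function. Affine
  tests then isolate the boundary terms, and the co-normal equivalence returns (II).\<close>

lemma solution_if_weak:
  assumes yc: "\<And>j. j \<in> {1..K} \<Longrightarrow> continuous_on {0..1} (y j)" and yI: "satisfies_I K A y"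
    and weak: "\<And>z z' z''. (\<And>j. j \<in> {1..K} \<Longrightarrow> C1_edge (z j) (z' j) \<and> C1_edge (z' j) (z'' j)) \<Longrightarrow> satisfies_I K A z \<Longrightarrow>
      (\<Sum>j=1..K. (y j 1 * cnj (z' j 1) - y j 0 * cnj (z' j 0)) - (LINT t|unit_edge. y j t * cnj (z'' j t))
        + (LINT t|unit_edge. of_real (q j t - l * \<omega> j) * y j t * cnj (z j t))) + bform y z = 0"
  shows "\<exists>y' y''. solution \<omega> l y y' y''"
proof -
  define g where "g = (\<lambda>j t. of_real (q j t - l * \<omega> j) * y j t)"
  have gi: "integrable unit_edge (g j)" if "j \<in> {1..K}" for j
    unfolding g_def by (rule potential_integrable[OF that yc[OF that]])
  define W where "W = (\<lambda>j. primitive (primitive (g j)))"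
  have C1W: "C1_edge (W j) (primitive (g j))" if "j \<in> {1..K}" for j
    unfolding W_def by (rule C1_edge_primitive[OF continuous_on_primitive[OF gi[OF that]]])
  have affine: "\<exists>a b. \<forall>t\<in>{0..1}. y j t - W j t = a + b * of_real t" if j: "j \<in> {1..K}" for j
  proof (rule du_Bois_Reymond_second)
    show "continuous_on {0..1} (\<lambda>t. y j t - W j t)"
      by (intro continuous_intros yc j C1_edge_continuous[OF C1W])
    fix z z' z'' :: "real \<Rightarrow> complex"
    assume z: "C1_edge z z'" "C1_edge z' z''" "z 0 = 0" "z' 0 = 0" "z 1 = 0" "z' 1 = 0"
    \<comment> \<open>A test function living on edge \<open>j\<close> alone, conjugated because the
      weak equation conjugates its test function.\<close>
    define Z where "Z = (\<lambda>i t. if i = j then cnj (z t) else 0)"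
    define Z' where "Z' = (\<lambda>i t. if i = j then cnj (z' t) else 0)"
    define Z'' where "Z'' = (\<lambda>i t. if i = j then cnj (z'' t) else 0)"
    let ?T = "\<lambda>i. (y i 1 * cnj (Z' i 1) - y i 0 * cnj (Z' i 0)) - (LINT t|unit_edge. y i t * cnj (Z'' i t))
        + (LINT t|unit_edge. g i t * cnj (Z i t))"
    have "(\<Sum>i=1..K. ?T i) + bform y Z = 0"
      unfolding g_def
    proof (rule weak)
      fix i
      show "C1_edge (Z i) (Z' i) \<and> C1_edge (Z' i) (Z'' i)"
        unfolding Z_def Z'_def Z''_def
        by (cases "i = j") (auto intro: C1_edge_cnj z C1_edge_const)
    qed (auto intro!: satisfies_I_zero simp: Z_def z)
    moreover have "bform y Z = 0"
    proof -
      have "Z i 0 = 0" "Z i 1 = 0" for i by (simp_all add: Z_def z)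
      then show ?thesis by (simp add: bform_def bdry_integral_def)
    qed
    moreover have "(\<Sum>i=1..K. ?T i) = ?T j"
    proof -
      have "(\<Sum>i\<in>{1..K} - {j}. ?T i) = 0"
        by (rule sum.neutral) (auto simp: Z_def Z'_def Z''_def)
      then show ?thesis by (subst sum.remove[OF _ j]) auto
    qed
    ultimately have "?T j = 0" by simp
    then have 1: "(LINT t|unit_edge. y j t * z'' t) = (LINT t|unit_edge. g j t * z t)"
      by (simp add: Z_def Z'_def Z''_def z)
    have "(LINT t|unit_edge. primitive (g j) t * z' t) = - (LINT t|unit_edge. W j t * z'' t)"
      using LINT_by_parts[OF C1W[OF j] z(2)] z by simp
    then have 2: "(LINT t|unit_edge. W j t * z'' t) = (LINT t|unit_edge. g j t * z t)"
      using LINT_primitive_mult[OF gi[OF j] z(1)] z by simp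
    have "(LINT t|unit_edge. (y j t - W j t) * z'' t) = (LINT t|unit_edge. y j t * z'' t - W j t * z'' t)"
      by (simp add: left_diff_distrib)
    also have "\<dots> = (LINT t|unit_edge. y j t * z'' t) - (LINT t|unit_edge. W j t * z'' t)"
      by (intro LINT_diff integrable_continuous_edge continuous_intros
          yc j C1_edge_continuous[OF C1W] C1_edge_continuous_deriv[OF z(2)])
    finally show "(LINT t|unit_edge. (y j t - W j t) * z'' t) = 0" using 1 2 by simp
  qed
  then obtain a b where ab: "\<And>j t. j \<in> {1..K} \<Longrightarrow> t \<in> {0..1} \<Longrightarrow> y j t - W j t = a j + b j * of_real t"
    by metis
  define y' where "y' = (\<lambda>j t. primitive (g j) t + b j)"
  have AC1: "AC_deriv (y' j) (g j)" if "j \<in> {1..K}" for j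
    using gi[OF that] by (simp add: AC_deriv_iff_primitive y'_def)
  have C1: "C1_edge (y j) (y' j)" if j: "j \<in> {1..K}" for j
  proof (rule C1_edge_cong)
    show "C1_edge (\<lambda>t. W j t + (a j + b j * of_real t)) (\<lambda>t. primitive (g j) t + (0 + b j * 1))"
      by (intro C1_edge_add C1W[OF j] C1_edge_const C1_edge_cmult C1_edge_of_real)
    fix t :: real assume "t \<in> {0..1}"
    then show "W j t + (a j + b j * of_real t) = y j t" using ab[OF j, of t] by (simp add: algebra_simps)
  qed (simp add: y'_def)
  have H2: "graph_H2 K y y' g"
    unfolding graph_H2_def graph_H1_def graph_L2_def graph_AC_deriv_def
  proof (intro conjI ballI)
    fix j assume j: "j \<in> {1..K}"
    show "AC_deriv (y j) (y' j)" by (rule C1_edge_imp_AC_deriv[OF C1[OF j]])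
    show "AC_deriv (y' j) (g j)" by (rule AC1[OF j])
    show "L2_edge (y' j)" by (rule L2_edge_continuous[OF AC_deriv_continuous[OF AC1[OF j]]])
    show "L2_edge (g j)"
      by (rule L2_edge_potential[where c = "l * \<omega> j", OF gi[OF j] _ yc[OF j] j]) (simp add: g_def)
  qed
  have yF: "y \<in> dom_F K A" by (rule dom_F_of_C1[OF C1_graphI[OF C1] yI])
  have "bdry_integral K (\<lambda>j t. (f j t * y j t + y' j t) * cnj (z j t)) = 0" if z: "z \<in> dom_F K A" for z
  proof -
    \<comment> \<open>The boundary integral sees only the end values of \<open>z\<close>, and an
      element of \<open>dom_F\<close> need not be smooth; its affine interpolant has the same end
      values and second derivative 0.\<close>
    define Z where "Z = (\<lambda>j t. z j 0 + (z j 1 - z j 0) * complex_of_real t)"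
    define Z' where "Z' = (\<lambda>j (t::real). z j 1 - z j 0)"
    have Z: "C1_edge (Z j) (Z' j)" "C1_edge (Z' j) (\<lambda>t. 0)" for j
    proof -
      show "C1_edge (Z j) (Z' j)"
        using C1_edge_add[OF C1_edge_const[of "z j 0"] C1_edge_cmult[OF C1_edge_of_real, of "z j 1 - z j 0"]]
        by (simp add: Z_def Z'_def)
      show "C1_edge (Z' j) (\<lambda>t. 0)" unfolding Z'_def by (rule C1_edge_const)
    qed
    have ZI: "satisfies_I K A Z"
      using z satisfies_I_cong[of K Z z A] by (simp add: Z_def dom_F_def)
    have "(\<Sum>j=1..K. (y j 1 * cnj (Z' j 1) - y j 0 * cnj (Z' j 0)) - (LINT t|unit_edge. y j t * cnj ((\<lambda>_ _. 0) j t))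
        + (LINT t|unit_edge. of_real (q j t - l * \<omega> j) * y j t * cnj (Z j t))) + bform y Z = 0"
      by (rule weak[OF _ ZI]) (use Z in simp)
    moreover have "(y j 1 * cnj (Z' j 1) - y j 0 * cnj (Z' j 0)) - (LINT t|unit_edge. y j t * cnj ((\<lambda>_ _. 0) j t))
        + (LINT t|unit_edge. of_real (q j t - l * \<omega> j) * y j t * cnj (Z j t))
        = y' j 1 * cnj (z j 1) - y' j 0 * cnj (z j 0)" if j: "j \<in> {1..K}" for j
      using LINT_AC_by_parts[OF AC1[OF j] C1_edge_cnj[OF Z(1)[of j]]] LINT_by_parts[OF C1[OF j] C1_edge_cnj[OF Z(2)[of j]]]
      by (simp add: g_def Z_def Z'_def)
    ultimately have "(\<Sum>j=1..K. y' j 1 * cnj (z j 1) - y' j 0 * cnj (z j 0)) + bform y Z = 0" by simp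
    then show ?thesis
      by (simp add: bdry_integral_def bform_def Z_def algebra_simps sum.distrib sum_subtractf)
  qed
  then have "satisfies_II K A y y'" using conormal[OF yF H2] by blast
  then have "solution \<omega> l y y' g"
    using H2 yI by (simp add: solution_def graph_H2_def graph_H1_def g_def)
  then show ?thesis by blast
qed

text \<open>The infimum \<open>l\<close> of \<open>F / Q\<close>, over vectors with
  \<open>Q x x > 0\<close> that are \<open>Q\<close>-orthogonal to \<open>T\<close>, is attained.
  Coercivity bounds the energies of a minimising sequence and makes \<open>l\<close> positive. As
  the members of \<open>T\<close> are weak eigenvectors themselves, the Euler equation found on the
  orthogonal complement extends to \<open>V\<close>.\<close>

lemma direct_method:
  fixes \<omega> :: "nat \<Rightarrow> real" and \<mu> :: "graph_fun \<Rightarrow> real"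
  defines "Q \<equiv> weighted_inner K \<omega>"
  assumes c: "0 < c" "\<And>y. y \<in> V \<Longrightarrow> c * (energy0 K y + energy1 K y) \<le> Re (F y y)"
    and T: "hermitian_form.orthonormal V Q T"
    and Tw: "\<And>e z. e \<in> T \<Longrightarrow> z \<in> V \<Longrightarrow> F e z = of_real (\<mu> e) * Q e z"
    and w: "w \<in> V" "\<And>e. e \<in> T \<Longrightarrow> Q w e = 0" "0 < Re (Q w w)"
  obtains l y y' y'' where "0 < l" "solution \<omega> l y y' y''" "Q y y = 1" "\<And>e. e \<in> T \<Longrightarrow> Q y e = 0"
    "\<And>j t. \<not> (j \<in> {1..K} \<and> t \<in> {0..1}) \<Longrightarrow> y j t = 0"
    "\<And>x. x \<in> V \<Longrightarrow> (\<And>e. e \<in> T \<Longrightarrow> Q x e = 0) \<Longrightarrow> l * Re (Q x x) \<le> Re (F x x)"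
proof -
  interpret vs: vector_space graph_scale by (rule vector_space_graph_scale)
  interpret F: hermitian_form graph_scale V F by (rule F_hermitian)
  interpret Q: hermitian_form graph_scale V Q unfolding Q_def by (rule weighted_inner_hermitian)
  have TV: "T \<subseteq> V" and finT: "finite T" using T by (auto simp: Q.orthonormal_def)
  define Y where "Y = {x \<in> V. \<forall>e\<in>T. Q x e = 0}"
  have YV: "Y \<subseteq> V" by (auto simp: Y_def)
  have Y: "vs.subspace Y"
  proof (rule vs.subspaceI)
    show "0 \<in> Y" using vs.subspace_0[OF Q.subspace_V] TV by (auto simp: Y_def Q.zero_left)
  next
    fix x y assume "x \<in> Y" "y \<in> Y"
    then show "x + y \<in> Y" using vs.subspace_add[OF Q.subspace_V, of x y] TV
      by (auto simp: Y_def subset_iff Q.add_left)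
  next
    fix k x assume "x \<in> Y"
    then show "graph_scale k x \<in> Y" using vs.subspace_scale[OF Q.subspace_V, of x k] TV
      by (auto simp: Y_def subset_iff Q.scale_left)
  qed
  have Fnn: "0 \<le> Re (F x x)" if "x \<in> V" for x
    using c(2)[OF that] c(1) energy0_nonneg[of K x] energy1_nonneg[of K x]
    by (meson add_nonneg_nonneg less_imp_le mult_nonneg_nonneg order_trans)
  define S where "S = {Re (F x x) | x. x \<in> Y \<and> Q x x = 1}"
  let ?s = "\<lambda>k. graph_scale (complex_of_real k)"
  have normalise: "\<exists>k>0. k\<^sup>2 * Re (Q x x) = 1 \<and> ?s k x \<in> Y \<and>
      Q (?s k x) (?s k x) = 1 \<and>
      F (?s k x) (?s k x) = of_real (k\<^sup>2) * F x x"
    if x: "x \<in> Y" "0 < Re (Q x x)" for x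
  proof -
    define k where "k = 1 / sqrt (Re (Q x x))"
    have k: "0 < k" "k\<^sup>2 * Re (Q x x) = 1" using x(2) by (auto simp: k_def power_divide)
    have xV: "x \<in> V" using x YV by auto
    have sV: "graph_scale k x \<in> V" using vs.subspace_scale[OF Q.subspace_V xV] .
    have "Q (graph_scale k x) (graph_scale k x) = of_real (k\<^sup>2) * Q x x"
      using xV sV by (simp add: Q.scale_left Q.scale_right power2_eq_square)
    also have "\<dots> = of_real (k\<^sup>2 * Re (Q x x))" by (subst Q.diag_real[OF xV]) simp
    finally have "Q (graph_scale k x) (graph_scale k x) = 1" using k by simp
    moreover have "F (graph_scale k x) (graph_scale k x) = of_real (k\<^sup>2) * F x x"
      using xV sV by (simp add: F.scale_left F.scale_right power2_eq_square)
    ultimately show ?thesis using k vs.subspace_scale[OF Y x(1), of k] by blast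
  qed
  have wY: "w \<in> Y" using w by (auto simp: Y_def)
  have Sne: "S \<noteq> {}" using normalise[OF wY w(3)] by (auto simp: S_def)
  have Sbdd: "bdd_below S" by (rule bdd_belowI[of _ 0]) (use Fnn YV in \<open>auto simp: S_def\<close>)
  define l where "l = Inf S"
  have l0: "0 \<le> l" unfolding l_def by (rule cInf_greatest[OF Sne]) (use Fnn YV in \<open>auto simp: S_def\<close>)
  have lmin: "l * Re (Q x x) \<le> Re (F x x)" if x: "x \<in> Y" for x
  proof (cases "0 < Re (Q x x)")
    case True
    obtain k where k: "0 < k" "k\<^sup>2 * Re (Q x x) = 1" "?s k x \<in> Y"
      "Q (?s k x) (?s k x) = 1"
      "F (?s k x) (?s k x) = of_real (k\<^sup>2) * F x x"
      using normalise[OF x True] by blast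
    have "Re (F (?s k x) (?s k x)) \<in> S"
      unfolding S_def using k(3,4) by blast
    then have "l \<le> k\<^sup>2 * Re (F x x)"
      unfolding l_def using cInf_lower[OF _ Sbdd] k(5) by fastforce
    then have "l * Re (Q x x) \<le> k\<^sup>2 * Re (F x x) * Re (Q x x)" using True by (intro mult_right_mono) auto
    also have "\<dots> = (k\<^sup>2 * Re (Q x x)) * Re (F x x)" by (simp add: mult_ac)
    finally show ?thesis using k(2) by simp
  next
    \<comment> \<open>Where \<open>Q x x\<close> is not positive the inequality holds by signs
      alone: \<open>l\<close> and \<open>F x x\<close> are nonnegative.\<close>
    case False
    then have "l * Re (Q x x) \<le> 0" using l0 by (intro mult_nonneg_nonpos) auto
    then show ?thesis using Fnn x YV by force
  qed
  have "\<exists>x. x \<in> Y \<and> Q x x = 1 \<and> Re (F x x) < l + 1 / real (Suc n)" for n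
  proof -
    have "Inf S < l + 1 / real (Suc n)" by (simp add: l_def)
    then show ?thesis using cInf_lessD[OF Sne] by (fastforce simp: S_def)
  qed
  then obtain s where s: "\<And>n. s n \<in> Y" "\<And>n. Q (s n) (s n) = 1" "\<And>n. Re (F (s n) (s n)) < l + 1 / real (Suc n)"
    by metis
  have sV: "s n \<in> V" for n using s(1) YV by auto
  have en: "energy0 K (s n) \<le> (l + 1) / c \<and> energy1 K (s n) \<le> (l + 1) / c" for n
  proof -
    have "c * (energy0 K (s n) + energy1 K (s n)) \<le> l + 1 / real (Suc n)"
      using c(2)[OF sV[of n]] s(3)[of n] by linarith
    also have "\<dots> \<le> l + 1" by simp
    finally have "energy0 K (s n) + energy1 K (s n) \<le> (l + 1) / c"
      using c(1) by (simp add: field_simps)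
    then show ?thesis using energy0_nonneg[of K "s n"] energy1_nonneg[of K "s n"] by linarith
  qed
  obtain k u B where k: "strict_mono (k :: nat \<Rightarrow> nat)" and uc: "\<And>j. j \<in> {1..K} \<Longrightarrow> continuous_on {0..1} (u j)"
    and lim: "\<And>j t. j \<in> {1..K} \<Longrightarrow> t \<in> {0..1} \<Longrightarrow> (\<lambda>n. s (k n) j t) \<longlonglongrightarrow> u j t"
    and B: "\<And>n j t. j \<in> {1..K} \<Longrightarrow> t \<in> {0..1} \<Longrightarrow> cmod (s n j t) \<le> B"
    and u0: "\<And>j t. \<not> (j \<in> {1..K} \<and> t \<in> {0..1}) \<Longrightarrow> u j t = 0"
    using graph_compactness[of K s "(l + 1) / c"] V_C1[OF sV] en by blast
  have sc: "continuous_on {0..1} (s n j)" if "j \<in> {1..K}" for n j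
    by (rule C1_graph_cont[OF V_C1[OF sV] that])
  have conv: "(\<lambda>n. LINT t|unit_edge. h t * s (k n) j t) \<longlonglongrightarrow> (LINT t|unit_edge. h t * u j t)"
    if "integrable unit_edge h" "j \<in> {1..K}" for h j
    by (rule LINT_tendsto[OF that(1) sc[OF that(2)] uc[OF that(2)] lim[OF that(2)] B[OF that(2)]])
  have lim0: "(\<lambda>n. s (k n) j 0) \<longlonglongrightarrow> u j 0" and lim1: "(\<lambda>n. s (k n) j 1) \<longlonglongrightarrow> u j 1" if "j \<in> {1..K}" for j
    using lim[OF that] by auto
  \<comment> \<open>Nonnegative on \<open>Y\<close> by the choice of \<open>l\<close>, and tending
    to 0 on the diagonal along the minimising sequence; Cauchy-Schwarz then sends
    \<open>H (s n) z\<close> to 0 for each \<open>z\<close> in \<open>Y\<close>.\<close>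
  define H where "H = (\<lambda>x y. F x y - complex_of_real l * Q x y)"
  interpret H: hermitian_form graph_scale V H
    unfolding H_def by (rule hermitian_form_diff[OF F_hermitian Q.hermitian_form_axioms])
  have Hnn: "0 \<le> Re (H x x)" if "x \<in> Y" for x
    using lmin[OF that] by (simp add: H_def)
  have Hs: "(\<lambda>n. Re (H (s n) (s n))) \<longlonglongrightarrow> 0"
  proof (rule tendsto_sandwich[OF _ _ tendsto_const LIMSEQ_inverse_real_of_nat])
    show "\<forall>\<^sub>F n in sequentially. 0 \<le> Re (H (s n) (s n))" using Hnn s(1) by simp
    show "\<forall>\<^sub>F n in sequentially. Re (H (s n) (s n)) \<le> inverse (real (Suc n))"
      using s(2,3) by (simp add: H_def inverse_eq_divide algebra_simps less_imp_le)
  qed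
  have HY: "(\<lambda>n. H (s n) z) \<longlonglongrightarrow> 0" if z: "z \<in> Y" for z
  proof -
    have "(\<lambda>n. Re (H (s n) (s n)) * Re (H z z)) \<longlonglongrightarrow> 0 * Re (H z z)"
      by (intro tendsto_intros Hs)
    then have "(\<lambda>n. sqrt (Re (H (s n) (s n)) * Re (H z z))) \<longlonglongrightarrow> sqrt 0"
      by (intro tendsto_real_sqrt) simp
    then have lim: "(\<lambda>n. sqrt (Re (H (s n) (s n)) * Re (H z z))) \<longlonglongrightarrow> 0" by simp
    have "cmod (H (s n) z) \<le> sqrt (Re (H (s n) (s n)) * Re (H z z))" for n
      by (rule real_le_rsqrt[OF H.Cauchy_Schwarz[OF Y YV Hnn s(1) z]])
    then show ?thesis by (intro Lim_null_comparison[OF _ lim] always_eventually allI)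
  qed
  \<comment> \<open>Write \<open>z\<close> as its projection onto the span of \<open>T\<close> plus
    an element of \<open>Y\<close>. The projection contributes nothing: for \<open>e\<close> in
    \<open>T\<close> the weak equation makes \<open>F e (s n)\<close> a multiple of
    \<open>Q e (s n)\<close>, which is 0.\<close>
  have HV: "(\<lambda>n. H (s n) z) \<longlonglongrightarrow> 0" if z: "z \<in> V" for z
  proof -
    let ?p = "\<Sum>e\<in>T. graph_scale (Q z e) e"
    have p: "?p \<in> V" by (rule Q.comb_in[OF finT TV])
    have zp: "z - ?p \<in> V" by (rule vs.subspace_diff[OF Q.subspace_V z p])
    then have zpY: "z - ?p \<in> Y" using Q.orthonormal_residual[OF T z] by (auto simp: Y_def)
    have "H (s n) ?p = 0" for n
    proof -
      have "H e (s n) = 0" if e: "e \<in> T" for e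
      proof -
        have "Q e (s n) = 0" using s(1)[of n] e Q.herm[of "s n" e] TV by (auto simp: Y_def)
        then show ?thesis using Tw[OF e sV[of n]] by (simp add: H_def)
      qed
      then have "H ?p (s n) = 0" using H.comb_left[OF finT TV sV[of n], of "Q z"] by simp
      then show ?thesis using H.herm[OF p sV[of n]] by simp
    qed
    then have "H (s n) z = H (s n) (z - ?p)" for n
      using H.add_right[OF zp p sV[of n]] by simp
    then show ?thesis using HY[OF zpY] by simp
  qed
  have uI: "satisfies_I K A u"
    unfolding satisfies_I_def
  proof
    fix i assume i: "i \<in> {1..num_I A}"
    have "(\<lambda>n. \<Sum>j=1..K. bc_alpha A i j * s (k n) j 0 + bc_gamma A i j * s (k n) j 1)
        \<longlonglongrightarrow> (\<Sum>j=1..K. bc_alpha A i j * u j 0 + bc_gamma A i j * u j 1)"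
      by (intro tendsto_intros lim0 lim1)
    moreover have "(\<Sum>j=1..K. bc_alpha A i j * s (k n) j 0 + bc_gamma A i j * s (k n) j 1) = 0" for n
      using V_I[OF sV] i by (auto simp: satisfies_I_def)
    ultimately show "(\<Sum>j=1..K. bc_alpha A i j * u j 0 + bc_gamma A i j * u j 1) = 0"
      by (simp add: LIMSEQ_const_iff)
  qed
  have blim: "(\<lambda>n. bform (s (k n)) z) \<longlonglongrightarrow> bform u z" for z
    unfolding bform_def bdry_integral_def by (intro tendsto_intros lim0 lim1)
  have "\<exists>u' u''. solution \<omega> l u u' u''"
  proof (rule solution_if_weak[OF uc uI])
    fix z z' z'' :: graph_fun
    assume z: "\<And>j. j \<in> {1..K} \<Longrightarrow> C1_edge (z j) (z' j) \<and> C1_edge (z' j) (z'' j)" and zI: "satisfies_I K A z"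
    have zV: "z \<in> V" using z zI by (auto simp: V_def intro!: C1_graphI[of K z z'])
    let ?g = "\<lambda>j t. of_real (q j t - l * \<omega> j) * cnj (z j t)"
    \<comment> \<open>The form \<open>H x z\<close> after integration by parts. Here
      \<open>x\<close> enters without derivatives, so the expression passes to the limit under
      bounded pointwise convergence.\<close>
    let ?E = "\<lambda>x. (\<Sum>j=1..K. (x j 1 * cnj (z' j 1) - x j 0 * cnj (z' j 0)) - (LINT t|unit_edge. cnj (z'' j t) * x j t)
        + (LINT t|unit_edge. ?g j t * x j t)) + bform x z"
    have zc: "continuous_on {0..1} (z j)" "continuous_on {0..1} (z' j)" "continuous_on {0..1} (z'' j)" if "j \<in> {1..K}" for j
      using z[OF that] by (auto dest: C1_edge_continuous C1_edge_continuous_deriv)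
    have gi: "integrable unit_edge (?g j)" if "j \<in> {1..K}" for j
      by (rule potential_integrable[OF that]) (intro continuous_intros zc that)
    have z''i: "integrable unit_edge (\<lambda>t. cnj (z'' j t))" if "j \<in> {1..K}" for j
      by (intro integrable_continuous_edge continuous_intros zc that)
    have EH: "H x z = ?E x" if x: "x \<in> V" for x
    proof -
      have "(LINT t|unit_edge. grad x j t * cnj (grad z j t)) + (LINT t|unit_edge. of_real (q j t) * (x j t * cnj (z j t)))
          - of_real l * (of_real (\<omega> j) * (LINT t|unit_edge. x j t * cnj (z j t)))
        = (x j 1 * cnj (z' j 1) - x j 0 * cnj (z' j 0)) - (LINT t|unit_edge. cnj (z'' j t) * x j t)
          + (LINT t|unit_edge. ?g j t * x j t)" if j: "j \<in> {1..K}" for j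
      proof -
        note xc = C1_graph_edge[OF V_C1[OF x] j]
        have "(LINT t|unit_edge. grad x j t * cnj (grad z j t)) = (LINT t|unit_edge. grad x j t * cnj (z' j t))"
          by (rule LINT_cong) (use z[OF j] grad_eq[of z j "z' j"] in auto)
        also have "\<dots> = (x j 1 * cnj (z' j 1) - x j 0 * cnj (z' j 0)) - (LINT t|unit_edge. cnj (z'' j t) * x j t)"
          using LINT_by_parts[OF xc C1_edge_cnj, of "z' j" "z'' j"] z[OF j] by (simp add: mult.commute)
        finally have 1: "(LINT t|unit_edge. grad x j t * cnj (grad z j t)) = \<dots>" .
        have "(LINT t|unit_edge. ?g j t * x j t) = (LINT t|unit_edge. of_real (q j t) * (x j t * cnj (z j t)) - of_real (l * \<omega> j) * (x j t * cnj (z j t)))"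
          by (simp add: algebra_simps)
        also have "\<dots> = (LINT t|unit_edge. of_real (q j t) * (x j t * cnj (z j t))) - (LINT t|unit_edge. of_real (l * \<omega> j) * (x j t * cnj (z j t)))"
          by (intro LINT_diff q_mult_integrable j integrable_continuous_edge
            continuous_intros zc C1_edge_continuous[OF xc])
        also have "(LINT t|unit_edge. of_real (l * \<omega> j) * (x j t * cnj (z j t))) = of_real l * (of_real (\<omega> j) * (LINT t|unit_edge. x j t * cnj (z j t)))"
          by (simp add: mult.assoc)
        finally show ?thesis unfolding 1 by simp
      qed
      then have "(\<Sum>j=1..K. (LINT t|unit_edge. grad x j t * cnj (grad z j t)) + (LINT t|unit_edge. of_real (q j t) * (x j t * cnj (z j t)))
          - of_real l * (of_real (\<omega> j) * (LINT t|unit_edge. x j t * cnj (z j t)))) + bform x z = ?E x"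
        by simp
      then show ?thesis
        unfolding H_def F_def Q_def weighted_inner_def by (simp add: sum_subtractf sum_distrib_left algebra_simps)
    qed
    have "(\<lambda>n. ?E (s (k n))) \<longlonglongrightarrow> ?E u"
      by (intro tendsto_intros lim0 lim1 conv gi z''i blim)
    moreover have "(\<lambda>n. ?E (s (k n))) \<longlonglongrightarrow> 0"
      unfolding EH[OF sV, symmetric] using LIMSEQ_subseq_LIMSEQ[OF HV[OF zV] k] by (simp add: o_def)
    ultimately have "?E u = 0" by (rule LIMSEQ_unique)
    then show "(\<Sum>j=1..K. (u j 1 * cnj (z' j 1) - u j 0 * cnj (z' j 0)) - (LINT t|unit_edge. u j t * cnj (z'' j t))
        + (LINT t|unit_edge. of_real (q j t - l * \<omega> j) * u j t * cnj (z j t))) + bform u z = 0"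
      by (simp add: mult_ac)
  qed
  then obtain u' u'' where sol: "solution \<omega> l u u' u''" by blast
  have uV: "u \<in> V" by (rule solution_H2(2)[OF sol])
  have Que: "Q u e = 0" if e: "e \<in> T" for e
  proof -
    have eV: "e \<in> V" using e TV by auto
    have ei: "integrable unit_edge (\<lambda>t. cnj (e j t))" if "j \<in> {1..K}" for j
      by (intro integrable_continuous_edge continuous_intros C1_graph_cont[OF V_C1[OF eV] that])
    have "(\<lambda>n. Q (s (k n)) e) \<longlonglongrightarrow> Q u e"
      unfolding Q_def weighted_inner_def
      by (subst (1 2) mult.commute[of _ "cnj _"]) (intro tendsto_intros conv ei)
    moreover have "Q (s (k n)) e = 0" for n using s(1) e by (auto simp: Y_def)
    ultimately show ?thesis by (simp add: LIMSEQ_const_iff)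
  qed
  \<comment> \<open>The constraint survives the limit although it is quadratic, because the sequence
    is uniformly bounded and converges at every point of the graph.\<close>
  have Quu: "Q u u = 1"
  proof -
    have "(\<lambda>n. LINT t|unit_edge. s (k n) j t * cnj (s (k n) j t)) \<longlonglongrightarrow> (LINT t|unit_edge. u j t * cnj (u j t))"
      if j: "j \<in> {1..K}" for j
    proof -
      have 1: "(\<lambda>n. LINT t|unit_edge. 1 * (s (k n) j t * cnj (s (k n) j t))) \<longlonglongrightarrow> (LINT t|unit_edge. 1 * (u j t * cnj (u j t)))"
      proof (rule LINT_tendsto)
        show "integrable unit_edge (\<lambda>t. 1::complex)" by (intro integrable_continuous_edge continuous_intros)
        show "cmod (s (k n) j t * cnj (s (k n) j t)) \<le> B * B" if "t \<in> {0..1}" for n t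
          using B[OF j that, of "k n"] by (auto simp: norm_mult intro!: mult_mono intro: order_trans[OF norm_ge_zero])
      qed (intro continuous_intros sc uc tendsto_intros lim j | assumption)+
      then show ?thesis by simp
    qed
    then have "(\<lambda>n. Q (s (k n)) (s (k n))) \<longlonglongrightarrow> Q u u"
      unfolding Q_def weighted_inner_def by (intro tendsto_intros)
    then show ?thesis using s(2) by (simp add: LIMSEQ_const_iff)
  qed
  \<comment> \<open>Coercivity at the minimiser gives \<open>c * energy0 K u \<le> l\<close>, and
    \<open>Q u u = 1\<close> excludes \<open>energy0 K u = 0\<close>; this sharpens
    \<open>0 \<le> l\<close> to \<open>0 < l\<close>.\<close>
  have "F u u = of_real l" using solution_weak[OF sol uV] Quu by (simp add: Q_def)
  then have "c * energy0 K u \<le> l"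
    using c(2)[OF uV] mult_nonneg_nonneg[OF less_imp_le[OF c(1)] energy1_nonneg[of K u]]
    by (simp add: distrib_left)
  moreover have "0 < energy0 K u"
  proof (rule ccontr)
    assume "\<not> 0 < energy0 K u"
    then have "(\<Sum>j=1..K. LINT t|unit_edge. (cmod (u j t))\<^sup>2) = 0" using energy0_nonneg[of K u] by (simp add: energy0_def)
    then have "(LINT t|unit_edge. (cmod (u j t))\<^sup>2) = 0" if "j \<in> {1..K}" for j
      using that by (subst (asm) sum_nonneg_eq_0_iff) auto
    then have "Q u u = 0" by (simp add: Q_def weighted_inner_diag)
    then show False using Quu by simp
  qed
  ultimately have "0 < l" using c(1) by (meson less_le_trans mult_pos_pos)
  show ?thesis
    by (rule that[OF \<open>0 < l\<close> sol Quu Que u0 lmin]) (auto simp: Y_def)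
qed

end

section \<open>Test functions and eigenvalue bounds\<close>

text \<open>Parseval for a finite orthogonal family with squared norms 1/2, stated abstractly to
  cover the sines and the cosines at once.\<close>

lemma LINT_orthogonal_sum:
  fixes a :: "'k \<Rightarrow> complex" and \<phi> :: "'k \<Rightarrow> real \<Rightarrow> real"
  assumes fin: "finite I" and cont: "\<And>k. continuous_on {0..1} (\<phi> k)"
    and orth: "\<And>k l. k \<in> I \<Longrightarrow> l \<in> I \<Longrightarrow> (LINT t|unit_edge. \<phi> k t * \<phi> l t) = (if k = l then 1 / 2 else 0)"
  shows "(LINT t|unit_edge. (cmod (\<Sum>k\<in>I. a k * of_real (\<phi> k t)))\<^sup>2) = (\<Sum>k\<in>I. (cmod (a k))\<^sup>2) / 2"
proof -
  let ?S = "\<lambda>t. \<Sum>k\<in>I. a k * of_real (\<phi> k t)"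
  have int: "integrable unit_edge (\<lambda>t. (a k * cnj (a l)) * of_real (\<phi> k t * \<phi> l t))" for k l
    by (intro integrable_continuous_edge continuous_intros cont)
  have "complex_of_real (LINT t|unit_edge. (cmod (?S t))\<^sup>2) = (LINT t|unit_edge. ?S t * cnj (?S t))"
    by (rule LINT_of_real_norm_square[symmetric])
  also have "\<dots> = (LINT t|unit_edge. (\<Sum>k\<in>I. \<Sum>l\<in>I. (a k * cnj (a l)) * of_real (\<phi> k t * \<phi> l t)))"
    unfolding cnj_sum sum_product by (simp add: mult_ac)
  also have "\<dots> = (\<Sum>k\<in>I. \<Sum>l\<in>I. (LINT t|unit_edge. (a k * cnj (a l)) * of_real (\<phi> k t * \<phi> l t)))"
    by (simp only: Bochner_Integration.integral_sum Bochner_Integration.integrable_sum int)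
  also have "\<dots> = (\<Sum>k\<in>I. \<Sum>l\<in>I. (if k = l then a k * cnj (a l) / 2 else 0))"
  proof (intro sum.cong refl)
    fix k l assume "k \<in> I" "l \<in> I"
    then show "(LINT t|unit_edge. (a k * cnj (a l)) * of_real (\<phi> k t * \<phi> l t)) = (if k = l then a k * cnj (a l) / 2 else 0)"
      unfolding integral_mult_right_zero integral_complex_of_real by (simp add: orth)
  qed
  also have "\<dots> = (\<Sum>k\<in>I. a k * cnj (a k) / 2)" using fin by simp
  also have "\<dots> = of_real ((\<Sum>k\<in>I. (cmod (a k))\<^sup>2) / 2)"
    unfolding complex_norm_square[symmetric] by (simp add: sum_divide_distrib)
  finally show ?thesis by (simp only: of_real_eq_iff)
qed

lemma C1_edge_sum:
  assumes "finite I" "\<And>k. k \<in> I \<Longrightarrow> C1_edge (f k) (f' k)"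
  shows "C1_edge (\<lambda>t. \<Sum>k\<in>I. f k t) (\<lambda>t. \<Sum>k\<in>I. f' k t)"
  using assms by (induction I rule: finite_induct) (simp_all add: C1_edge_const C1_edge_add)

lemma C1_edge_sine: "C1_edge (\<lambda>t. complex_of_real (sin (real k * pi * t))) (\<lambda>t. of_real (real k * pi) * of_real (cos (real k * pi * t)))"
  unfolding C1_edge_def
proof (intro conjI ballI)
  fix t :: real
  have "((\<lambda>t. sin (real k * pi * t)) has_real_derivative (real k * pi) * cos (real k * pi * t)) (at t within {0..1})"
    by (auto intro!: derivative_eq_intros)
  then show "((\<lambda>t. complex_of_real (sin (real k * pi * t))) has_vector_derivative
      of_real (real k * pi) * of_real (cos (real k * pi * t))) (at t within {0..1})"
    unfolding of_real_mult[symmetric] by (rule has_vector_derivative_of_real)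
qed (intro continuous_intros)

lemma graph_sum_apply: "(\<Sum>e\<in>T. graph_scale (c e) e) j t = (\<Sum>e\<in>T. c e * e j t)"
  by (induction T rule: infinite_finite_induct) (simp_all add: graph_scale_def)

lemma weighted_inner_one: "weighted_inner K (\<lambda>_. 1) y y = of_real (energy0 K y)"
  by (simp add: weighted_inner_diag energy0_def)

lemma weighted_inner_le_energy0: "Re (weighted_inner K (weight p) y y) \<le> energy0 K y"
  unfolding weighted_inner_diag energy0_def Re_complex_of_real
  by (intro sum_mono) (auto simp: weight_def intro: order_trans[of _ 0])

context graph_form
begin

text \<open>Sines vanish at the edge ends, so the combinations satisfy (I) and annihilate the
  boundary form, while \<open>V\<close> leaves their end derivatives free. Being zero on the
  negative edges, they have \<open>Q\<close> equal to the squared norm.\<close>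

lemma sine_test_function:
  fixes c :: "nat \<times> nat \<Rightarrow> complex" and p m :: nat
  defines "w \<equiv> \<lambda>j t. if j \<in> {1..p} then \<Sum>k=1..m. c (j, k) * of_real (sin (real k * pi * t)) else 0"
  assumes pK: "p \<le> K" and C: "\<And>j. j \<in> {1..K} \<Longrightarrow> AE t in unit_edge. \<bar>q j t\<bar> \<le> C"
  defines "s \<equiv> \<Sum>i\<in>{1..p} \<times> {1..m}. (cmod (c i))\<^sup>2"
  shows "w \<in> V" "Re (weighted_inner K (weight p) w w) = s / 2"
    "Re (F w w) \<le> ((real m * pi)\<^sup>2 + C) * (s / 2)"
proof -
  define w' where "w' = (\<lambda>j t. if j \<in> {1..p} then \<Sum>k=1..m. (c (j, k) * of_real (real k * pi)) * complex_of_real (cos (real k * pi * t)) else 0)"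
  have off: "w j = (\<lambda>t. 0)" "w' j = (\<lambda>t. 0)" if "j \<notin> {1..p}" for j
    using that unfolding w_def w'_def by (simp_all only: if_False)
  have C1: "C1_edge (w j) (w' j)" for j
  proof (cases "j \<in> {1..p}")
    case True
    have "C1_edge (\<lambda>t. \<Sum>k=1..m. c (j, k) * complex_of_real (sin (real k * pi * t)))
        (\<lambda>t. \<Sum>k=1..m. c (j, k) * (of_real (real k * pi) * of_real (cos (real k * pi * t))))"
      by (intro C1_edge_sum C1_edge_cmult C1_edge_sine) simp
    then show ?thesis using True by (simp add: w_def w'_def mult.assoc)
  next
    case False
    then show ?thesis using C1_edge_const[of 0] by (simp add: off)
  qed
  have w0: "w j 0 = 0" "w j 1 = 0" for j
    by (simp_all add: w_def)
  show wV: "w \<in> V"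
    using C1_graphI[of K w w', OF C1] satisfies_I_zero[of K w A] w0 by (simp add: V_def)
  let ?s = "\<lambda>j. \<Sum>k=1..m. (cmod (c (j, k)))\<^sup>2"
  have e0: "(LINT t|unit_edge. (cmod (w j t))\<^sup>2) = (if j \<in> {1..p} then ?s j / 2 else 0)" for j
  proof (cases "j \<in> {1..p}")
    case True
    have "(LINT t|unit_edge. (cmod (\<Sum>k=1..m. c (j, k) * of_real (sin (real k * pi * t))))\<^sup>2) = ?s j / 2"
      by (rule LINT_orthogonal_sum[where \<phi> = "\<lambda>k t. sin (real k * pi * t)"])
        (simp, intro continuous_intros, rule LINT_sin_sin(1), auto)
    then show ?thesis using True by (simp add: w_def)
  qed (auto simp: off)
  have e1: "(LINT t|unit_edge. (cmod (grad w j t))\<^sup>2) \<le> (real m * pi)\<^sup>2 * (LINT t|unit_edge. (cmod (w j t))\<^sup>2)" for j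
  proof -
    have "(LINT t|unit_edge. (cmod (grad w j t))\<^sup>2) = (LINT t|unit_edge. (cmod (w' j t))\<^sup>2)"
      by (rule LINT_cong) (auto simp: grad_eq[of w j "w' j", OF C1])
    also have "\<dots> \<le> (real m * pi)\<^sup>2 * (LINT t|unit_edge. (cmod (w j t))\<^sup>2)"
    proof (cases "j \<in> {1..p}")
      case True
      have "(LINT t|unit_edge. (cmod (\<Sum>k=1..m. (c (j, k) * of_real (real k * pi)) * complex_of_real (cos (real k * pi * t))))\<^sup>2)
          = (\<Sum>k=1..m. (cmod (c (j, k) * of_real (real k * pi)))\<^sup>2) / 2"
        by (rule LINT_orthogonal_sum[where \<phi> = "\<lambda>k t. cos (real k * pi * t)"])
          (simp, intro continuous_intros, rule LINT_sin_sin(2), auto)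
      also have "\<dots> \<le> ((real m * pi)\<^sup>2 * ?s j) / 2"
        unfolding sum_distrib_left
      proof (intro divide_right_mono sum_mono)
        fix k assume k: "k \<in> {1..m}"
        have "(cmod (c (j, k) * of_real (real k * pi)))\<^sup>2 = (real k * pi)\<^sup>2 * (cmod (c (j, k)))\<^sup>2"
          unfolding norm_mult norm_of_real power_mult_distrib power2_abs by (simp add: mult_ac)
        also have "\<dots> \<le> (real m * pi)\<^sup>2 * (cmod (c (j, k)))\<^sup>2"
          using k by (intro mult_right_mono power_mono) auto
        finally show "(cmod (c (j, k) * of_real (real k * pi)))\<^sup>2 \<le> (real m * pi)\<^sup>2 * (cmod (c (j, k)))\<^sup>2" .
      qed simp
      finally show ?thesis unfolding e0 using True by (simp add: w'_def)
    qed (simp add: off)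
    finally show ?thesis .
  qed
  have Q: "(\<Sum>j=1..K. LINT t|unit_edge. (cmod (w j t))\<^sup>2) = s / 2"
  proof -
    have "(\<Sum>j=1..K. LINT t|unit_edge. (cmod (w j t))\<^sup>2) = (\<Sum>j=1..p. ?s j / 2)"
      unfolding e0 by (rule sum.mono_neutral_cong_right) (use pK in auto)
    also have "\<dots> = s / 2" unfolding s_def sum_divide_distrib[symmetric] by (simp add: sum.cartesian_product)
    finally show ?thesis .
  qed
  have "weight p j * (LINT t|unit_edge. (cmod (w j t))\<^sup>2) = (LINT t|unit_edge. (cmod (w j t))\<^sup>2)" if "j \<in> {1..K}" for j
    using e0[of j] that by (auto simp: weight_def)
  then have "(\<Sum>j=1..K. weight p j * (LINT t|unit_edge. (cmod (w j t))\<^sup>2)) = s / 2"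
    unfolding Q[symmetric] by (rule sum.cong[OF refl])
  then show "Re (weighted_inner K (weight p) w w) = s / 2"
    by (simp add: weighted_inner_diag)
  have "bform w w = 0" by (simp add: bform_def bdry_integral_def w0)
  then have "Re (F w w) = (\<Sum>j=1..K. (LINT t|unit_edge. (cmod (grad w j t))\<^sup>2) + (LINT t|unit_edge. q j t * (cmod (w j t))\<^sup>2))"
    using Re_F_diag[OF wV] by (simp add: energy1_def sum.distrib)
  also have "\<dots> \<le> (\<Sum>j=1..K. ((real m * pi)\<^sup>2 + C) * (LINT t|unit_edge. (cmod (w j t))\<^sup>2))"
  proof (rule sum_mono)
    fix j assume j: "j \<in> {1..K}"
    show "(LINT t|unit_edge. (cmod (grad w j t))\<^sup>2) + (LINT t|unit_edge. q j t * (cmod (w j t))\<^sup>2)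
        \<le> ((real m * pi)\<^sup>2 + C) * (LINT t|unit_edge. (cmod (w j t))\<^sup>2)"
      using q_term_bound[OF C[OF j] j C1_edge_continuous[OF C1[of j]]] e1[of j] by (simp add: distrib_right abs_le_iff)
  qed
  also have "\<dots> = ((real m * pi)\<^sup>2 + C) * (s / 2)" unfolding sum_distrib_left[symmetric] Q ..
  finally show "Re (F w w) \<le> ((real m * pi)\<^sup>2 + C) * (s / 2)" .
qed

text \<open>There are \<open>p m\<close> coefficients and one linear condition for each element of
  \<open>T\<close>, so some nonzero combination of sines is orthogonal to \<open>T\<close>. The
  strict gap between \<open>(m pi)^2 + C\<close> and \<open>r\<close> makes the last inequality
  strict.\<close>

lemma lower_test:
  assumes pK: "p \<le> K" and C: "\<And>j. j \<in> {1..K} \<Longrightarrow> AE t in unit_edge. \<bar>q j t\<bar> \<le> C"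
    and T: "finite T" "T \<subseteq> V" "card T < p * m" and r: "(real m * pi)\<^sup>2 + C < r"
  shows "\<exists>w\<in>V. (\<forall>e\<in>T. weighted_inner K (weight p) w e = 0) \<and> 0 < Re (weighted_inner K (weight p) w w) \<and>
    Re (F w w) < r * Re (weighted_inner K (weight p) w w)"
proof -
  let ?I = "{1..p} \<times> {1..m}"
  \<comment> \<open>The pairing of the sine of frequency \<open>snd i\<close> on edge
    \<open>fst i\<close> with \<open>e\<close>; on these edges the weight is 1.\<close>
  define a where "a = (\<lambda>(e::graph_fun) (i::nat \<times> nat). LINT t|unit_edge. of_real (sin (real (snd i) * pi * t)) * cnj (e (fst i) t))"
  have "card T < card ?I" using T(3) by simp
  then obtain c where c: "\<exists>i\<in>?I. c i \<noteq> 0" "\<And>e. e \<in> T \<Longrightarrow> (\<Sum>i\<in>?I. c i * a e i) = 0"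
    using underdetermined_system[OF T(1), of ?I a] by auto
  define w where "w = (\<lambda>j t. if j \<in> {1..p} then \<Sum>k=1..m. c (j, k) * complex_of_real (sin (real k * pi * t)) else 0)"
  define s where "s = (\<Sum>i\<in>?I. (cmod (c i))\<^sup>2)"
  have w: "w \<in> V" "Re (weighted_inner K (weight p) w w) = s / 2"
    "Re (F w w) \<le> ((real m * pi)\<^sup>2 + C) * (s / 2)"
    unfolding w_def s_def by (rule sine_test_function[OF pK C], assumption)+
  have "0 < s"
  proof -
    obtain i where i: "i \<in> ?I" "c i \<noteq> 0" using c(1) by blast
    have "(cmod (c i))\<^sup>2 \<le> s" unfolding s_def by (rule member_le_sum[OF i(1)]) auto
    moreover have "0 < (cmod (c i))\<^sup>2" using i(2) by simp
    ultimately show ?thesis by linarith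
  qed
  have "weighted_inner K (weight p) w e = 0" if e: "e \<in> T" for e
  proof -
    have eV: "e \<in> V" using e T by auto
    have "of_real (weight p j) * (LINT t|unit_edge. w j t * cnj (e j t)) = (if j \<in> {1..p} then \<Sum>k=1..m. c (j, k) * a e (j, k) else 0)"
      if j: "j \<in> {1..K}" for j
    proof (cases "j \<in> {1..p}")
      case True
      have int: "integrable unit_edge (\<lambda>t. c (j, k) * (of_real (sin (real k * pi * t)) * cnj (e j t)))" for k
        by (intro integrable_continuous_edge continuous_intros C1_graph_cont[OF V_C1[OF eV] j])
      have "(LINT t|unit_edge. w j t * cnj (e j t)) = (LINT t|unit_edge. (\<Sum>k=1..m. c (j, k) * (of_real (sin (real k * pi * t)) * cnj (e j t))))"
        using True by (simp add: w_def sum_distrib_right mult.assoc)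
      also have "\<dots> = (\<Sum>k=1..m. c (j, k) * a e (j, k))"
        by (simp only: Bochner_Integration.integral_sum int integral_mult_right_zero a_def fst_conv snd_conv)
      finally show ?thesis using True by (simp add: weight_def)
    next
      case False
      then have "w j = (\<lambda>t. 0)" unfolding w_def by (simp only: if_False)
      then show ?thesis using False by auto
    qed
    then have "weighted_inner K (weight p) w e = (\<Sum>j=1..K. if j \<in> {1..p} then \<Sum>k=1..m. c (j, k) * a e (j, k) else 0)"
      by (simp add: weighted_inner_def)
    also have "\<dots> = (\<Sum>j=1..p. \<Sum>k=1..m. c (j, k) * a e (j, k))"
      by (rule sum.mono_neutral_cong_right) (use pK in auto)
    also have "\<dots> = 0" using c(2)[OF e] by (simp add: sum.cartesian_product)
    finally show ?thesis .
  qed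
  moreover have "Re (F w w) < r * (s / 2)"
    by (rule le_less_trans[OF w(3) mult_strict_right_mono[OF r]]) (use \<open>0 < s\<close> in simp)
  ultimately show ?thesis using w(1) \<open>0 < s\<close> by (intro bexI[of _ w]) (auto simp: w(2))
qed

lemma upper_test:
  assumes pK: "p \<le> K" and C: "0 \<le> C" "\<And>j. j \<in> {1..K} \<Longrightarrow> AE t in unit_edge. \<bar>q j t\<bar> \<le> C"
    and T: "hermitian_form.orthonormal V (weighted_inner K (weight p)) T"
    and Tw: "\<And>e. e \<in> T \<Longrightarrow> \<exists>\<mu>. 0 < \<mu> \<and> \<mu> \<le> r \<and> (\<forall>z\<in>V. F e z = of_real \<mu> * weighted_inner K (weight p) e z)"
    and r: "0 < r" "r + 2 * C < (real (Suc m) * pi)\<^sup>2"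
  shows "card T \<le> 2 * K + p * m"
proof (rule ccontr)
  let ?Q = "weighted_inner K (weight p)"
  interpret F: hermitian_form graph_scale V F by (rule F_hermitian)
  interpret Q: hermitian_form graph_scale V ?Q by (rule weighted_inner_hermitian)
  assume neg: "\<not> card T \<le> 2 * K + p * m"
  have TV: "T \<subseteq> V" and finT: "finite T" using T by (auto simp: Q.orthonormal_def)
  let ?g = "\<lambda>i. real i / real (Suc m)"
  \<comment> \<open>The \<open>2 K\<close> edge ends and \<open>m\<close> interior grid points on
    each positive edge. Zeros at the ends serve the Wirtinger inequality and also make the boundary
    form vanish.\<close>
  let ?J = "{1..K} \<times> {0, 1} \<union> {1..p} \<times> (?g ` {1..m})"
  have "card ?J \<le> card ({1..K} \<times> {0::real, 1}) + card ({1..p} \<times> (?g ` {1..m}))" by (rule card_Un_le)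
  also have "\<dots> \<le> 2 * K + p * m"
    using card_image_le[of "{1..m}" ?g] by (simp add: card_cartesian_product)
  finally have "card ?J < card T" using neg by simp
  moreover have "finite ?J" by simp
  ultimately obtain c where c: "\<exists>e\<in>T. c e \<noteq> 0" "\<forall>x\<in>?J. (\<Sum>e\<in>T. c e * e (fst x) (snd x)) = 0"
    using underdetermined_system[of ?J T "\<lambda>x e. e (fst x) (snd x)"] finT by blast
  define y where "y = (\<Sum>e\<in>T. graph_scale (c e) e)"
  have yV: "y \<in> V" unfolding y_def by (rule Q.comb_in[OF finT TV])
  have y0: "y j s = 0" if "(j, s) \<in> ?J" for j s
    using bspec[OF c(2) that] by (simp add: y_def graph_sum_apply)
  obtain \<mu> where \<mu>: "\<And>e. e \<in> T \<Longrightarrow> 0 < \<mu> e \<and> \<mu> e \<le> r \<and> (\<forall>z\<in>V. F e z = of_real (\<mu> e) * ?Q e z)"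
    using Tw by metis
  define n where "n = (\<Sum>e\<in>T. (cmod (c e))\<^sup>2)"
  have Qy: "?Q y y = of_real n" unfolding y_def n_def by (rule Q.orthonormal_norm[OF T])
  have n0: "0 < n"
  proof -
    obtain e where e: "e \<in> T" "c e \<noteq> 0" using c(1) by blast
    have "(cmod (c e))\<^sup>2 \<le> n" unfolding n_def by (rule member_le_sum[OF e(1)]) (use finT in auto)
    moreover have "0 < (cmod (c e))\<^sup>2" using e(2) by simp
    ultimately show ?thesis by linarith
  qed
  have "F y y = (\<Sum>e\<in>T. c e * F e y)"
    using F.comb_left[OF finT TV yV, of c] by (simp add: y_def)
  also have "\<dots> = (\<Sum>e\<in>T. of_real (\<mu> e * (cmod (c e))\<^sup>2))"
  proof (rule sum.cong[OF refl])
    fix e assume e: "e \<in> T"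
    have "?Q y e = c e" unfolding y_def by (rule Q.orthonormal_coeff[OF T e])
    then have "?Q e y = cnj (c e)" using Q.herm[OF yV, of e] e TV by auto
    then have "F e y = of_real (\<mu> e) * cnj (c e)" using \<mu>[OF e] yV by simp
    then show "c e * F e y = of_real (\<mu> e * (cmod (c e))\<^sup>2)"
      by (simp only: of_real_mult complex_norm_square) (simp add: mult_ac)
  qed
  finally have "Re (F y y) = (\<Sum>e\<in>T. \<mu> e * (cmod (c e))\<^sup>2)" by simp
  also have "\<dots> \<le> r * n" unfolding n_def sum_distrib_left
    using \<mu> by (intro sum_mono mult_right_mono) auto
  finally have up: "Re (F y y) \<le> r * n" .
  \<comment> \<open>\<open>\<kappa>^2\<close> is the midpoint of \<open>r + 2 C\<close> and
    \<open>((m + 1) pi)^2\<close>. Being below the latter it is admissible in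
    \<open>wirtinger_grid\<close>; being above the former it makes \<open>R = \<kappa>^2 - C\<close>
    exceed both \<open>r\<close> and \<open>C\<close>.\<close>
  define \<kappa> where "\<kappa> = sqrt ((r + 2 * C + (real (Suc m) * pi)\<^sup>2) / 2)"
  have "0 < r + 2 * C + (real (Suc m) * pi)\<^sup>2" using r C(1) by (intro add_pos_nonneg) auto
  then have k2: "\<kappa>\<^sup>2 = (r + 2 * C + (real (Suc m) * pi)\<^sup>2) / 2" and kpos: "0 < \<kappa>"
    by (auto simp: \<kappa>_def)
  have "\<kappa>\<^sup>2 < (real (Suc m) * pi)\<^sup>2" unfolding k2 using r by simp
  then have klt: "\<kappa> < real (Suc m) * pi" by (rule power2_less_imp_less) simp
  define R where "R = \<kappa>\<^sup>2 - C"
  define X where "X = (real (Suc m) * pi)\<^sup>2"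
  have R: "r < R" "C \<le> R"
    unfolding R_def k2 using r C(1) unfolding X_def[symmetric] by (auto simp: field_simps)
  have b0: "bform y y = 0"
    using y0 by (auto simp: bform_def bdry_integral_def intro!: sum.neutral)
  have edge_bound: "R * (weight p j * (LINT t|unit_edge. (cmod (y j t))\<^sup>2)) \<le>
      (LINT t|unit_edge. (cmod (grad y j t))\<^sup>2) + (LINT t|unit_edge. q j t * (cmod (y j t))\<^sup>2)" if j: "j \<in> {1..K}" for j
  proof -
    let ?e = "LINT t|unit_edge. (cmod (y j t))\<^sup>2"
    have e0: "0 \<le> ?e" by simp
    note yj = C1_graph_edge[OF V_C1[OF yV] j]
    have qb: "- (C * ?e) \<le> (LINT t|unit_edge. q j t * (cmod (y j t))\<^sup>2)"
      using q_term_bound[OF C(2)[OF j] j C1_edge_continuous[OF yj]] by (simp add: abs_le_iff)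
    show ?thesis
    proof (cases "j \<le> p")
      case True
      have "\<kappa>\<^sup>2 * ?e \<le> (LINT t|unit_edge. (cmod (grad y j t))\<^sup>2)"
      proof (rule wirtinger_grid[OF yj kpos klt])
        fix i assume i: "i \<le> Suc m"
        show "y j (real i / real (Suc m)) = 0"
        proof (cases "i = 0 \<or> i = Suc m")
          case True
          then show ?thesis using y0[of j 0] y0[of j 1] j by auto
        next
          case False
          then show ?thesis using i j \<open>j \<le> p\<close> by (intro y0) auto
        qed
      qed
      then show ?thesis using qb True by (simp add: weight_def R_def left_diff_distrib)
    next
      case False
      \<comment> \<open>On a negative edge the weight turns the left-hand side into
        \<open>- R * ?e\<close>, and \<open>C \<le> R\<close> is enough to absorb the
        potential.\<close>
      have "- (R * ?e) \<le> - (C * ?e)" using R(2) e0 by (simp add: mult_right_mono)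
      moreover have "0 \<le> (LINT t|unit_edge. (cmod (grad y j t))\<^sup>2)" by simp
      ultimately have "- (R * ?e) \<le> (LINT t|unit_edge. (cmod (grad y j t))\<^sup>2) + (LINT t|unit_edge. q j t * (cmod (y j t))\<^sup>2)"
        using qb by linarith
      then show ?thesis using False by (simp add: weight_def)
    qed
  qed
  have "R * n = (\<Sum>j=1..K. R * (weight p j * (LINT t|unit_edge. (cmod (y j t))\<^sup>2)))"
    unfolding Qy[unfolded weighted_inner_diag of_real_eq_iff, symmetric] by (rule sum_distrib_left)
  also have "\<dots> \<le> (\<Sum>j=1..K. (LINT t|unit_edge. (cmod (grad y j t))\<^sup>2) + (LINT t|unit_edge. q j t * (cmod (y j t))\<^sup>2))"
    by (rule sum_mono[OF edge_bound])
  also have "\<dots> = Re (F y y)" using Re_F_diag[OF yV] b0 by (simp add: energy1_def sum.distrib)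
  also have "\<dots> \<le> r * n" by (rule up)
  finally show False using R(1) n0 by simp
qed

section \<open>From solutions of the equation to positivity and coercivity\<close>

lemma solution_dom_L:
  assumes sol: "solution \<omega> l y y' y''"
  shows "dom_L K q A y y' y''"
    "j \<in> {1..K} \<Longrightarrow> AE t in unit_edge. diff_expr q y y'' j t = of_real (l * \<omega> j) * y j t"
    "graph_inner K (diff_expr q y y'') y = of_real l * weighted_inner K \<omega> y y"
proof -
  have AC: "AC_deriv (y j) (y' j)" "AC_deriv (y' j) (y'' j)" if "j \<in> {1..K}" for j
    using sol that by (auto simp: solution_def graph_AC_deriv_def)
  have yc: "continuous_on {0..1} (y j)" if "j \<in> {1..K}" for j
    by (rule AC_deriv_continuous[OF AC(1)[OF that]])
  have AE: "AE t in unit_edge. diff_expr q y y'' j t = of_real (l * \<omega> j) * y j t" if j: "j \<in> {1..K}" for j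
  proof -
    have "AE t in unit_edge. y'' j t = of_real (q j t - l * \<omega> j) * y j t"
      using sol j by (auto simp: solution_def)
    then show ?thesis by eventually_elim (simp add: diff_expr_def algebra_simps)
  qed
  then show "j \<in> {1..K} \<Longrightarrow> AE t in unit_edge. diff_expr q y y'' j t = of_real (l * \<omega> j) * y j t" .
  have int: "integrable unit_edge (diff_expr q y y'' j)" if j: "j \<in> {1..K}" for j
  proof -
    have "integrable unit_edge (\<lambda>t. - y'' j t + of_real (q j t) * y j t)"
      using AC(2)[OF j]
      by (intro Bochner_Integration.integrable_add integrable_minus q_mult_integrable j yc) (auto simp: AC_deriv_def)
    then show ?thesis by (simp add: diff_expr_def)
  qed
  have "L2_edge (diff_expr q y y'' j)" if j: "j \<in> {1..K}" for j
    unfolding L2_edge_def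
  proof
    show m: "diff_expr q y y'' j \<in> borel_measurable unit_edge" using int[OF j] by simp
    have "integrable unit_edge (\<lambda>t. (cmod (of_real (l * \<omega> j) * y j t))\<^sup>2)"
      by (intro integrable_continuous_edge continuous_intros yc j)
    moreover have "(\<lambda>t. (cmod (diff_expr q y y'' j t))\<^sup>2) \<in> borel_measurable unit_edge"
      using m by measurable
    moreover have "AE t in unit_edge. (cmod (of_real (l * \<omega> j) * y j t))\<^sup>2 = (cmod (diff_expr q y y'' j t))\<^sup>2"
      using AE[OF j] by eventually_elim simp
    ultimately show "integrable unit_edge (\<lambda>t. (cmod (diff_expr q y y'' j t))\<^sup>2)"
      by (rule integrable_cong_AE_imp)
  qed
  then show "dom_L K q A y y' y''"
    using sol by (auto simp: dom_L_def solution_def graph_L2_def)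
  have "(LINT t|unit_edge. diff_expr q y y'' j t * cnj (y j t)) = of_real l * (of_real (\<omega> j) * (LINT t|unit_edge. y j t * cnj (y j t)))"
    if j: "j \<in> {1..K}" for j
  proof -
    have "(LINT t|unit_edge. diff_expr q y y'' j t * cnj (y j t)) = (LINT t|unit_edge. of_real (l * \<omega> j) * (y j t * cnj (y j t)))"
    proof (rule integral_cong_AE)
      show "(\<lambda>t. diff_expr q y y'' j t * cnj (y j t)) \<in> borel_measurable unit_edge"
        using integrable_mult_continuous[OF int[OF j], of "\<lambda>t. cnj (y j t)"] yc[OF j]
        by (simp add: continuous_intros)
      show "(\<lambda>t. of_real (l * \<omega> j) * (y j t * cnj (y j t))) \<in> borel_measurable unit_edge"
        by (intro borel_measurable_integrable integrable_continuous_edge continuous_intros yc j)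
      show "AE t in unit_edge. diff_expr q y y'' j t * cnj (y j t) = of_real (l * \<omega> j) * (y j t * cnj (y j t))"
        using AE[OF j] by eventually_elim (simp add: mult.assoc)
    qed
    then show ?thesis by (simp add: mult.assoc)
  qed
  then show "graph_inner K (diff_expr q y y'') y = of_real l * weighted_inner K \<omega> y y"
    by (simp add: graph_inner_def weighted_inner_def sum_distrib_left)
qed

lemma nonzero_on_graph_if:
  assumes "weighted_inner K \<omega> y y \<noteq> 0"
  shows "nonzero_on_graph K y"
proof (rule ccontr)
  assume "\<not> nonzero_on_graph K y"
  then have "(LINT t|unit_edge. (cmod (y j t))\<^sup>2) = (LINT t|unit_edge. 0)" if "j \<in> {1..K}" for j
    using that by (intro LINT_cong) (auto simp: nonzero_on_graph_def)
  then show False using assms by (simp add: weighted_inner_diag)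
qed

text \<open>Pairing the equation with \<open>y\<close> gives \<open>l\<close> times the weighted
  square of \<open>y\<close> for the pairing of \<open>L y\<close> with \<open>y\<close>. So
  \<open>l\<close> and that square have the same sign; with weight 1 the eigenvalue itself is
  positive.\<close>

lemma solution_pos:
  assumes sol: "solution \<omega> l y y' y''" and L: "L_positive_definite K q A" and nz: "nonzero_on_graph K y"
  shows "0 < l * Re (weighted_inner K \<omega> y y)"
proof -
  have "pos_number (graph_inner K (diff_expr q y y'') y)"
    using L solution_dom_L(1)[OF sol] nz unfolding L_positive_definite_def by blast
  then show ?thesis unfolding solution_dom_L(3)[OF sol] by (simp add: pos_number_def)
qed

text \<open>Positivity on the domain of \<open>L\<close> is exploited through a minimiser, but
  \<open>direct_method\<close> presupposes coercivity. The circle is broken by shifting the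
  potential by \<open>D\<close>: Garding's inequality makes the shifted form coercive, its minimiser
  for the squared norm is an eigenfunction of \<open>L\<close> with eigenvalue \<open>l - D\<close>,
  and this number is positive.\<close>

lemma coercive:
  assumes K: "1 \<le> K" and L: "L_positive_definite K q A"
  obtains c where "0 < c" "\<And>y. y \<in> V \<Longrightarrow> c * (energy0 K y + energy1 K y) \<le> Re (F y y)"
proof -
  obtain d where d: "0 \<le> d" "\<And>y. y \<in> V \<Longrightarrow> energy1 K y \<le> 2 * Re (F y y) + d * energy0 K y"
    using Garding by blast
  obtain C where C: "0 \<le> C" "\<And>j. j \<in> {1..K} \<Longrightarrow> AE t in unit_edge. \<bar>q j t\<bar> \<le> C"
    using q_bound by blast
  \<comment> \<open>Chosen so that Garding's inequality becomes
    \<open>(energy0 + energy1) / 2 \<le> Re F + D energy0\<close>.\<close>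
  define D where "D = (d + 1) / 2"
  interpret S: graph_form K "\<lambda>j t. q j t + D" A f
  proof
    show "ess_bounded_potential K (\<lambda>j t. q j t + D)"
      unfolding ess_bounded_potential_def
    proof (intro ballI conjI)
      fix j assume j: "j \<in> {1..K}"
      show "(\<lambda>t. q j t + D) \<in> borel_measurable unit_edge" using q_measurable[OF j] by measurable
      have "AE t in unit_edge. \<bar>q j t + D\<bar> \<le> C + \<bar>D\<bar>" using C(2)[OF j] by eventually_elim linarith
      then show "\<exists>C. AE t in unit_edge. \<bar>q j t + D\<bar> \<le> C" by blast
    qed
  qed (fact bdry_herm conormal)+
  have SF: "S.F y y = F y y + of_real (D * energy0 K y)" if y: "y \<in> V" for y
  proof -
    have "(LINT t|unit_edge. of_real (q j t + D) * (y j t * cnj (y j t)))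
        = (LINT t|unit_edge. of_real (q j t) * (y j t * cnj (y j t))) + of_real D * (LINT t|unit_edge. y j t * cnj (y j t))"
      if j: "j \<in> {1..K}" for j
    proof -
      note yc = C1_graph_cont[OF V_C1[OF y] j]
      have "(LINT t|unit_edge. of_real (q j t + D) * (y j t * cnj (y j t)))
          = (LINT t|unit_edge. of_real (q j t) * (y j t * cnj (y j t)) + of_real D * (y j t * cnj (y j t)))"
        by (simp add: algebra_simps)
      also have "\<dots> = (LINT t|unit_edge. of_real (q j t) * (y j t * cnj (y j t))) + (LINT t|unit_edge. of_real D * (y j t * cnj (y j t)))"
        by (intro LINT_add q_mult_integrable j integrable_continuous_edge continuous_intros yc)
      finally show ?thesis by simp
    qed
    then have "S.F y y = F y y + of_real D * (\<Sum>j=1..K. LINT t|unit_edge. y j t * cnj (y j t))"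
      unfolding S.F_def F_def S.bform_def bform_def by (simp add: sum.distrib sum_distrib_left)
    then show ?thesis unfolding LINT_of_real_norm_square by (simp add: energy0_def)
  qed
  have Sc: "1 / 2 * (energy0 K y + energy1 K y) \<le> Re (S.F y y)" if y: "y \<in> V" for y
  proof -
    have "D * energy0 K y = (d * energy0 K y + energy0 K y) / 2" by (simp add: D_def field_simps)
    then show ?thesis using d(2)[OF y] unfolding SF[OF y] by simp
  qed
  \<comment> \<open>Supplies a nonzero element of \<open>V\<close>, a multiple of one sine on the
    first edge, so that the constraint set of the minimisation is inhabited.\<close>
  have "\<exists>w\<in>V. (\<forall>e\<in>{}. weighted_inner K (weight 1) w e = 0) \<and> 0 < Re (weighted_inner K (weight 1) w w) \<and>
    Re (F w w) < ((real 1 * pi)\<^sup>2 + C + 1) * Re (weighted_inner K (weight 1) w w)"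
    by (rule lower_test[OF K C(2), of "{}" 1]) auto
  then obtain w where w: "w \<in> V" "0 < Re (weighted_inner K (weight 1) w w)" by blast
  have w1: "0 < Re (weighted_inner K (\<lambda>_. 1) w w)"
    using w(2) weighted_inner_le_energy0[of K 1 w] by (simp add: weighted_inner_one)
  have orth: "hermitian_form.orthonormal V (weighted_inner K (\<lambda>_. 1)) {}"
    using hermitian_form.orthonormal_def[OF S.weighted_inner_hermitian] by simp
  obtain l y y' y'' where y: "S.solution (\<lambda>_. 1) l y y' y''" "weighted_inner K (\<lambda>_. 1) y y = 1"
    "\<And>x. x \<in> V \<Longrightarrow> l * Re (weighted_inner K (\<lambda>_. 1) x x) \<le> Re (S.F x x)"
  proof (rule S.direct_method[OF _ Sc orth _ w(1) _ w1, of "\<lambda>_. 0"])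
    fix l y y' y''
    assume "S.solution (\<lambda>_. 1) l y y' y''" "weighted_inner K (\<lambda>_. 1) y y = 1"
      and "\<And>x. x \<in> V \<Longrightarrow> (\<And>e. e \<in> {} \<Longrightarrow> weighted_inner K (\<lambda>_. 1) x e = 0)
        \<Longrightarrow> l * Re (weighted_inner K (\<lambda>_. 1) x x) \<le> Re (S.F x x)"
    then show thesis by (intro that) auto
  qed auto
  have sol: "solution (\<lambda>_. 1) (l - D) y y' y''"
  proof -
    have eq: "q j t + D - l * 1 = q j t - (l - D) * 1" for j t by simp
    show ?thesis using y(1) by (simp only: S.solution_def solution_def eq) blast
  qed
  define m where "m = l - D"
  have "0 < (l - D) * Re (weighted_inner K (\<lambda>_. 1) y y)"
    by (rule solution_pos[OF sol L nonzero_on_graph_if[of "\<lambda>_. 1"]]) (simp add: y(2))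
  then have m: "0 < m" using y(2) by (simp add: m_def)
  have low: "m * energy0 K x \<le> Re (F x x)" if x: "x \<in> V" for x
    using y(3)[of x] x SF[OF x] by (simp add: weighted_inner_one m_def algebra_simps)
  \<comment> \<open>Comes from \<open>energy0 \<le> Re F / m\<close> inserted into
    \<open>energy0 + energy1 \<le> 2 Re F + (d + 1) energy0\<close>.\<close>
  define c where "c = 1 / (2 + (d + 1) / m)"
  have den: "0 < 2 + (d + 1) / m" using d(1) m by (simp add: add_pos_nonneg)
  have "c * (energy0 K x + energy1 K x) \<le> Re (F x x)" if x: "x \<in> V" for x
  proof -
    have "energy0 K x \<le> Re (F x x) / m" using low[OF x] m by (simp add: field_simps)
    then have "(d + 1) * energy0 K x \<le> (d + 1) * (Re (F x x) / m)" using d(1) by (intro mult_left_mono) auto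
    then have "energy0 K x + energy1 K x \<le> (2 + (d + 1) / m) * Re (F x x)"
      using d(2)[OF x] by (simp add: algebra_simps)
    then show ?thesis using den by (simp add: c_def field_simps)
  qed
  moreover have "0 < c" using den by (simp add: c_def)
  ultimately show ?thesis using that by blast
qed

end

section \<open>The eigenvalue problem\<close>

text \<open>The cubic \<open>a + c t + A t^2 + B t^3\<close>, with \<open>A\<close> and
  \<open>B\<close> determined by the data at 1.\<close>

lemma Hermite_interpolation:
  fixes a b c d :: complex
  shows "\<exists>h h' h''. C1_edge h h' \<and> C1_edge h' h'' \<and> h 0 = a \<and> h 1 = b \<and> h' 0 = c \<and> h' 1 = d"
proof -
  define A B where "A = 3 * (b - a) - 2 * c - d" and "B = 2 * (a - b) + c + d"
  define X where "X = complex_of_real"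
  have X: "C1_edge X (\<lambda>t. 1)" unfolding X_def by (rule C1_edge_of_real)
  define h h' h'' where "h = (\<lambda>t. a + (c * X t + (A * (X t * X t) + B * (X t * (X t * X t)))))"
    and "h' = (\<lambda>t. c + (2 * A * X t + 3 * B * (X t * X t)))"
    and "h'' = (\<lambda>t. 0 + (2 * A * 1 + 3 * B * (1 * X t + X t * 1)))"
  have "C1_edge h (\<lambda>t. 0 + (c * 1 + (A * (1 * X t + X t * 1) + B * (1 * (X t * X t) + X t * (1 * X t + X t * 1)))))"
    unfolding h_def by (intro C1_edge_add C1_edge_const C1_edge_cmult C1_edge_mult X)
  then have "C1_edge h h'"
    by (rule C1_edge_cong) (simp_all add: h'_def algebra_simps)
  moreover have "C1_edge h' h''"
    unfolding h'_def h''_def by (intro C1_edge_add C1_edge_const C1_edge_cmult C1_edge_mult X)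
  moreover have "h 0 = a" "h 1 = b" "h' 0 = c" "h' 1 = d"
    by (simp_all add: h_def h'_def X_def A_def B_def)
  ultimately show ?thesis by blast
qed

text \<open>Co-normality provides \<open>f\<close> without any symmetry. End values satisfying (I)
  are extended to functions with \<open>X' = - f X\<close> at every edge end; these satisfy (II) by
  co-normality, and formal self-adjointness reduces Green's identity for two of them to the claimed
  symmetry.\<close>

lemma bdry_integral_hermitian:
  assumes q: "ess_bounded_potential K q" and sa: "formally_self_adjoint K q A"
    and conormal: "\<And>x x' x''. x \<in> dom_F K A \<Longrightarrow> graph_H2 K x x' x'' \<Longrightarrow>
      (\<forall>y\<in>dom_F K A. bdry_integral K (\<lambda>j t. (f j t * x j t + x' j t) * cnj (y j t)) = 0) \<longleftrightarrow> satisfies_II K A x x'"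
    and I: "satisfies_I K A x" "satisfies_I K A y"
  shows "bdry_integral K (\<lambda>j t. f j t * y j t * cnj (x j t)) = cnj (bdry_integral K (\<lambda>j t. f j t * x j t * cnj (y j t)))"
proof -
  interpret graph_potential K q by standard (rule q)
  have ext: "\<exists>Z Z' Z''. (\<forall>j. C1_edge (Z j) (Z' j) \<and> C1_edge (Z' j) (Z'' j) \<and> Z j 0 = z j 0 \<and> Z j 1 = z j 1
      \<and> Z' j 0 = - f j 0 * z j 0 \<and> Z' j 1 = - f j 1 * z j 1)" for z
  proof -
    have "\<forall>j. \<exists>h h' h''. C1_edge h h' \<and> C1_edge h' h'' \<and> h 0 = z j 0 \<and> h 1 = z j 1
      \<and> h' 0 = - f j 0 * z j 0 \<and> h' 1 = - f j 1 * z j 1"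
      by (intro allI Hermite_interpolation)
    then show ?thesis by metis
  qed
  have ok: "graph_H2 K Z Z' Z'' \<and> satisfies_I K A Z \<and> satisfies_II K A Z Z'"
    if Z: "\<forall>j. C1_edge (Z j) (Z' j) \<and> C1_edge (Z' j) (Z'' j) \<and> Z j 0 = z j 0 \<and> Z j 1 = z j 1
      \<and> Z' j 0 = - f j 0 * z j 0 \<and> Z' j 1 = - f j 1 * z j 1" and z: "satisfies_I K A z" for Z Z' Z'' z
  proof -
    have H2: "graph_H2 K Z Z' Z''"
      unfolding graph_H2_def graph_H1_def graph_AC_deriv_def graph_L2_def
      using Z by (intro conjI ballI C1_edge_imp_AC_deriv L2_edge_continuous)
        (auto intro: C1_edge_continuous_deriv)
    have ZI: "satisfies_I K A Z" using z satisfies_I_cong[of K Z z A] Z by simp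
    have "Z \<in> dom_F K A" using H2 ZI unfolding dom_F_def graph_H2_def by blast
    \<comment> \<open>The first factor is 0 at every edge end by the choice of
      \<open>Z'\<close>.\<close>
    moreover have "bdry_integral K (\<lambda>j t. (f j t * Z j t + Z' j t) * cnj (y j t)) = 0" for y
      using Z by (simp add: bdry_integral_def)
    ultimately have "satisfies_II K A Z Z'" using conormal[OF _ H2] by blast
    with H2 ZI show ?thesis by blast
  qed
  obtain X X' X'' where X: "\<forall>j. C1_edge (X j) (X' j) \<and> C1_edge (X' j) (X'' j) \<and> X j 0 = x j 0 \<and> X j 1 = x j 1
      \<and> X' j 0 = - f j 0 * x j 0 \<and> X' j 1 = - f j 1 * x j 1" using ext[of x] by blast
  obtain Y Y' Y'' where Y: "\<forall>j. C1_edge (Y j) (Y' j) \<and> C1_edge (Y' j) (Y'' j) \<and> Y j 0 = y j 0 \<and> Y j 1 = y j 1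
      \<and> Y' j 0 = - f j 0 * y j 0 \<and> Y' j 1 = - f j 1 * y j 1" using ext[of y] by blast
  define D where "D = (\<lambda>(Z::graph_fun) (Y::graph_fun) j. (LINT t|unit_edge. Z j t * cnj (Y j t)) :: complex)"
  define P where "P = (\<lambda>j. LINT t|unit_edge. of_real (q j t) * (X j t * cnj (Y j t)))"
  have "graph_inner K (diff_expr q X X'') Y = graph_inner K X (diff_expr q Y Y'')"
    using sa ok[OF X I(1)] ok[OF Y I(2)] unfolding formally_self_adjoint_def by blast
  moreover have "(LINT t|unit_edge. diff_expr q X X'' j t * cnj (Y j t))
      = D X' Y' j + P j - (X' j 1 * cnj (Y j 1) - X' j 0 * cnj (Y j 0))" if j: "j \<in> {1..K}" for j
  proof -
    have X1: "C1_edge (X j) (X' j)" "C1_edge (X' j) (X'' j)" and Y1: "C1_edge (Y j) (Y' j)" using X Y by auto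
    note c = C1_edge_continuous[OF X1(1)] C1_edge_continuous_deriv[OF X1(2)] C1_edge_continuous[OF Y1]
    have "(LINT t|unit_edge. diff_expr q X X'' j t * cnj (Y j t))
        = (LINT t|unit_edge. of_real (q j t) * (X j t * cnj (Y j t)) - X'' j t * cnj (Y j t))"
      by (rule LINT_cong) (auto simp: diff_expr_def algebra_simps)
    also have "\<dots> = P j - (LINT t|unit_edge. X'' j t * cnj (Y j t))"
      unfolding P_def
      by (intro LINT_diff q_mult_integrable j integrable_continuous_edge continuous_intros c)
    also have "(LINT t|unit_edge. X'' j t * cnj (Y j t)) = X' j 1 * cnj (Y j 1) - X' j 0 * cnj (Y j 0) - D X' Y' j"
      using LINT_by_parts[OF X1(2) C1_edge_cnj[OF Y1]] by (simp add: D_def)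
    finally show ?thesis by simp
  qed
  moreover have "(LINT t|unit_edge. X j t * cnj (diff_expr q Y Y'' j t))
      = D X' Y' j + P j - (X j 1 * cnj (Y' j 1) - X j 0 * cnj (Y' j 0))" if j: "j \<in> {1..K}" for j
  proof -
    have Y1: "C1_edge (Y j) (Y' j)" "C1_edge (Y' j) (Y'' j)" and X1: "C1_edge (X j) (X' j)" using X Y by auto
    note c = C1_edge_continuous[OF Y1(1)] C1_edge_continuous_deriv[OF Y1(2)] C1_edge_continuous[OF X1]
    have "(LINT t|unit_edge. X j t * cnj (diff_expr q Y Y'' j t))
        = (LINT t|unit_edge. of_real (q j t) * (X j t * cnj (Y j t)) - X j t * cnj (Y'' j t))"
      by (rule LINT_cong) (auto simp: diff_expr_def algebra_simps)
    also have "\<dots> = P j - (LINT t|unit_edge. X j t * cnj (Y'' j t))"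
      unfolding P_def
      by (intro LINT_diff q_mult_integrable j integrable_continuous_edge continuous_intros c)
    also have "(LINT t|unit_edge. X j t * cnj (Y'' j t)) = X j 1 * cnj (Y' j 1) - X j 0 * cnj (Y' j 0) - D X' Y' j"
      using LINT_by_parts[OF X1 C1_edge_cnj[OF Y1(2)]] by (simp add: D_def)
    finally show ?thesis by simp
  qed
  ultimately have "(\<Sum>j=1..K. D X' Y' j + P j - (X' j 1 * cnj (Y j 1) - X' j 0 * cnj (Y j 0)))
      = (\<Sum>j=1..K. D X' Y' j + P j - (X j 1 * cnj (Y' j 1) - X j 0 * cnj (Y' j 0)))"
    by (simp add: graph_inner_def)
  \<comment> \<open>The interior terms \<open>D\<close> and \<open>P\<close> are common to both
    sides and cancel, so only boundary terms remain.\<close>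
  then have sums: "(\<Sum>j=1..K. X' j 1 * cnj (Y j 1) - X' j 0 * cnj (Y j 0)) = (\<Sum>j=1..K. X j 1 * cnj (Y' j 1) - X j 0 * cnj (Y' j 0))"
    unfolding sum_subtractf[of "\<lambda>j. D X' Y' j + P j"] by simp
  have "X' j 1 * cnj (Y j 1) - X' j 0 * cnj (Y j 0) = - (f j 1 * x j 1 * cnj (y j 1) - f j 0 * x j 0 * cnj (y j 0))"
    and "X j 1 * cnj (Y' j 1) - X j 0 * cnj (Y' j 0) = - cnj (f j 1 * y j 1 * cnj (x j 1) - f j 0 * y j 0 * cnj (x j 0))" for j
    using X Y by (simp_all add: algebra_simps)
  then have "- bdry_integral K (\<lambda>j t. f j t * x j t * cnj (y j t)) = - cnj (bdry_integral K (\<lambda>j t. f j t * y j t * cnj (x j t)))"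
    using sums unfolding bdry_integral_def cnj_sum by (simp only: sum_negf)
  then show ?thesis by simp
qed

section \<open>Linear structure and orthogonality of the eigenspaces\<close>

lemma AC_deriv_add:
  assumes "AC_deriv x x'" "AC_deriv y y'"
  shows "AC_deriv (\<lambda>t. x t + y t) (\<lambda>t. x' t + y' t)"
  unfolding AC_deriv_def
proof (intro conjI ballI)
  show "integrable unit_edge (\<lambda>t. x' t + y' t)" using assms by (simp add: AC_deriv_def)
  fix t :: real assume t: "t \<in> {0..1}"
  then have i: "integrable (lebesgue_on {0..t}) x'" "integrable (lebesgue_on {0..t}) y'"
    using assms by (auto simp: AC_deriv_def intro!: integrable_lebesgue_on_subinterval)
  show "x t + y t = x 0 + y 0 + (LINT s|lebesgue_on {0..t}. x' s + y' s)"
    unfolding LINT_add[OF i]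
    unfolding AC_deriv_eq[OF assms(1) t, symmetric] AC_deriv_eq[OF assms(2) t, symmetric] primitive_def
    by simp
qed

lemma AC_deriv_cmult:
  assumes "AC_deriv x x'"
  shows "AC_deriv (\<lambda>t. c * x t) (\<lambda>t. c * x' t)"
  unfolding AC_deriv_def
proof (intro conjI ballI)
  show "integrable unit_edge (\<lambda>t. c * x' t)" using assms by (simp add: AC_deriv_def)
  fix t :: real assume t: "t \<in> {0..1}"
  show "c * x t = c * x 0 + (LINT s|lebesgue_on {0..t}. c * x' s)"
    unfolding AC_deriv_eq[OF assms t, symmetric] by (simp add: primitive_def distrib_left)
qed

lemma satisfies_II_add:
  assumes "satisfies_II K A x x'" "satisfies_II K A y y'"
  shows "satisfies_II K A (x + y) (x' + y')"
  unfolding satisfies_II_def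
proof
  fix i assume i: "i \<in> {num_I A + 1..2 * K}"
  let ?S = "\<lambda>x x'. \<Sum>j=1..K. bc_alpha A i j * x j 0 + bc_beta A i j * x' j 0 + bc_gamma A i j * x j 1 + bc_delta A i j * x' j 1"
  have "?S (x + y) (x' + y') = ?S x x' + ?S y y'"
    by (simp add: sum.distrib[symmetric] algebra_simps)
  then show "?S (x + y) (x' + y') = 0" using assms i by (simp add: satisfies_II_def)
qed

lemma satisfies_II_scale:
  assumes "satisfies_II K A x x'"
  shows "satisfies_II K A (graph_scale c x) (graph_scale c x')"
  unfolding satisfies_II_def
proof
  fix i assume i: "i \<in> {num_I A + 1..2 * K}"
  let ?S = "\<lambda>x x'. \<Sum>j=1..K. bc_alpha A i j * x j 0 + bc_beta A i j * x' j 0 + bc_gamma A i j * x j 1 + bc_delta A i j * x' j 1"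
  have "?S (graph_scale c x) (graph_scale c x') = c * ?S x x'"
    by (simp add: sum_distrib_left graph_scale_def algebra_simps)
  then show "?S (graph_scale c x) (graph_scale c x') = 0" using assms i by (simp add: satisfies_II_def)
qed

lemma weighted_inner_eq_indef_inner: "indef_inner K p x y = weighted_inner K (weight p) x y"
  by (simp add: indef_inner_def graph_inner_def mult_weight_def weighted_inner_def mult.assoc)

context graph_form
begin

text \<open>The eigenvalue equation with a real parameter is solved for \<open>y''\<close>; the
  square integrability of \<open>diff_expr\<close> that \<open>dom_L\<close> demands is supplied by
  \<open>solution_dom_L\<close>.\<close>

lemma eigenspace_iff_solution:
  "y \<in> eigenspace K p q A (of_real l) \<longleftrightarrow>
    (\<forall>j t. \<not> (j \<in> {1..K} \<and> t \<in> {0..1}) \<longrightarrow> y j t = 0) \<and> (\<exists>y' y''. solution (weight p) l y y' y'')"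
proof -
  have eq: "diff_expr q y y'' j t = of_real l * mult_weight p y j t \<longleftrightarrow> y'' j t = of_real (q j t - l * weight p j) * y j t"
    for y'' j t
    by (auto simp: diff_expr_def mult_weight_def algebra_simps)
  have "dom_L K q A y y' y'' \<and> (\<forall>j\<in>{1..K}. AE t in unit_edge. diff_expr q y y'' j t = of_real l * mult_weight p y j t)
      \<longleftrightarrow> solution (weight p) l y y' y''" for y' y''
    using solution_dom_L(1)[of "weight p" l y y' y''] unfolding eq by (auto simp: solution_def dom_L_def)
  then show ?thesis unfolding eigenspace_def by simp
qed

lemma solution_add:
  assumes "solution \<omega> l x x' x''" "solution \<omega> l y y' y''"
  shows "solution \<omega> l (x + y) (x' + y') (x'' + y'')"
  unfolding solution_def graph_AC_deriv_def
proof (intro conjI ballI)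
  fix j assume j: "j \<in> {1..K}"
  show "AC_deriv ((x + y) j) ((x' + y') j)" "AC_deriv ((x' + y') j) ((x'' + y'') j)"
    using AC_deriv_add[of "x j" "x' j" "y j" "y' j"] AC_deriv_add[of "x' j" "x'' j" "y' j" "y'' j"] assms j
    by (auto simp: solution_def graph_AC_deriv_def plus_fun_def)
  have "AE t in unit_edge. x'' j t = of_real (q j t - l * \<omega> j) * x j t" "AE t in unit_edge. y'' j t = of_real (q j t - l * \<omega> j) * y j t"
    using assms j by (auto simp: solution_def)
  then show "AE t in unit_edge. (x'' + y'') j t = of_real (q j t - l * \<omega> j) * (x + y) j t"
  proof eventually_elim
    case (elim t)
    then show ?case by (simp add: distrib_left)
  qed
qed (use assms in \<open>auto simp: solution_def intro: satisfies_I_add satisfies_II_add\<close>)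

lemma solution_scale:
  assumes "solution \<omega> l x x' x''"
  shows "solution \<omega> l (graph_scale c x) (graph_scale c x') (graph_scale c x'')"
  unfolding solution_def graph_AC_deriv_def
proof (intro conjI ballI)
  fix j assume j: "j \<in> {1..K}"
  show "AC_deriv (graph_scale c x j) (graph_scale c x' j)" "AC_deriv (graph_scale c x' j) (graph_scale c x'' j)"
    using AC_deriv_cmult[of "x j" "x' j" c] AC_deriv_cmult[of "x' j" "x'' j" c] assms j
    by (auto simp: solution_def graph_AC_deriv_def graph_scale_def)
  have "AE t in unit_edge. x'' j t = of_real (q j t - l * \<omega> j) * x j t"
    using assms j by (auto simp: solution_def)
  then show "AE t in unit_edge. graph_scale c x'' j t = of_real (q j t - l * \<omega> j) * graph_scale c x j t"
    by eventually_elim (simp add: graph_scale_def)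
qed (use assms in \<open>auto simp: solution_def intro: satisfies_I_scale satisfies_II_scale\<close>)

lemma solution_zero: "solution \<omega> l 0 0 0"
  unfolding solution_def graph_AC_deriv_def
  by (auto simp: AC_deriv_def satisfies_I_def satisfies_II_def zero_fun_def)

lemma eigenspace_subspace: "module.subspace graph_scale (eigenspace K p q A (of_real l))"
proof -
  interpret vector_space graph_scale by (rule vector_space_graph_scale)
  show ?thesis
  proof (rule subspaceI)
    show "0 \<in> eigenspace K p q A (of_real l)"
      unfolding eigenspace_iff_solution using solution_zero by auto
    show "x + y \<in> eigenspace K p q A (of_real l)"
      if xy: "x \<in> eigenspace K p q A (of_real l)" "y \<in> eigenspace K p q A (of_real l)" for x y
    proof -
      obtain x' x'' y' y'' where s: "solution (weight p) l x x' x''" "solution (weight p) l y y' y''"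
        using xy unfolding eigenspace_iff_solution by blast
      show ?thesis
        using solution_add[OF s] xy unfolding eigenspace_iff_solution plus_fun_apply
        by (intro conjI exI) (blast | simp)+
    qed
    show "graph_scale c x \<in> eigenspace K p q A (of_real l)"
      if "x \<in> eigenspace K p q A (of_real l)" for c x
      using that solution_scale unfolding eigenspace_iff_solution by (metis graph_scale_def mult_zero_right)
  qed
qed

lemma eigenspace_V: "y \<in> eigenspace K p q A (of_real l) \<Longrightarrow> y \<in> V"
  unfolding eigenspace_iff_solution using solution_H2(2) by blast

lemma eigenspace_weak:
  "y \<in> eigenspace K p q A (of_real l) \<Longrightarrow> z \<in> V \<Longrightarrow> F y z = of_real l * weighted_inner K (weight p) y z"
  unfolding eigenspace_iff_solution using solution_weak by blast

text \<open>The normalisation off the graph makes vanishing as a vector and vanishing on the graph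
  the same.\<close>

lemma eigenspace_nonzero:
  assumes "y \<in> eigenspace K p q A \<mu>" "y \<noteq> 0"
  shows "nonzero_on_graph K y"
proof -
  obtain j t where jt: "y j t \<noteq> 0" using assms(2) by (auto simp: fun_eq_iff)
  then have "j \<in> {1..K} \<and> t \<in> {0..1}" using assms(1) unfolding eigenspace_def by blast
  then show ?thesis using jt unfolding nonzero_on_graph_def by blast
qed

text \<open>For \<open>l > 0\<close> this makes the indefinite form positive definite on the
  eigenspace, so that orthonormal bases exist there.\<close>

lemma eigenspace_pos:
  assumes L: "L_positive_definite K q A" and y: "y \<in> eigenspace K p q A (of_real l)" "nonzero_on_graph K y"
  shows "0 < l * Re (weighted_inner K (weight p) y y)"
  using y solution_pos[OF _ L] unfolding eigenspace_iff_solution by blast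

text \<open>Evaluating \<open>F\<close> on the pair in both orders yields the same multiple of the
  inner product with the factors \<open>l\<close> and \<open>m\<close>.\<close>

lemma eigenspace_orthogonal:
  assumes x: "x \<in> eigenspace K p q A (of_real l)" and y: "y \<in> eigenspace K p q A (of_real m)" and ne: "l \<noteq> m"
  shows "weighted_inner K (weight p) x y = 0"
proof -
  interpret F: hermitian_form graph_scale V F by (rule F_hermitian)
  interpret Q: hermitian_form graph_scale V "weighted_inner K (weight p)" by (rule weighted_inner_hermitian)
  note V = eigenspace_V[OF x] eigenspace_V[OF y]
  have "of_real m * weighted_inner K (weight p) y x = F y x" using eigenspace_weak[OF y V(1)] by simp
  also have "\<dots> = cnj (F x y)" by (rule F.herm[OF V])
  also have "\<dots> = of_real l * weighted_inner K (weight p) y x"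
    using eigenspace_weak[OF x V(2)] Q.herm[OF V] by simp
  finally have "weighted_inner K (weight p) y x = 0" using ne by simp
  then show ?thesis using Q.herm[OF V(2,1)] by simp
qed

definition pos_eigenvalues :: "nat \<Rightarrow> real set"
  where "pos_eigenvalues p = {l. 0 < l \<and> (\<exists>y\<in>eigenspace K p q A (of_real l). nonzero_on_graph K y)}"

text \<open>Pairing the equation with \<open>y\<close> gives \<open>(L y, y) = \<mu> [y, y]\<close>.
  If both brackets are positive, \<open>\<mu>\<close> is a positive real; if \<open>\<mu>\<close> is
  a positive real, positivity of \<open>L\<close> forces \<open>[y, y] > 0\<close>.\<close>

lemma eigenvalues_C_plus_eq:
  assumes L: "L_positive_definite K q A"
  shows "eigenvalues_C_plus K p q A = complex_of_real ` pos_eigenvalues p"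
proof (intro set_eqI iffI)
  fix \<mu> assume "\<mu> \<in> eigenvalues_C_plus K p q A"
  then obtain y where y: "y \<in> eigenspace K p q A \<mu>" "nonzero_on_graph K y" "y \<in> C_plus K p"
    by (auto simp: eigenvalues_C_plus_def)
  then obtain y' y'' where d: "dom_L K q A y y' y''"
    and AE: "\<And>j. j \<in> {1..K} \<Longrightarrow> AE t in unit_edge. diff_expr q y y'' j t = \<mu> * mult_weight p y j t"
    by (auto simp: eigenspace_def)
  \<comment> \<open>Here \<open>\<mu>\<close> is a priori complex, so the lemmas on real parameters
    do not apply and the pairing is computed from \<open>dom_L\<close> directly.\<close>
  have "(LINT t|unit_edge. diff_expr q y y'' j t * cnj (y j t)) = \<mu> * (LINT t|unit_edge. mult_weight p y j t * cnj (y j t))"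
    if j: "j \<in> {1..K}" for j
  proof -
    have yc: "continuous_on {0..1} (y j)" using d j by (auto simp: dom_L_def graph_AC_deriv_def intro: AC_deriv_continuous)
    have m: "diff_expr q y y'' j \<in> borel_measurable unit_edge" "(\<lambda>t. cnj (y j t)) \<in> borel_measurable unit_edge"
      using d j by (auto simp: dom_L_def graph_L2_def L2_edge_def
          intro!: borel_measurable_integrable integrable_continuous_edge continuous_intros yc)
    have "(LINT t|unit_edge. diff_expr q y y'' j t * cnj (y j t)) = (LINT t|unit_edge. \<mu> * (mult_weight p y j t * cnj (y j t)))"
    proof (rule integral_cong_AE)
      show "(\<lambda>t. diff_expr q y y'' j t * cnj (y j t)) \<in> borel_measurable unit_edge" using m by measurable
      show "(\<lambda>t. \<mu> * (mult_weight p y j t * cnj (y j t))) \<in> borel_measurable unit_edge"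
        unfolding mult_weight_def
        by (intro borel_measurable_integrable integrable_continuous_edge continuous_intros yc)
      show "AE t in unit_edge. diff_expr q y y'' j t * cnj (y j t) = \<mu> * (mult_weight p y j t * cnj (y j t))"
        using AE[OF j] by eventually_elim (simp add: mult.assoc)
    qed
    then show ?thesis by simp
  qed
  then have eq: "graph_inner K (diff_expr q y y'') y = \<mu> * indef_inner K p y y"
    by (simp add: graph_inner_def indef_inner_def sum_distrib_left)
  have "pos_number (\<mu> * indef_inner K p y y)"
    using L d y(2) unfolding L_positive_definite_def eq[symmetric] by blast
  moreover have "pos_number (indef_inner K p y y)" using y(3) by (simp add: C_plus_def)
  ultimately obtain a b where ab: "\<mu> * indef_inner K p y y = of_real a" "0 < a" "indef_inner K p y y = of_real b" "0 < b"
    unfolding pos_number_def by (metis Re_complex_of_real of_real_Re)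
  have "\<mu> = of_real (a / b)" using ab by (simp add: field_simps)
  moreover have "a / b \<in> pos_eigenvalues p"
    using y ab calculation by (auto simp: pos_eigenvalues_def)
  ultimately show "\<mu> \<in> complex_of_real ` pos_eigenvalues p" by blast
next
  fix \<mu> assume "\<mu> \<in> complex_of_real ` pos_eigenvalues p"
  then obtain l where l: "\<mu> = of_real l" "0 < l" "\<exists>y\<in>eigenspace K p q A \<mu>. nonzero_on_graph K y"
    by (auto simp: pos_eigenvalues_def)
  interpret Q: hermitian_form graph_scale V "weighted_inner K (weight p)" by (rule weighted_inner_hermitian)
  have "y \<in> C_plus K p" if y: "y \<in> eigenspace K p q A \<mu>" "nonzero_on_graph K y" for y
  proof -
    have V: "y \<in> V" using y eigenspace_V l(1) by blast
    have "graph_L2 K y" using C1_graph_cont[OF V_C1[OF V]] by (auto simp: graph_L2_def intro: L2_edge_continuous)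
    moreover have "0 < Re (weighted_inner K (weight p) y y)"
      using eigenspace_pos[OF L, of y p l] y l by (simp add: zero_less_mult_iff)
    ultimately show ?thesis
      using Q.diag_real[OF V] unfolding C_plus_def pos_number_def weighted_inner_eq_indef_inner
      by (metis (mono_tags, lifting) Reals_of_real mem_Collect_eq)
  qed
  then show "\<mu> \<in> eigenvalues_C_plus K p q A" using l by (auto simp: eigenvalues_C_plus_def)
qed

theorem eigenvalue_asymptotics:
  assumes p: "1 \<le> p" "p \<le> K" and L: "L_positive_definite K q A"
  shows "(\<exists>lam. lists_eigenvalues_C_plus K p q A lam) \<and>
    (\<forall>lam. lists_eigenvalues_C_plus K p q A lam \<longrightarrow> (\<lambda>n. sqrt (lam n) - real n * pi / real p) \<in> O(\<lambda>_. 1))"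
proof -
  let ?Q = "weighted_inner K (weight p)" and ?S = "\<lambda>l. eigenspace K p q A (complex_of_real l)"
  interpret Q: hermitian_form graph_scale V ?Q by (rule weighted_inner_hermitian)
  define E where "E = pos_eigenvalues p"
  define m where "m = (\<lambda>l. multiplicity_of K p q A (complex_of_real l))"
  obtain C where C: "0 \<le> C" "\<And>j. j \<in> {1..K} \<Longrightarrow> AE t in unit_edge. \<bar>q j t\<bar> \<le> C"
    using q_bound by blast
  have upper: "card T \<le> 2 * K + p * k"
    if asm: "Q.orthonormal T" "0 < r" "r + 2 * C < (real (Suc k) * pi)\<^sup>2" "\<And>e. e \<in> T \<Longrightarrow> \<exists>l. 0 < l \<and> l \<le> r \<and> e \<in> ?S l" for T r k
  proof (rule upper_test[OF p(2) C asm(1) _ asm(2,3)])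
    fix e assume "e \<in> T"
    then obtain l where "0 < l" "l \<le> r" "e \<in> ?S l" using asm(4) by blast
    then show "\<exists>\<mu>. 0 < \<mu> \<and> \<mu> \<le> r \<and> (\<forall>z\<in>V. F e z = of_real \<mu> * ?Q e z)"
      by (intro exI[of _ l] conjI ballI eigenspace_weak)
  qed
  have arch: "\<exists>k. x < (real (Suc k) * pi)\<^sup>2" for x
  proof -
    obtain k where k: "x < real k" using reals_Archimedean2 by blast
    have "real k \<le> real (Suc k) * 1" by simp
    also have "\<dots> \<le> real (Suc k) * pi" using pi_ge_two by (intro mult_left_mono) auto
    also have "\<dots> \<le> (real (Suc k) * pi)\<^sup>2"
    proof (rule self_le_power)
      show "1 \<le> real (Suc k) * pi" using pi_ge_two mult_mono[of 1 "real (Suc k)" 1 pi] by simp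
    qed simp
    finally show ?thesis using k by (intro exI[of _ k]) linarith
  qed
  have pos: "0 < Re (?Q x x)" if "x \<in> ?S l" "x \<noteq> 0" "0 < l" for x l
    using eigenspace_pos[OF L that(1) eigenspace_nonzero[OF that(1,2)]] that(3) by (simp add: zero_less_mult_iff)
  have "\<exists>T. Q.orthonormal T \<and> T \<subseteq> ?S l \<and> card T = m l \<and> (\<forall>x\<in>?S l. (\<forall>e\<in>T. ?Q x e = 0) \<longrightarrow> x = 0)"
    if l: "l \<in> E" for l
  proof -
    have l0: "0 < l" using l by (simp add: E_def pos_eigenvalues_def)
    obtain k where k: "l + 2 * C < (real (Suc k) * pi)\<^sup>2" using arch by blast
    have sub: "?S l \<subseteq> V" using eigenspace_V by blast
    have b: "card T \<le> 2 * K + p * k" if "Q.orthonormal T" "T \<subseteq> ?S l" for T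
      by (rule upper[OF that(1) l0 k]) (use that(2) l0 in blast)
    obtain T where T: "Q.orthonormal T" "T \<subseteq> ?S l" "card T = vector_space.dim graph_scale (?S l)"
        "\<And>x. x \<in> ?S l \<Longrightarrow> (\<And>e. e \<in> T \<Longrightarrow> ?Q x e = 0) \<Longrightarrow> x = 0"
      by (rule Q.maximal_orthonormal[OF eigenspace_subspace sub _ b]) (use pos l0 in blast)+
    then show ?thesis unfolding m_def multiplicity_of_def by blast
  qed
  \<comment> \<open>One maximal orthonormal set per eigenvalue: it has \<open>m l\<close> elements,
    and only 0 in the eigenspace is orthogonal to it.\<close>
  then obtain T where T: "\<And>l. l \<in> E \<Longrightarrow> Q.orthonormal (T l)" "\<And>l. l \<in> E \<Longrightarrow> T l \<subseteq> ?S l" "\<And>l. l \<in> E \<Longrightarrow> card (T l) = m l"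
    "\<And>l x. l \<in> E \<Longrightarrow> x \<in> ?S l \<Longrightarrow> (\<And>e. e \<in> T l \<Longrightarrow> ?Q x e = 0) \<Longrightarrow> x = 0"
    by metis
  have cross: "?Q x y = 0" if "l \<in> E" "l' \<in> E" "l \<noteq> l'" "x \<in> T l" "y \<in> T l'" for l l' x y
    by (rule eigenspace_orthogonal[of x p l y l']) (use that T(2) in auto)
  have norm1: "?Q x x = 1" if "l \<in> E" "x \<in> T l" for l x
    using T(1)[OF that(1)] that(2) by (simp add: Q.orthonormal_def)
  have disj: "T l \<inter> T l' = {}" if "l \<in> E" "l' \<in> E" "l \<noteq> l'" for l l'
    using cross[OF that] norm1[OF that(1)] by fastforce
  \<comment> \<open>Different eigenspaces are orthogonal to each other, and members of square 1
    cannot be orthogonal to themselves, so the sets are disjoint and their union is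
    orthonormal.\<close>
  have union: "Q.orthonormal (\<Union>l\<in>X. T l) \<and> card (\<Union>l\<in>X. T l) = (\<Sum>l\<in>X. m l)" if X: "finite X" "X \<subseteq> E" for X
  proof
    have fin: "finite (T l)" "T l \<subseteq> V" if "l \<in> X" for l using T(1) that X by (auto simp: Q.orthonormal_def)
    show "Q.orthonormal (\<Union>l\<in>X. T l)"
      unfolding Q.orthonormal_def
    proof (intro conjI ballI)
      show "finite (\<Union>l\<in>X. T l)" using X fin by blast
      show "(\<Union>l\<in>X. T l) \<subseteq> V" using fin by blast
      fix x y assume "x \<in> (\<Union>l\<in>X. T l)" "y \<in> (\<Union>l\<in>X. T l)"
      then obtain l l' where l: "l \<in> X" "l' \<in> X" "x \<in> T l" "y \<in> T l'" by blast
      show "?Q x y = (if x = y then 1 else 0)"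
      proof (cases "l = l'")
        case True
        then show ?thesis using T(1)[of l] l X by (auto simp: Q.orthonormal_def)
      next
        case False
        then have "?Q x y = 0" "x \<noteq> y" using cross[of l l' x y] disj[of l l'] l X by auto
        then show ?thesis by simp
      qed
    qed
    have "card (\<Union>l\<in>X. T l) = (\<Sum>l\<in>X. card (T l))"
      by (rule card_UN_disjoint[OF X(1)]) (use fin disj X in blast)+
    also have "\<dots> = (\<Sum>l\<in>X. m l)" using T(3) X by (intro sum.cong) auto
    finally show "card (\<Union>l\<in>X. T l) = (\<Sum>l\<in>X. m l)" .
  qed
  have m_pos: "0 < m l" if l: "l \<in> E" for l
  proof (rule ccontr)
    assume "\<not> 0 < m l"
    then have "T l = {}" using T(1,3)[OF l] by (simp add: Q.orthonormal_def)
    moreover obtain y where y: "y \<in> ?S l" "nonzero_on_graph K y" using l by (auto simp: E_def pos_eigenvalues_def)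
    ultimately have "y = 0" using T(4)[OF l y(1)] by simp
    then show False using y(2) by (auto simp: nonzero_on_graph_def)
  qed
  \<comment> \<open>Stated for finite \<open>X\<close> because finiteness of the set of eigenvalues
    below \<open>r\<close> is itself deduced from this uniform bound.\<close>
  have sum_le: "(\<Sum>l\<in>X. m l) \<le> 2 * K + p * k"
    if X: "finite X" "X \<subseteq> {l \<in> E. l \<le> r}" and r: "0 < r" "r + 2 * C < (real (Suc k) * pi)\<^sup>2" for X r k
  proof -
    have XE: "X \<subseteq> E" using X by blast
    have "card (\<Union>l\<in>X. T l) \<le> 2 * K + p * k"
    proof (rule upper[OF _ r])
      show "Q.orthonormal (\<Union>l\<in>X. T l)" using union[OF X(1) XE] by blast
      fix e assume "e \<in> (\<Union>l\<in>X. T l)"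
      then obtain l where l: "l \<in> X" "e \<in> T l" by blast
      then have "l \<in> E" "l \<le> r" using X by auto
      then show "\<exists>l. 0 < l \<and> l \<le> r \<and> e \<in> ?S l"
        using T(2) l by (intro exI[of _ l]) (auto simp: E_def pos_eigenvalues_def)
    qed
    then show ?thesis using union[OF X(1) XE] by simp
  qed
  interpret D: discrete_multiset E m
  proof
    fix r
    obtain k where k: "max r 1 + 2 * C < (real (Suc k) * pi)\<^sup>2" using arch by blast
    have "card X \<le> 2 * K + p * k" if X: "X \<subseteq> {l \<in> E. l \<le> r}" "finite X" for X
    proof -
      have "card X = (\<Sum>l\<in>X. 1)" by simp
      also have "\<dots> \<le> (\<Sum>l\<in>X. m l)" using m_pos X by (intro sum_mono) (auto simp: Suc_le_eq)
      also have "\<dots> \<le> 2 * K + p * k" by (rule sum_le[OF X(2) _ _ k]) (use X in auto)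
      finally show ?thesis .
    qed
    then show "finite {l \<in> E. l \<le> r}" using finite_if_finite_subsets_card_bdd[of "{l \<in> E. l \<le> r}"] by blast
  qed (rule m_pos)
  have N_upper: "D.N r \<le> 2 * K + p * k" if "0 < r" "r + 2 * C < (real (Suc k) * pi)\<^sup>2" for r k
    unfolding D.N_def by (rule sum_le[OF D.finite_below subset_refl that])
  obtain c where c: "0 < c" "\<And>y. y \<in> V \<Longrightarrow> c * (energy0 K y + energy1 K y) \<le> Re (F y y)"
    using coercive[OF _ L] p by (metis le_trans)
  have N_lower: "p * k \<le> D.N r" if r: "(real k * pi)\<^sup>2 + C < r" for r k
  proof (rule ccontr)
    assume neg: "\<not> p * k \<le> D.N r"
    let ?X = "{l \<in> E. l \<le> r}"
    let ?U = "\<Union>l\<in>?X. T l"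
    have U: "Q.orthonormal ?U" "card ?U = D.N r"
      using union[OF D.finite_below] unfolding D.N_def by auto
    then have "finite ?U" "?U \<subseteq> V" by (auto simp: Q.orthonormal_def)
    then obtain w where w: "w \<in> V" "\<And>e. e \<in> ?U \<Longrightarrow> ?Q w e = 0" "0 < Re (?Q w w)" "Re (F w w) < r * Re (?Q w w)"
      using lower_test[OF p(2) C(2) _ _ _ r, of ?U] U(2) neg by auto
    have "\<forall>e\<in>?U. \<exists>\<mu>. \<forall>z\<in>V. F e z = complex_of_real \<mu> * ?Q e z"
      using T(2) eigenspace_weak by blast
    then obtain \<mu> where \<mu>: "\<And>e z. e \<in> ?U \<Longrightarrow> z \<in> V \<Longrightarrow> F e z = complex_of_real (\<mu> e) * ?Q e z" by metis
    obtain l y y' y'' where y: "0 < l" "solution (weight p) l y y' y''" "?Q y y = 1" "\<And>e. e \<in> ?U \<Longrightarrow> ?Q y e = 0"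
      "\<And>j t. \<not> (j \<in> {1..K} \<and> t \<in> {0..1}) \<Longrightarrow> y j t = 0"
      "\<And>x. x \<in> V \<Longrightarrow> (\<And>e. e \<in> ?U \<Longrightarrow> ?Q x e = 0) \<Longrightarrow> l * Re (?Q x x) \<le> Re (F x x)"
      by (rule direct_method[OF c U(1) \<mu> w(1,2,3)]) blast+
    \<comment> \<open>The test vector \<open>w\<close> competes in the minimisation, which places
      the new eigenvalue below \<open>r\<close>.\<close>
    have "l * Re (?Q w w) < r * Re (?Q w w)" using y(6)[OF w(1,2)] w(4) by linarith
    then have "l < r" using w(3) by simp
    have yS: "y \<in> ?S l" unfolding eigenspace_iff_solution using y(2,5) by blast
    have "nonzero_on_graph K y" by (rule nonzero_on_graph_if[of "weight p"]) (simp add: y(3))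
    then have lX: "l \<in> ?X" using yS y(1) \<open>l < r\<close> by (auto simp: E_def pos_eigenvalues_def)
    \<comment> \<open>As \<open>l\<close> lies in \<open>?X\<close>, the new eigenfunction is
      orthogonal to the maximal set \<open>T l\<close> of its own eigenspace, which contradicts
      \<open>?Q y y = 1\<close>.\<close>
    have "y = 0" by (rule T(4)[OF _ yS]) (use lX y(4) in blast)+
    then show False using y(3) Q.zero_left[of 0] Q.subspace_V eigenspace_V[OF yS] by simp
  qed
  have unb: "\<exists>r. n \<le> D.N r" for n
  proof -
    have "p * n \<le> D.N ((real n * pi)\<^sup>2 + C + 1)" by (rule N_lower) simp
    moreover have "n \<le> p * n" using p(1) by simp
    ultimately show ?thesis by (meson le_trans)
  qed
  \<comment> \<open>The definition ranges over complex numbers; a non-real one is neither a value of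
    \<open>lam\<close> nor a member of \<open>eigenvalues_C_plus\<close>, so both counts are 0
    there.\<close>
  have lists: "lists_eigenvalues_C_plus K p q A lam \<longleftrightarrow> D.enumerates lam" for lam
  proof -
    let ?A = "\<lambda>\<mu>::complex. {n\<in>{1..}. of_real (lam n) = \<mu>}"
    let ?P = "\<lambda>\<mu>::complex. finite (?A \<mu>) \<and> card (?A \<mu>) = (if \<mu> \<in> eigenvalues_C_plus K p q A then multiplicity_of K p q A \<mu> else 0)"
    have real: "?P (of_real x) \<longleftrightarrow> finite {n\<in>{1..}. lam n = x} \<and> card {n\<in>{1..}. lam n = x} = (if x \<in> E then m x else 0)" for x
      unfolding eigenvalues_C_plus_eq[OF L] E_def m_def by (simp add: inj_image_mem_iff inj_of_real)
    have nonreal: "?P \<mu>" if "\<mu> \<notin> \<real>" for \<mu>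
    proof -
      have A: "?A \<mu> = {}" and "\<mu> \<notin> eigenvalues_C_plus K p q A"
        using that unfolding eigenvalues_C_plus_eq[OF L] by auto
      then show ?thesis unfolding A by simp
    qed
    have "(\<forall>\<mu>. ?P \<mu>) \<longleftrightarrow> (\<forall>x. ?P (of_real x))"
    proof (intro iffI allI)
      fix \<mu> assume a: "\<forall>x. ?P (of_real x)"
      show "?P \<mu>"
      proof (cases "\<mu> \<in> \<real>")
        case True
        then obtain x where "\<mu> = of_real x" by (rule Reals_cases)
        then show ?thesis using a by blast
      qed (rule nonreal)
    qed blast
    then show ?thesis unfolding lists_eigenvalues_C_plus_def D.enumerates_def real by simp
  qed
  show ?thesis
    unfolding lists
  proof (intro conjI allI impI)
    show "\<exists>lam. D.enumerates lam" by (rule D.enumerates_exists[OF unb])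
    fix lam assume "D.enumerates lam"
    then show "(\<lambda>n. sqrt (lam n) - real n * pi / real p) \<in> O(\<lambda>_. 1)"
      by (rule D.sqrt_asymptotics[OF _ _ p(1) C(1) N_upper N_lower]) (simp add: E_def pos_eigenvalues_def)
  qed
qed

end

lemma length_G_plus_eq:
  assumes "p \<le> K"
  shows "length_G_plus K p = real p"
proof -
  have "{j\<in>{1..K}. weight p j = 1} = {1..p}" using assms by (auto simp: weight_def split: if_splits)
  then show ?thesis by (simp add: length_G_plus_def)
qed

theorem theorem7p1:
  fixes G :: "('v, nat) pre_digraph"
    and K p :: nat
    and q :: "nat \<Rightarrow> real \<Rightarrow> real"
    and A :: bdry_cond
  assumes "fin_digraph G" and "arcs G = {1..K}"
    and "1 \<le> p" and "p \<le> K"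
    and "ess_bounded_potential K q"
    and "dirichlet_rows K A" and "independent_rows K A" and "all_dirichlet_in_I K A"
    and "nodal_conditions G K A"
    and "formally_self_adjoint K q A"
    and "co_normal K A"
    and "L_positive_definite K q A"
  shows "(\<exists>lam. lists_eigenvalues_C_plus K p q A lam) \<and>
    (\<forall>lam. lists_eigenvalues_C_plus K p q A lam \<longrightarrow>
      (\<lambda>n. sqrt (lam n) - real n * pi / length_G_plus K p) \<in> O(\<lambda>_. 1))"
proof -
  obtain f :: graph_fun where f: "\<And>x x' x''. x \<in> dom_F K A \<Longrightarrow> graph_H2 K x x' x'' \<Longrightarrow>
      (\<forall>y\<in>dom_F K A. bdry_integral K (\<lambda>j t. (f j t * x j t + x' j t) * cnj (y j t)) = 0) \<longleftrightarrow> satisfies_II K A x x'"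
    using \<open>co_normal K A\<close> unfolding co_normal_def by blast
  interpret graph_form K q A f
  proof
    show "ess_bounded_potential K q" by fact
    show "bdry_integral K (\<lambda>j t. f j t * y j t * cnj (x j t)) = cnj (bdry_integral K (\<lambda>j t. f j t * x j t * cnj (y j t)))"
      if "satisfies_I K A x" "satisfies_I K A y" for x y
      by (rule bdry_integral_hermitian[OF \<open>ess_bounded_potential K q\<close> \<open>formally_self_adjoint K q A\<close> f that])
  qed (rule f)
  show ?thesis
    unfolding length_G_plus_eq[OF \<open>p \<le> K\<close>]
    by (rule eigenvalue_asymptotics[OF \<open>1 \<le> p\<close> \<open>p \<le> K\<close> \<open>L_positive_definite K q A\<close>])
qed

end
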